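(* Let $A$ be a $(\mathbb{Z}_2)^n$-graded commutative algebra, $n\ge 1$, $p=2^n$, and $\mathbf{r}\in\mathbb{N}^p$. There is a unique group homomorphism $$\Gamma\mathrm{Ber}:\mathsf{GL}^0(\mathbf{r};A)\to(A^0)^\times$$ such that: (1) for every $2\times2$ block-diagonal matrix $\mathcal{X}=\begin{pmatrix}\mathcal{X}_{11}&0\\0&\mathcal{X}_{22}\end{pmatrix}\in\mathsf{GL}^0(\mathbf{r};A)$, $$\Gamma\mathrm{Ber}(\mathcal{X})=\Gamma\!\det(\mathcal{X}_{11})\cdot\Gamma\!\det(\mathcal{X}_{22})^{-1}\in(A^0)^\times;$$ (2) the image of any lower (resp., upper) $2\times2$ block-unitriangular matrix in $\mathsf{GL}^0(\mathbf{r};A)$ equals $1\in(A^0)^\times$.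
   Context: The group $(\mathbb{Z}_2)^n$ carries the $\mathbb{Z}_2$-valued scalar product $\langle\gamma,\gamma'\rangle=\sum_i\gamma_i\gamma'_i$; $\gamma$ is even if $\langle\gamma,\gamma\rangle=0$ and odd otherwise. The elements are listed as $\gamma_1,\dots,\gamma_p$, $p=2^n$: first the $q=2^{n-1}$ even ones, then the $q$ odd ones, each group ordered lexicographically. A $(\mathbb{Z}_2)^n$-graded commutative algebra is an associative unital algebra $A=\bigoplus_\gamma A^\gamma$ over a field of characteristic $0$ with $A^\gamma A^\delta\subset A^{\gamma+\delta}$ and $ba=(-1)^{\langle\tilde a,\tilde b\rangle}ab$ for homogeneous $a,b$ of degrees $\tilde a,\tilde b$. $(A^0)^\times$ is the group of invertible elements of $A^0$. $\mathsf{M}^0(\mathbf{r};A)$ is the algebra of $p\times p$ block matrices $X=(X_{ku})$ with $X_{ku}$ of size $r_k\times r_u$ and entries in $A^{\gamma_k+\gamma_u}$; $\mathsf{GL}^0(\mathbf{r};A)$ is its group of invertible elements. Splitting the block indices into even ($1,\dots,q$) and odd ($q+1,\dots,p$), each such $X$ is also written as a $2\times2$ block matrix $\mathcal{X}=(\mathcal{X}_{k\ell})$; $\mathcal{X}_{11},\mathcal{X}_{22}$ have entries of even degree and $\mathcal{X}_{12},\mathcal{X}_{21}$ have entries of odd degree. "$2\times 2$ block-unitriangular" means block triangular with respect to this $2\times2$ division with identity diagonal blocks. Graded determinant $\Gamma\!\det$: let $\delta_1,\dots,\delta_q$ be the list of even elements (for $\mathcal{X}_{11}$) or of odd elements (for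 $\mathcal{X}_{22}$), and let $Z=(Z_{ku})$ be a $q\times q$ block matrix with square diagonal blocks and $Z_{ku}$ having entries in $A^{\delta_k+\delta_u}$ (such matrices are regarded as purely even graded matrices of degree $0$ over $\bigoplus_{\gamma\ \mathrm{even}}A^\gamma$). $\Gamma\!\det$ is the unique map from such matrices to $A^0$ that is multiplicative, equals $\prod_k\det Z_{kk}$ on block-diagonal matrices, and equals $1$ on block-unitriangular matrices. Explicitly it is the polynomial in the entries of $Z$ which coincides with $\prod_{k=0}^{q-1}\det\bigl|Z^{1\ldots k,1\ldots k}\bigr|_{k+1\,k+1}$ whenever the inverses involved exist; here $Z^{1\ldots k,1\ldots k}$ is $Z$ with its first $k$ block rows and block columns deleted, and $|Z^{1\ldots k,1\ldots k}|_{k+1\,k+1}=Z_{k+1,k+1}-r\,(Z^{1\ldots k+1,1\ldots k+1})^{-1}c$, with $r=(Z_{k+1,b})_{b>k+1}$ and $c=(Z_{a,k+1})_{a>k+1}$ (this matrix has entries in the commutative algebra $A^0$). *)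

theory Defs
  imports
    "HOL-Library.Z2"
    "HOL-Library.FuncSet"
    "HOL-Combinatorics.Permutations"
    "HOL-Algebra.Group"
    "Jordan_Normal_Form.Matrix"
begin

type_synonym degree = "bit list"

definition degrees :: "nat \<Rightarrow> degree set" where
  "degrees n = {\<gamma>. length \<gamma> = n}"

definition deg_zero :: "nat \<Rightarrow> degree" where
  "deg_zero n = replicate n 0"

definition deg_add :: "degree \<Rightarrow> degree \<Rightarrow> degree" where
  "deg_add \<gamma> \<delta> = map2 (+) \<gamma> \<delta>"

definition deg_scalar :: "degree \<Rightarrow> degree \<Rightarrow> bit" where
  "deg_scalar \<gamma> \<delta> = sum_list (map2 (*) \<gamma> \<delta>)"

text \<open>\<^const>\<open>product_lists\<close> enumerates \<open>{0, 1}\<^sup>n\<close> in lexicographic order.\<close>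

definition even_degrees :: "nat \<Rightarrow> degree list" where
  "even_degrees n = filter (\<lambda>\<gamma>. deg_scalar \<gamma> \<gamma> = 0) (product_lists (replicate n [0, 1]))"

definition odd_degrees :: "nat \<Rightarrow> degree list" where
  "odd_degrees n = filter (\<lambda>\<gamma>. deg_scalar \<gamma> \<gamma> = 1) (product_lists (replicate n [0, 1]))"

definition degree_list :: "nat \<Rightarrow> degree list" where
  "degree_list n = even_degrees n @ odd_degrees n"


text \<open>The sort \<open>{ring, monoid_mult}\<close> is that of associative unital rings, without the
  requirement \<open>0 \<noteq> 1\<close> of \<^class>\<open>ring_1\<close>.\<close>

locale graded_commutative_algebra = vector_space scale
  for scale :: "'k::field_char_0 \<Rightarrow> 'a::{ring, monoid_mult} \<Rightarrow> 'a" +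
  fixes n :: nat
    and A :: "degree \<Rightarrow> 'a set"
  assumes scale_mult_left: "scale c (a * b) = scale c a * b"
    and scale_mult_right: "scale c (a * b) = a * scale c b"
    and homogeneous_subspace: "\<gamma> \<in> degrees n \<Longrightarrow> subspace (A \<gamma>)"
    and direct_sum:
      "\<exists>!f. f \<in> (\<Pi>\<^sub>E \<gamma>\<in>degrees n. A \<gamma>) \<and> a = (\<Sum>\<gamma>\<in>degrees n. f \<gamma>)"
    and graded_mult:
      "\<lbrakk>\<gamma> \<in> degrees n; \<delta> \<in> degrees n; a \<in> A \<gamma>; b \<in> A \<delta>\<rbrakk> \<Longrightarrow> a * b \<in> A (deg_add \<gamma> \<delta>)"
    and graded_commute:
      "\<lbrakk>\<gamma> \<in> degrees n; \<delta> \<in> degrees n; a \<in> A \<gamma>; b \<in> A \<delta>\<rbrakk>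
        \<Longrightarrow> b * a = (if deg_scalar \<gamma> \<delta> = 0 then a * b else - (a * b))"

definition degree0_monoid :: "nat \<Rightarrow> (degree \<Rightarrow> 'a::monoid_mult set) \<Rightarrow> 'a monoid" where
  "degree0_monoid n A = \<lparr>carrier = A (deg_zero n), mult = (*), one = 1\<rparr>"

abbreviation degree0_units :: "nat \<Rightarrow> (degree \<Rightarrow> 'a::monoid_mult set) \<Rightarrow> 'a monoid" where
  "degree0_units n A \<equiv> units_of (degree0_monoid n A)"


text \<open>A block matrix whose \<open>k\<close>-th block row and block column have size \<open>rs ! k\<close> and degree
  \<open>ds ! k\<close> is stored as one flat matrix of size \<^term>\<open>sum_list rs\<close>; \<open>index_degrees ds rs\<close> lists
  the degrees of its individual rows (and columns).\<close>

definition index_degrees :: "degree list \<Rightarrow> nat list \<Rightarrow> degree list" where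
  "index_degrees ds rs = concat (map2 (\<lambda>d m. replicate m d) ds rs)"

definition graded_mats ::
    "(degree \<Rightarrow> 'a set) \<Rightarrow> degree list \<Rightarrow> nat list \<Rightarrow> 'a mat set" where
  "graded_mats A ds rs = {X \<in> carrier_mat (sum_list rs) (sum_list rs).
     \<forall>i<sum_list rs. \<forall>j<sum_list rs.
       X $$ (i, j) \<in> A (deg_add (index_degrees ds rs ! i) (index_degrees ds rs ! j))}"

definition graded_mat_monoid ::
    "(degree \<Rightarrow> 'a::{ring, monoid_mult} set) \<Rightarrow> degree list \<Rightarrow> nat list \<Rightarrow> 'a mat monoid" where
  "graded_mat_monoid A ds rs =
     \<lparr>carrier = graded_mats A ds rs, mult = (*), one = 1\<^sub>m (sum_list rs)\<rparr>"

definition GL0 ::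
    "nat \<Rightarrow> (degree \<Rightarrow> 'a::{ring, monoid_mult} set) \<Rightarrow> nat list \<Rightarrow> 'a mat monoid" where
  "GL0 n A rs = units_of (graded_mat_monoid A (degree_list n) rs)"


text \<open>The Leibniz determinant. It is only used for matrices with entries in the commutative
  algebra \<open>A\<^sup>0\<close>, where the order of the factors is irrelevant; the determinants of the libraries
  require a commutative ring type.\<close>

definition leibniz_det :: "'a::{ring, monoid_mult} mat \<Rightarrow> 'a" where
  "leibniz_det M = (\<Sum>\<pi> | \<pi> permutes {..<dim_row M}.
     let m = prod_list (map (\<lambda>i. M $$ (i, \<pi> i)) [0..<dim_row M])
     in if evenperm \<pi> then m else - m)"

text \<open>\<open>trailing rs k Z\<close> is \<open>Z\<close> without its first \<open>k\<close> block rows and block columns.\<close>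

definition trailing :: "nat list \<Rightarrow> nat \<Rightarrow> 'a mat \<Rightarrow> 'a mat" where
  "trailing rs k Z = (let m = sum_list (take k rs) in
     mat (dim_row Z - m) (dim_col Z - m) (\<lambda>(i, j). Z $$ (i + m, j + m)))"

text \<open>Blocks are counted from \<open>0\<close>: this is the quasideterminant of \<open>trailing rs k Z\<close> at its
  first diagonal block.\<close>

definition quasidet ::
    "(degree \<Rightarrow> 'a::{ring, monoid_mult} set) \<Rightarrow> degree list \<Rightarrow> nat list \<Rightarrow> nat \<Rightarrow> 'a mat \<Rightarrow> 'a mat" where
  "quasidet A ds rs k Z =
     (case split_block (trailing rs k Z) (rs ! k) (rs ! k) of (Zkk, R, C, D) \<Rightarrow>
        Zkk - R * (inv\<^bsub>graded_mat_monoid A (drop (Suc k) ds) (drop (Suc k) rs)\<^esub> D) * C)"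

definition quasidets_exist ::
    "(degree \<Rightarrow> 'a::{ring, monoid_mult} set) \<Rightarrow> degree list \<Rightarrow> nat list \<Rightarrow> 'a mat \<Rightarrow> bool" where
  "quasidets_exist A ds rs Z \<longleftrightarrow>
     (\<forall>k<length rs. trailing rs (Suc k) Z
        \<in> Units (graded_mat_monoid A (drop (Suc k) ds) (drop (Suc k) rs)))"

inductive_set entry_polynomials ::
    "('k::field_char_0 \<Rightarrow> 'a::{ring, monoid_mult} \<Rightarrow> 'a) \<Rightarrow> nat \<Rightarrow> ('a mat \<Rightarrow> 'a) set"
  for scale :: "'k::field_char_0 \<Rightarrow> 'a::{ring, monoid_mult} \<Rightarrow> 'a" and N :: nat where
  const: "(\<lambda>Z. scale c 1) \<in> entry_polynomials scale N"
| entry: "\<lbrakk>i < N; j < N\<rbrakk> \<Longrightarrow> (\<lambda>Z. Z $$ (i, j)) \<in> entry_polynomials scale N"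
| add: "\<lbrakk>P \<in> entry_polynomials scale N; Q \<in> entry_polynomials scale N\<rbrakk>
    \<Longrightarrow> (\<lambda>Z. P Z + Q Z) \<in> entry_polynomials scale N"
| mult: "\<lbrakk>P \<in> entry_polynomials scale N; Q \<in> entry_polynomials scale N\<rbrakk>
    \<Longrightarrow> (\<lambda>Z. P Z * Q Z) \<in> entry_polynomials scale N"

text \<open>The graded determinant: the value at \<open>Z\<close> of the polynomial in the entries that coincides with
  the product of the determinants of the quasideterminants whenever the latter exist. Any two such
  polynomials agree as functions on \<^term>\<open>graded_mats A ds rs\<close>, because the ground field is
  infinite. (The characterisation by multiplicativity and by the values on block-diagonal and
  block-unitriangular matrices does not determine a function over every single algebra \<open>A\<close>.)\<close>

definition graded_det ::
    "('k::field_char_0 \<Rightarrow> 'a::{ring, monoid_mult} \<Rightarrow> 'a) \<Rightarrow> (degree \<Rightarrow> 'a set)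
      \<Rightarrow> degree list \<Rightarrow> nat list \<Rightarrow> 'a mat \<Rightarrow> 'a" where
  "graded_det scale A ds rs Z =
     (THE d. \<exists>P \<in> entry_polynomials scale (sum_list rs).
        (\<forall>W \<in> graded_mats A ds rs. quasidets_exist A ds rs W \<longrightarrow>
           P W = prod_list (map (\<lambda>k. leibniz_det (quasidet A ds rs k W)) [0..<length rs]))
        \<and> d = P Z)"

end

theory Submission
  imports Defs "Jordan_Normal_Form.Determinant"
begin

text \<open>
The proof turns graded-commutative linear algebra into ordinary linear algebra over a commutative
  ring, as far as matrices with entries of even degree are concerned, and handles the odd blocks by
  one determinant identity.

  \<^bold>\<open>The sign twist.\<close> The bilinear form $\sigma(\gamma, \delta) = \sum_{i<j} \gamma_i \delta_j$
  satisfies $\sigma(\gamma, \delta) + \sigma(\delta, \gamma) = \langle\gamma, \delta\rangle +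
  \langle\gamma, \gamma\rangle \langle\delta, \delta\rangle$ (\<open>twist_commute\<close>). Multiplying $ab$ by
  $(-1)^{\sigma(\gamma, \delta)}$ for homogeneous $a$, $b$ keeps associativity and makes the algebra
  commutative in the super sense; in particular its even part becomes a commutative ring
  (\<open>comm_ring_on_even_part\<close>). The sign change $x_{ij} \mapsto (-1)^{\sigma(\gamma_i + \gamma_j, \gamma_j)}
  x_{ij}$ of the entries is compatible with matrix multiplication (\<open>twisted_entry_mult\<close>). Hence a
  square graded matrix whose indices have degrees of one parity has an ordinary determinant over the
  twisted even part, called \<open>gdet\<close> below. The Leibniz formula shows that \<open>gdet\<close> has values in $A^0$
  and is a polynomial in the original entries. It is multiplicative, and the Schur complement
  formula identifies it with the product of the determinants of the quasideterminants.

  \<^bold>\<open>Well-definedness of the graded determinant.\<close> A polynomial in the entries that vanishes whenever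
  the quasideterminants exist vanishes everywhere (\<open>entry_polynomial_vanishing\<close>). Invertible elements
  may be rare in $A^0$, so genericity is used one diagonal entry at a time: if the trailing minor
  after the $m$-th index is invertible, then a shift of the $m$-th diagonal entry can make the next
  minor a nonzero scalar multiple of it, and there are infinitely many such shifts. Therefore
  \<open>graded_det\<close> equals \<open>gdet\<close> (\<open>graded_det_eq_gdet\<close>).

  \<^bold>\<open>The odd blocks.\<close> For odd blocks $B$, $C$ one has $\det(1 + BC)\,\det(1 + CB) = 1$
  (\<open>gdet_one_plus_odd\<close>). If $B$ has a single nonzero entry $b$, the factors are $1 + bc$ and $1 - bc$
  with $b^2 = 0$; and the matrices $B$ for which the identity holds for all $C$ are closed under
  addition. Consequently the diagonal blocks of an invertible matrix are invertible, and every
  invertible matrix becomes block-diagonal after multiplication by unitriangular matrices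
  (\<open>unitriangular_diagonalization\<close>), which gives uniqueness.

  \<^bold>\<open>Existence.\<close> The Berezinian is defined by $\mathrm{Ber}(X)^{-1} = \det((X^{-1})_{11}) \det(X_{22})$.
  With $C = X_{22}^{-1} X_{21}$ and $B = Y_{12} Y_{22}^{-1}$ one finds
  $(XY)_{22} = X_{22} (1 + CB) Y_{22}$ and
  $((XY)^{-1})_{11} = (Y^{-1})_{11} (1 + BC) (X^{-1})_{11}$, so the same identity makes it
  multiplicative (\<open>inverse_ber_mult\<close>).
\<close>


section \<open>A commutative ring type above all commutative rings on subsets of a type\<close>

definition comm_ring_on :: "'a::ab_group_add set \<Rightarrow> ('a \<Rightarrow> 'a \<Rightarrow> 'a) \<Rightarrow> 'a \<Rightarrow> bool" where
  "comm_ring_on S m e \<longleftrightarrow>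
     0 \<in> S \<and> e \<in> S
     \<and> (\<forall>x\<in>S. - x \<in> S \<and> m e x = x)
     \<and> (\<forall>x\<in>S. \<forall>y\<in>S. x + y \<in> S \<and> m x y \<in> S \<and> m x y = m y x)
     \<and> (\<forall>x\<in>S. \<forall>y\<in>S. \<forall>z\<in>S. m (m x y) z = m x (m y z) \<and> m (x + y) z = m x z + m y z)"

lemma comm_ring_on_closed:
  assumes "comm_ring_on S m e"
  shows "0 \<in> S" "e \<in> S" "x \<in> S \<Longrightarrow> - x \<in> S"
    "x \<in> S \<Longrightarrow> y \<in> S \<Longrightarrow> x + y \<in> S" "x \<in> S \<Longrightarrow> y \<in> S \<Longrightarrow> m x y \<in> S"
  using assms by (simp_all add: comm_ring_on_def)

lemma comm_ring_on_laws:
  assumes "comm_ring_on S m e" "x \<in> S"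
  shows "m e x = x" "y \<in> S \<Longrightarrow> m x y = m y x"
    "y \<in> S \<Longrightarrow> z \<in> S \<Longrightarrow> m (m x y) z = m x (m y z)"
    "y \<in> S \<Longrightarrow> z \<in> S \<Longrightarrow> m (x + y) z = m x z + m y z"
  using assms unfolding comm_ring_on_def by blast+

lemma comm_ring_on_mult_zero:
  assumes "comm_ring_on S m e"
  shows "m 0 0 = 0"
proof -
  have "m (0 + 0) 0 = m 0 0 + m 0 0"
    using assms unfolding comm_ring_on_def by blast
  then show ?thesis by simp
qed

text \<open>
  The determinant of a matrix is taken over a commutative ring type, whereas the rings of interest are
  carried by a subset of \<open>'a\<close> that depends on the grading, with a product other than that of \<open>'a\<close>.
  The product of all commutative rings carried by subsets of \<open>'a\<close> is a single type and projects onto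
  each of them, so that determinant identities can be transported along the projections. The additional
  factor \<^typ>\<open>int\<close> ensures \<open>0 \<noteq> 1\<close>, even if \<open>'a\<close> has only one element.
\<close>

type_synonym 'a ring_structure = "'a set \<times> ('a \<Rightarrow> 'a \<Rightarrow> 'a) \<times> 'a"

typedef (overloaded) 'a universal_ring =
  "{(f :: 'a::ab_group_add ring_structure \<Rightarrow> 'a, z :: int).
     \<forall>S m e. (comm_ring_on S m e \<longrightarrow> f (S, m, e) \<in> S) \<and> (\<not> comm_ring_on S m e \<longrightarrow> f (S, m, e) = 0)}"
  by (rule exI[of _ "(\<lambda>_. 0, 0)"]) (auto intro: comm_ring_on_closed)

setup_lifting type_definition_universal_ring

instantiation universal_ring :: (ab_group_add) comm_ring_1
begin

lift_definition zero_universal_ring :: "'a universal_ring" is "(\<lambda>_. 0, 0)"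
  by (auto intro: comm_ring_on_closed)

lift_definition one_universal_ring :: "'a universal_ring" is
  "(\<lambda>(S, m, e). if comm_ring_on S m e then e else 0, 1)"
  by (auto intro: comm_ring_on_closed)

lift_definition plus_universal_ring :: "'a universal_ring \<Rightarrow> 'a universal_ring \<Rightarrow> 'a universal_ring" is
  "\<lambda>(f, z) (g, w). (\<lambda>\<sigma>. f \<sigma> + g \<sigma>, z + w)"
  by (auto intro: comm_ring_on_closed)

lift_definition uminus_universal_ring :: "'a universal_ring \<Rightarrow> 'a universal_ring" is
  "\<lambda>(f, z). (\<lambda>\<sigma>. - f \<sigma>, - z)"
  by (auto intro: comm_ring_on_closed)

definition minus_universal_ring :: "'a universal_ring \<Rightarrow> 'a universal_ring \<Rightarrow> 'a universal_ring" where
  "minus_universal_ring x y = x + - y"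

lift_definition times_universal_ring :: "'a universal_ring \<Rightarrow> 'a universal_ring \<Rightarrow> 'a universal_ring" is
  "\<lambda>(f, z) (g, w).
     (\<lambda>(S, m, e). if comm_ring_on S m e then m (f (S, m, e)) (g (S, m, e)) else 0, z * w)"
  by (auto intro: comm_ring_on_closed)

instance
proof
  fix a b c :: "'a universal_ring"
  show "a * b * c = a * (b * c)"
    by transfer (auto simp: fun_eq_iff comm_ring_on_laws(3))
  show "a * b = b * a"
    by transfer (auto simp: fun_eq_iff comm_ring_on_laws(2))
  show "1 * a = a"
    by transfer (auto simp: fun_eq_iff comm_ring_on_laws(1))
  show "a + b + c = a + (b + c)"
    by transfer (auto simp: fun_eq_iff)
  show "a + b = b + a"
    by transfer (auto simp: fun_eq_iff)
  show "0 + a = a"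
    by transfer (auto simp: fun_eq_iff)
  show "- a + a = 0"
    by transfer (auto simp: fun_eq_iff)
  show "a - b = a + - b"
    by (rule minus_universal_ring_def)
  show "(a + b) * c = a * c + b * c"
    by transfer (auto simp: fun_eq_iff distrib_right comm_ring_on_laws(4))
  show "(0 :: 'a universal_ring) \<noteq> 1"
    by transfer auto
qed

end

lift_definition component :: "'a::ab_group_add ring_structure \<Rightarrow> 'a universal_ring \<Rightarrow> 'a" is
  "\<lambda>\<sigma> (f, z). f \<sigma>" .

text \<open>
  A section of \<open>component \<sigma>\<close> which is additive and multiplicative; it sends the unit of the ring \<open>\<sigma>\<close>
  to an idempotent and not to \<open>1\<close>.
\<close>

lift_definition concentrate :: "'a::ab_group_add ring_structure \<Rightarrow> 'a \<Rightarrow> 'a universal_ring" is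
  "\<lambda>\<sigma> a. (\<lambda>\<tau>. if \<tau> = \<sigma> \<and> (case \<sigma> of (S, m, e) \<Rightarrow> comm_ring_on S m e \<and> a \<in> S) then a else 0, 0)"
  by (auto intro: comm_ring_on_closed)

lemma component_zero [simp]: "component \<sigma> 0 = 0"
  by transfer auto

lemma component_add [simp]: "component \<sigma> (x + y) = component \<sigma> x + component \<sigma> y"
  by transfer auto

lemma component_uminus [simp]: "component \<sigma> (- x) = - component \<sigma> x"
  by transfer auto

lemma component_sum [simp]: "component \<sigma> (sum f I) = (\<Sum>i\<in>I. component \<sigma> (f i))"
  by (induction I rule: infinite_finite_induct) auto

locale comm_ring_structure =
  fixes S :: "'a::ab_group_add set" and m :: "'a \<Rightarrow> 'a \<Rightarrow> 'a" and e :: 'a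
  assumes comm_ring_on: "comm_ring_on S m e"
begin

abbreviation "pr \<equiv> component (S, m, e)"
abbreviation "emb \<equiv> concentrate (S, m, e)"

lemma component_one: "pr 1 = e"
  using comm_ring_on by transfer auto

lemma component_mult: "pr (x * y) = m (pr x) (pr y)"
  using comm_ring_on by transfer auto

lemma component_concentrate: "a \<in> S \<Longrightarrow> pr (emb a) = a"
  using comm_ring_on by transfer auto

lemma concentrate_zero: "emb 0 = 0"
  by transfer auto

lemma concentrate_add:
  assumes "a \<in> S" "b \<in> S"
  shows "emb (a + b) = emb a + emb b"
  using assms comm_ring_on comm_ring_on_closed(4)[OF comm_ring_on assms]
  by (transfer fixing: S m e a b) (simp add: fun_eq_iff)

lemma concentrate_mult:
  assumes "a \<in> S" "b \<in> S"
  shows "emb (m a b) = emb a * emb b"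
  using assms comm_ring_on comm_ring_on_closed(5)[OF comm_ring_on assms]
  by (transfer fixing: S m e a b) (auto intro!: ext dest: comm_ring_on_mult_zero)

lemma concentrate_sum:
  "(\<And>i. i \<in> I \<Longrightarrow> f i \<in> S) \<Longrightarrow> sum f I \<in> S \<and> emb (sum f I) = (\<Sum>i\<in>I. emb (f i))"
  using comm_ring_on
  by (induction I rule: infinite_finite_induct)
    (auto simp: concentrate_zero concentrate_add comm_ring_on_closed[OF comm_ring_on])

lemma component_prod_cong:
  "(\<And>i. i \<in> I \<Longrightarrow> pr (f i) = pr (g i)) \<Longrightarrow> pr (prod f I) = pr (prod g I)"
  by (induction I rule: infinite_finite_induct) (auto simp: component_mult)

text \<open>
  By the Leibniz formula the projection of a determinant depends on the projections of the entries
  only. This replaces unitality of \<open>emb\<close>: the lift of an identity matrix may be exchanged for the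
  identity matrix.
\<close>

lemma component_det_cong:
  assumes "M \<in> carrier_mat N N" "M' \<in> carrier_mat N N"
    and "\<And>i j. i < N \<Longrightarrow> j < N \<Longrightarrow> pr (M $$ (i, j)) = pr (M' $$ (i, j))"
  shows "pr (det M) = pr (det M')"
proof -
  have "pr (signof p * (\<Prod>i = 0..<N. M $$ (i, p i))) = pr (signof p * (\<Prod>i = 0..<N. M' $$ (i, p i)))"
    if "p permutes {0..<N}" for p
    unfolding component_mult
    by (rule arg_cong2[of _ _ _ _ m, OF refl component_prod_cong])
      (use assms(3) permutes_in_image[OF that] in auto)
  then show ?thesis
    unfolding det_def'[OF assms(1)] det_def'[OF assms(2)] by simp
qed

end


section \<open>Determinants of block triangular matrices\<close>

lemma det_four_block_mat_one_upper_left: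
  fixes D :: "'a::comm_ring_1 mat"
  assumes D: "D \<in> carrier_mat m m"
  shows "det (four_block_mat (1\<^sub>m n) (0\<^sub>m n m) (0\<^sub>m m n) D) = det D"
proof (induction n)
  case 0
  have "four_block_mat (1\<^sub>m 0) (0\<^sub>m 0 m) (0\<^sub>m m 0) D = D"
    using D by (intro eq_matI) auto
  then show ?case by simp
next
  case (Suc n)
  let ?F = "four_block_mat (1\<^sub>m n) (0\<^sub>m n m) (0\<^sub>m m n) D"
  have F: "?F \<in> carrier_mat (n + m) (n + m)"
    using D by auto
  have "four_block_mat (1\<^sub>m (Suc n)) (0\<^sub>m (Suc n) m) (0\<^sub>m m (Suc n)) D
      = four_block_mat (1\<^sub>m 1) (0\<^sub>m 1 (n + m)) (0\<^sub>m (n + m) 1) ?F"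
    using D by (intro eq_matI) auto
  then show ?case
    using det_four_block_mat_lower_left_zero_col[of "1\<^sub>m 1" "0\<^sub>m 1 (n + m)" "n + m" "0\<^sub>m (n + m) 1" ?F] F Suc
    by simp
qed

lemma det_four_block_mat_one_lower_right:
  fixes A :: "'a::comm_ring_1 mat"
  assumes A: "A \<in> carrier_mat n n"
  shows "det (four_block_mat A (0\<^sub>m n m) (0\<^sub>m m n) (1\<^sub>m m)) = det A"
proof (induction m)
  case 0
  have "four_block_mat A (0\<^sub>m n 0) (0\<^sub>m 0 n) (1\<^sub>m 0) = A"
    using A by (intro eq_matI) auto
  then show ?case by simp
next
  case (Suc m)
  let ?F = "four_block_mat A (0\<^sub>m n m) (0\<^sub>m m n) (1\<^sub>m m)"
  have F: "?F \<in> carrier_mat (n + m) (n + m)"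
    using A by auto
  have "four_block_mat A (0\<^sub>m n (Suc m)) (0\<^sub>m (Suc m) n) (1\<^sub>m (Suc m))
      = four_block_mat ?F (0\<^sub>m (n + m) 1) (0\<^sub>m 1 (n + m)) (1\<^sub>m 1)"
    using A by (intro eq_matI) auto
  then show ?case
    using det_four_block_mat_upper_right_zero_col[OF F refl, of "0\<^sub>m 1 (n + m)" "1\<^sub>m 1"] Suc
    by simp
qed

text \<open>
  The universal ring has zero divisors, so the formula is needed over every commutative ring. It
  follows from the factorisation of the matrix into a block-diagonal, a unitriangular and another
  block-diagonal matrix, in which only one diagonal block differs from the identity.
\<close>

lemma det_four_block_mat_block_lower_triangular:
  fixes A :: "'a::comm_ring_1 mat"
  assumes A: "A \<in> carrier_mat n n" and C: "C \<in> carrier_mat m n" and D: "D \<in> carrier_mat m m"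
  shows "det (four_block_mat A (0\<^sub>m n m) C D) = det A * det D"
proof -
  let ?L = "four_block_mat A (0\<^sub>m n m) (0\<^sub>m m n) (1\<^sub>m m)"
  let ?M = "four_block_mat (1\<^sub>m n) (0\<^sub>m n m) C (1\<^sub>m m)"
  let ?R = "four_block_mat (1\<^sub>m n) (0\<^sub>m n m) (0\<^sub>m m n) D"
  have c: "?L \<in> carrier_mat (n + m) (n + m)" "?M \<in> carrier_mat (n + m) (n + m)"
    "?R \<in> carrier_mat (n + m) (n + m)"
    using A D by auto
  have M: "det ?M = 1"
  proof -
    have "det ?M = prod_list (diag_mat ?M)"
      by (rule det_lower_triangular[OF _ c(2)]) (use C in auto)
    also have "diag_mat ?M = replicate (n + m) 1"
      using C by (intro nth_equalityI) (auto simp: diag_mat_def)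
    finally show ?thesis by (simp add: prod_list_replicate)
  qed
  have "?M * ?R = four_block_mat (1\<^sub>m n) (0\<^sub>m n m) C D"
    using C D
    by (subst mult_four_block_mat[OF one_carrier_mat zero_carrier_mat C one_carrier_mat
            one_carrier_mat zero_carrier_mat zero_carrier_mat D]) auto
  moreover have "?L * four_block_mat (1\<^sub>m n) (0\<^sub>m n m) C D = four_block_mat A (0\<^sub>m n m) C D"
    using A C D
    by (subst mult_four_block_mat[OF A zero_carrier_mat zero_carrier_mat one_carrier_mat
            one_carrier_mat zero_carrier_mat C D]) auto
  ultimately have "four_block_mat A (0\<^sub>m n m) C D = ?L * (?M * ?R)"
    by simp
  then show ?thesis
    using det_mult[OF c(1) mult_carrier_mat[OF c(2,3)]] det_mult[OF c(2,3)] M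
      det_four_block_mat_one_upper_left[OF D, of n] det_four_block_mat_one_lower_right[OF A, of m]
    by simp
qed

lemma det_four_block_mat_block_upper_triangular:
  fixes A :: "'a::comm_ring_1 mat"
  assumes A: "A \<in> carrier_mat n n" and B: "B \<in> carrier_mat n m" and D: "D \<in> carrier_mat m m"
  shows "det (four_block_mat A B (0\<^sub>m m n) D) = det A * det D"
proof -
  have "transpose_mat (four_block_mat A B (0\<^sub>m m n) D)
      = four_block_mat (transpose_mat A) (0\<^sub>m n m) (transpose_mat B) (transpose_mat D)"
    using transpose_four_block_mat[OF A B zero_carrier_mat D] by simp
  moreover have "det (transpose_mat (four_block_mat A B (0\<^sub>m m n) D)) = det (four_block_mat A B (0\<^sub>m m n) D)"
    by (rule det_transpose[OF four_block_carrier_mat[OF A D]])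
  moreover have "det (four_block_mat (transpose_mat A) (0\<^sub>m n m) (transpose_mat B) (transpose_mat D))
      = det (transpose_mat A) * det (transpose_mat D)"
    using A B D by (intro det_four_block_mat_block_lower_triangular) auto
  ultimately show ?thesis
    using det_transpose[OF A] det_transpose[OF D] by simp
qed


section \<open>Degrees, signs and homogeneous components\<close>

text \<open>
  Bits are used as elements of a field of signs; rewriting their sum and product to Boolean connectives
  would hide the bilinear structure.
\<close>

declare add_bit_eq_xor [simp del] mult_bit_eq_and [simp del]

lemma bit_add_self: "(b::bit) + b = 0"
  by (cases b) simp_all

lemma bit_mult_self: "(b::bit) * b = b"
  by (cases b) simp_all

lemma length_degree: "\<gamma> \<in> degrees n \<longleftrightarrow> length \<gamma> = n"
  by (simp add: degrees_def)

lemma finite_degrees: "finite (degrees n)"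
proof -
  have "degrees n = {\<gamma>. set \<gamma> \<subseteq> {0, 1} \<and> length \<gamma> = n}"
    unfolding degrees_def by auto
  then show ?thesis
    using finite_lists_length_eq[of "{0, 1 :: bit}" n] by simp
qed

lemma nth_deg_add: "\<lbrakk>\<gamma> \<in> degrees n; \<delta> \<in> degrees n; i < n\<rbrakk> \<Longrightarrow> deg_add \<gamma> \<delta> ! i = \<gamma> ! i + \<delta> ! i"
  by (simp add: degrees_def deg_add_def)

lemma deg_add_closed: "\<lbrakk>\<gamma> \<in> degrees n; \<delta> \<in> degrees n\<rbrakk> \<Longrightarrow> deg_add \<gamma> \<delta> \<in> degrees n"
  by (simp add: degrees_def deg_add_def)

lemma deg_zero_closed: "deg_zero n \<in> degrees n"
  by (simp add: degrees_def deg_zero_def)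

lemma nth_deg_zero: "i < n \<Longrightarrow> deg_zero n ! i = 0"
  by (simp add: deg_zero_def)

lemma degree_eqI:
  "\<lbrakk>\<gamma> \<in> degrees n; \<delta> \<in> degrees n; \<And>i. i < n \<Longrightarrow> \<gamma> ! i = \<delta> ! i\<rbrakk> \<Longrightarrow> \<gamma> = \<delta>"
  by (simp add: degrees_def nth_equalityI)

lemma deg_add_zero_left: "\<gamma> \<in> degrees n \<Longrightarrow> deg_add (deg_zero n) \<gamma> = \<gamma>"
  by (rule degree_eqI[of _ n])
    (auto simp: deg_add_closed deg_zero_closed nth_deg_add[of _ n] bit_add_self nth_deg_zero)

lemma deg_add_self: "\<gamma> \<in> degrees n \<Longrightarrow> deg_add \<gamma> \<gamma> = deg_zero n"
  by (rule degree_eqI[of _ n])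
    (auto simp: deg_add_closed deg_zero_closed nth_deg_add[of _ n] bit_add_self nth_deg_zero)

lemma deg_add_commute: "\<lbrakk>\<gamma> \<in> degrees n; \<delta> \<in> degrees n\<rbrakk> \<Longrightarrow> deg_add \<gamma> \<delta> = deg_add \<delta> \<gamma>"
  by (rule degree_eqI[of _ n]) (auto simp: deg_add_closed nth_deg_add[of _ n] add.commute)

lemma deg_add_assoc:
  "\<lbrakk>\<gamma> \<in> degrees n; \<delta> \<in> degrees n; \<epsilon> \<in> degrees n\<rbrakk>
    \<Longrightarrow> deg_add (deg_add \<gamma> \<delta>) \<epsilon> = deg_add \<gamma> (deg_add \<delta> \<epsilon>)"
  by (rule degree_eqI[of _ n]) (auto simp: deg_add_closed nth_deg_add[of _ n] add.assoc)

lemma deg_add_telescope: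
  assumes "\<gamma> \<in> degrees n" "\<delta> \<in> degrees n" "\<epsilon> \<in> degrees n"
  shows "deg_add (deg_add \<gamma> \<delta>) (deg_add \<delta> \<epsilon>) = deg_add \<gamma> \<epsilon>"
  by (rule degree_eqI[of _ n]) (use assms in \<open>auto simp: deg_add_closed nth_deg_add[of _ n] add.assoc add.left_commute[of "x::bit" for x] bit_add_self\<close>)

lemma deg_add_left_cancel:
  assumes "\<gamma> \<in> degrees n" "\<delta> \<in> degrees n" "\<epsilon> \<in> degrees n"
  shows "deg_add \<gamma> \<delta> = deg_add \<gamma> \<epsilon> \<longleftrightarrow> \<delta> = \<epsilon>"
proof
  assume "deg_add \<gamma> \<delta> = deg_add \<gamma> \<epsilon>"
  then have "deg_add (deg_add \<gamma> \<gamma>) \<delta> = deg_add (deg_add \<gamma> \<gamma>) \<epsilon>"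
    using assms by (simp add: deg_add_assoc)
  then show "\<delta> = \<epsilon>"
    using assms by (simp add: deg_add_self deg_add_zero_left)
qed simp

lemma deg_scalar_sum:
  "\<lbrakk>\<gamma> \<in> degrees n; \<delta> \<in> degrees n\<rbrakk> \<Longrightarrow> deg_scalar \<gamma> \<delta> = (\<Sum>i<n. \<gamma> ! i * \<delta> ! i)"
  by (simp add: deg_scalar_def degrees_def sum_list_sum_nth atLeast0LessThan)

lemma deg_scalar_self_sum: "\<gamma> \<in> degrees n \<Longrightarrow> deg_scalar \<gamma> \<gamma> = (\<Sum>i<n. \<gamma> ! i)"
  by (simp add: deg_scalar_sum) (rule sum.cong, auto simp: bit_mult_self)

lemma deg_scalar_self_add:
  "\<lbrakk>\<gamma> \<in> degrees n; \<delta> \<in> degrees n\<rbrakk>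
    \<Longrightarrow> deg_scalar (deg_add \<gamma> \<delta>) (deg_add \<gamma> \<delta>) = deg_scalar \<gamma> \<gamma> + deg_scalar \<delta> \<delta>"
  by (simp add: deg_scalar_self_sum[of _ n] deg_add_closed[of _ n] nth_deg_add[of _ n] sum.distrib)

text \<open>
  The bilinear form $\sigma(\gamma, \delta) = \sum_{i<j} \gamma_i \delta_j$, a cocycle whose
  antisymmetrisation is the difference between graded commutativity and commutativity in the super
  sense.
\<close>

definition twist :: "degree \<Rightarrow> degree \<Rightarrow> bit" where
  "twist \<gamma> \<delta> = (\<Sum>j<length \<delta>. (\<Sum>i<j. \<gamma> ! i) * \<delta> ! j)"

lemma twist_add_left:
  "\<lbrakk>\<gamma> \<in> degrees n; \<gamma>' \<in> degrees n; \<delta> \<in> degrees n\<rbrakk>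
    \<Longrightarrow> twist (deg_add \<gamma> \<gamma>') \<delta> = twist \<gamma> \<delta> + twist \<gamma>' \<delta>"
  by (simp add: twist_def length_degree nth_deg_add sum.distrib distrib_right)

lemma twist_add_right:
  "\<lbrakk>\<gamma> \<in> degrees n; \<delta> \<in> degrees n; \<delta>' \<in> degrees n\<rbrakk>
    \<Longrightarrow> twist \<gamma> (deg_add \<delta> \<delta>') = twist \<gamma> \<delta> + twist \<gamma> \<delta>'"
  using deg_add_closed[of \<delta> n \<delta>']
  by (simp add: twist_def length_degree nth_deg_add sum.distrib distrib_left)

lemma twist_zero_left: "\<delta> \<in> degrees n \<Longrightarrow> twist (deg_zero n) \<delta> = 0"
  by (simp add: twist_def length_degree deg_zero_def)

text \<open>
  The two open triangles and the diagonal of the square \<open>{..<n} \<times> {..<n}\<close>.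
\<close>

lemma triangular_sums:
  fixes x y :: "nat \<Rightarrow> 'r::comm_ring"
  shows "(\<Sum>j<n. (\<Sum>i<j. x i) * y j) + (\<Sum>j<n. (\<Sum>i<j. y i) * x j) + (\<Sum>j<n. x j * y j)
    = (\<Sum>i<n. x i) * (\<Sum>i<n. y i)"
  by (induction n) (simp_all add: algebra_simps)

lemma twist_commute:
  assumes "\<gamma> \<in> degrees n" "\<delta> \<in> degrees n"
  shows "twist \<gamma> \<delta> + twist \<delta> \<gamma> = deg_scalar \<gamma> \<delta> + deg_scalar \<gamma> \<gamma> * deg_scalar \<delta> \<delta>"
proof -
  have "twist \<gamma> \<delta> + twist \<delta> \<gamma> + deg_scalar \<gamma> \<delta> = deg_scalar \<gamma> \<gamma> * deg_scalar \<delta> \<delta>"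
    using assms triangular_sums[where n = n and x = "\<lambda>i. \<gamma> ! i" and y = "\<lambda>i. \<delta> ! i"]
    by (simp add: twist_def length_degree deg_scalar_sum[OF assms] deg_scalar_self_sum)
  then show ?thesis
    by (metis add.commute add.left_commute add_0_right bit_add_self)
qed

definition signed :: "bit \<Rightarrow> 'a::group_add \<Rightarrow> 'a" where
  "signed b a = (if b = 0 then a else - a)"

lemma signed_zero [simp]: "signed b 0 = 0" "signed 0 a = a"
  by (auto simp: signed_def)

lemma signed_signed: "signed b (signed c a) = signed (b + c) a"
  by (cases b; cases c) (simp_all add: signed_def)

lemma signed_signed_self [simp]: "signed b (signed b a) = a"
  by (simp add: signed_def)

lemma signed_add: "signed b (x + y) = signed b x + signed b (y :: 'a::ab_group_add)"
  by (simp add: signed_def)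

lemma signed_mult_left: "signed b x * y = signed b (x * y :: 'a::ring)"
  by (simp add: signed_def)

lemma signed_mult_right: "x * signed b y = signed b (x * y :: 'a::ring)"
  by (simp add: signed_def)

lemma signed_sum: "signed b (sum f I) = (\<Sum>i\<in>I. signed b (f i :: 'a::ab_group_add))"
  by (simp add: signed_def sum_negf)

context graded_commutative_algebra
begin

abbreviation zero_degree ("\<zero>\<^sub>d") where "\<zero>\<^sub>d \<equiv> deg_zero n"

lemma homogeneous_zero: "\<gamma> \<in> degrees n \<Longrightarrow> 0 \<in> A \<gamma>"
  using homogeneous_subspace subspace_0 by blast

lemma homogeneous_add: "\<lbrakk>\<gamma> \<in> degrees n; a \<in> A \<gamma>; b \<in> A \<gamma>\<rbrakk> \<Longrightarrow> a + b \<in> A \<gamma>"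
  using homogeneous_subspace subspace_add by blast

lemma homogeneous_uminus: "\<lbrakk>\<gamma> \<in> degrees n; a \<in> A \<gamma>\<rbrakk> \<Longrightarrow> - a \<in> A \<gamma>"
  using homogeneous_subspace subspace_neg by blast

lemma homogeneous_scale: "\<lbrakk>\<gamma> \<in> degrees n; a \<in> A \<gamma>\<rbrakk> \<Longrightarrow> scale c a \<in> A \<gamma>"
  using homogeneous_subspace subspace_scale by blast

lemma homogeneous_signed: "\<lbrakk>\<gamma> \<in> degrees n; a \<in> A \<gamma>\<rbrakk> \<Longrightarrow> signed s a \<in> A \<gamma>"
  by (simp add: signed_def homogeneous_uminus)

lemma homogeneous_sum:
  "\<lbrakk>\<gamma> \<in> degrees n; \<And>i. i \<in> I \<Longrightarrow> f i \<in> A \<gamma>\<rbrakk> \<Longrightarrow> sum f I \<in> A \<gamma>"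
  using homogeneous_subspace subspace_sum by blast

definition part :: "degree \<Rightarrow> 'a \<Rightarrow> 'a" where
  "part \<gamma> a = (THE f. f \<in> (\<Pi>\<^sub>E \<gamma>\<in>degrees n. A \<gamma>) \<and> a = (\<Sum>\<gamma>\<in>degrees n. f \<gamma>)) \<gamma>"

lemma part_homogeneous: "\<gamma> \<in> degrees n \<Longrightarrow> part \<gamma> a \<in> A \<gamma>"
  unfolding part_def using theI'[OF direct_sum[of a]] by (auto dest: PiE_mem)

lemma sum_part: "(\<Sum>\<gamma>\<in>degrees n. part \<gamma> a) = a"
  unfolding part_def using theI'[OF direct_sum[of a]] by simp

lemma part_eqI:
  assumes f: "\<And>\<gamma>. \<gamma> \<in> degrees n \<Longrightarrow> f \<gamma> \<in> A \<gamma>" and a: "a = (\<Sum>\<gamma>\<in>degrees n. f \<gamma>)"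
    and \<gamma>: "\<gamma> \<in> degrees n"
  shows "part \<gamma> a = f \<gamma>"
proof -
  have "restrict f (degrees n) \<in> (\<Pi>\<^sub>E \<gamma>\<in>degrees n. A \<gamma>) \<and> a = (\<Sum>\<gamma>\<in>degrees n. restrict f (degrees n) \<gamma>)"
    using f a by auto
  then have "(THE f. f \<in> (\<Pi>\<^sub>E \<gamma>\<in>degrees n. A \<gamma>) \<and> a = (\<Sum>\<gamma>\<in>degrees n. f \<gamma>)) = restrict f (degrees n)"
    by (intro the1_equality direct_sum)
  then show ?thesis
    using \<gamma> by (simp add: part_def)
qed

lemma part_of_homogeneous:
  assumes "\<gamma> \<in> degrees n" "\<delta> \<in> degrees n" "a \<in> A \<gamma>"
  shows "part \<delta> a = (if \<delta> = \<gamma> then a else 0)"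
  by (rule part_eqI[where f = "\<lambda>\<delta>. if \<delta> = \<gamma> then a else 0"])
    (use assms in \<open>auto simp: homogeneous_zero finite_degrees sum.delta\<close>)

lemma part_zero: "\<gamma> \<in> degrees n \<Longrightarrow> part \<gamma> 0 = 0"
  by (rule part_eqI[where f = "\<lambda>_. 0"]) (auto simp: homogeneous_zero)

lemma part_add: "\<gamma> \<in> degrees n \<Longrightarrow> part \<gamma> (a + b) = part \<gamma> a + part \<gamma> b"
  by (rule part_eqI[where f = "\<lambda>\<gamma>. part \<gamma> a + part \<gamma> b"])
    (auto simp: homogeneous_add part_homogeneous sum.distrib sum_part)

lemma part_uminus: "\<gamma> \<in> degrees n \<Longrightarrow> part \<gamma> (- a) = - part \<gamma> a"
  by (rule part_eqI[where f = "\<lambda>\<gamma>. - part \<gamma> a"])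
    (auto simp: homogeneous_uminus part_homogeneous sum_negf sum_part)

lemma part_sum: "\<gamma> \<in> degrees n \<Longrightarrow> part \<gamma> (sum f I) = (\<Sum>i\<in>I. part \<gamma> (f i))"
  by (induction I rule: infinite_finite_induct) (auto simp: part_zero part_add)

text \<open>
  Taking homogeneous components commutes with multiplication by a homogeneous element. This is what
  makes inverses of homogeneous objects homogeneous: the component of an inverse is again an inverse.
\<close>

lemma part_mult_left:
  assumes \<gamma>: "\<gamma> \<in> degrees n" and \<delta>: "\<delta> \<in> degrees n" and a: "a \<in> A \<gamma>"
  shows "part (deg_add \<gamma> \<delta>) (a * b) = a * part \<delta> b"
proof -
  have "part (deg_add \<gamma> \<delta>) (a * b) = (\<Sum>\<epsilon>\<in>degrees n. part (deg_add \<gamma> \<delta>) (a * part \<epsilon> b))"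
    by (subst sum_part[of b, symmetric])
      (use \<gamma> \<delta> in \<open>simp only: sum_distrib_left part_sum deg_add_closed\<close>)
  also have "\<dots> = (\<Sum>\<epsilon>\<in>degrees n. if \<epsilon> = \<delta> then a * part \<epsilon> b else 0)"
  proof (rule sum.cong[OF refl])
    fix \<epsilon> assume \<epsilon>: "\<epsilon> \<in> degrees n"
    show "part (deg_add \<gamma> \<delta>) (a * part \<epsilon> b) = (if \<epsilon> = \<delta> then a * part \<epsilon> b else 0)"
      using part_of_homogeneous[OF deg_add_closed[OF \<gamma> \<epsilon>] deg_add_closed[OF \<gamma> \<delta>]
          graded_mult[OF \<gamma> \<epsilon> a part_homogeneous[OF \<epsilon>]], of b]
      by (auto simp: deg_add_left_cancel[OF \<gamma> \<delta> \<epsilon>])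
  qed
  also have "\<dots> = a * part \<delta> b"
    using \<delta> by (simp add: finite_degrees)
  finally show ?thesis .
qed

text \<open>
  The component \<open>e\<close> of \<open>1\<close> in degree zero satisfies \<open>a * e = a\<close> for all homogeneous \<open>a\<close>, hence by
  additivity also for \<open>a = 1\<close>.
\<close>

lemma one_homogeneous: "1 \<in> A \<zero>\<^sub>d"
proof -
  have "a * part \<zero>\<^sub>d 1 = a" if "\<gamma> \<in> degrees n" "a \<in> A \<gamma>" for \<gamma> a
    using part_mult_left[OF that(1) deg_zero_closed that(2), of 1]
    by (simp add: deg_add_commute[OF that(1) deg_zero_closed] deg_add_zero_left[OF that(1)]
        part_of_homogeneous[OF that(1) that(1) that(2)])
  then have "part \<gamma> 1 * part \<zero>\<^sub>d 1 = part \<gamma> 1" if "\<gamma> \<in> degrees n" for \<gamma>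
    using that part_homogeneous by blast
  then have "(\<Sum>\<gamma>\<in>degrees n. part \<gamma> 1 * part \<zero>\<^sub>d 1) = (\<Sum>\<gamma>\<in>degrees n. part \<gamma> 1)"
    by (rule sum.cong[OF refl])
  then have "1 * part \<zero>\<^sub>d 1 = 1"
    by (simp only: sum_distrib_right[symmetric] sum_part)
  then show ?thesis
    using part_homogeneous[OF deg_zero_closed, of 1] by simp
qed

lemma deg_zero_central:
  assumes "c \<in> A \<zero>\<^sub>d"
  shows "a * c = c * a"
proof -
  have "part \<gamma> a * c = c * part \<gamma> a" if \<gamma>: "\<gamma> \<in> degrees n" for \<gamma>
    using graded_commute[OF deg_zero_closed \<gamma> assms part_homogeneous[OF \<gamma>], of a]
    by (simp add: deg_scalar_sum[OF deg_zero_closed \<gamma>]) (simp add: deg_zero_def)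
  then have "(\<Sum>\<gamma>\<in>degrees n. part \<gamma> a * c) = (\<Sum>\<gamma>\<in>degrees n. c * part \<gamma> a)"
    by (rule sum.cong[OF refl])
  then show ?thesis
    by (simp only: sum_distrib_right[symmetric] sum_distrib_left[symmetric] sum_part)
qed

lemma deg_zero_mult: "\<lbrakk>a \<in> A \<zero>\<^sub>d; b \<in> A \<zero>\<^sub>d\<rbrakk> \<Longrightarrow> a * b \<in> A \<zero>\<^sub>d"
  using graded_mult[OF deg_zero_closed deg_zero_closed] by (simp add: deg_add_self[OF deg_zero_closed])

text \<open>
  An odd element anticommutes with itself, and \<open>2\<close> is invertible in the ground field.
\<close>

lemma odd_square_zero:
  assumes \<gamma>: "\<gamma> \<in> degrees n" and odd: "deg_scalar \<gamma> \<gamma> = 1" and a: "a \<in> A \<gamma>"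
  shows "a * a = 0"
proof -
  have "a * a + a * a = 0"
    using graded_commute[OF \<gamma> \<gamma> a a] odd by (simp add: eq_neg_iff_add_eq_0)
  then have "scale (1 + 1) (a * a) = 0"
    by (simp only: scale_left_distrib scale_one)
  then show ?thesis
    by (simp add: scale_eq_0_iff)
qed

end


section \<open>The twisted product and the commutative ring of even elements\<close>

context graded_commutative_algebra
begin

definition twisted_mult :: "'a \<Rightarrow> 'a \<Rightarrow> 'a" (infixl "\<star>" 70) where
  "a \<star> b = (\<Sum>\<gamma>\<in>degrees n. \<Sum>\<delta>\<in>degrees n. signed (twist \<gamma> \<delta>) (part \<gamma> a * part \<delta> b))"

lemma twisted_mult_homogeneous:
  assumes "\<gamma> \<in> degrees n" "\<delta> \<in> degrees n" "a \<in> A \<gamma>" "b \<in> A \<delta>"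
  shows "a \<star> b = signed (twist \<gamma> \<delta>) (a * b)"
proof -
  have "(\<Sum>\<delta>'\<in>degrees n. signed (twist \<gamma>' \<delta>') (part \<gamma>' a * part \<delta>' b))
      = (if \<gamma>' = \<gamma> then signed (twist \<gamma> \<delta>) (a * b) else 0)" if "\<gamma>' \<in> degrees n" for \<gamma>'
  proof -
    have "(\<Sum>\<delta>'\<in>degrees n. signed (twist \<gamma>' \<delta>') (part \<gamma>' a * part \<delta>' b))
        = (\<Sum>\<delta>'\<in>degrees n. if \<delta>' = \<delta> then signed (twist \<gamma>' \<delta>) (part \<gamma>' a * b) else 0)"
      using assms by (intro sum.cong) (auto simp: part_of_homogeneous)
    then show ?thesis
      using assms that by (simp add: finite_degrees part_of_homogeneous)
  qed
  then show ?thesis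
    unfolding twisted_mult_def using assms by (simp add: finite_degrees)
qed

lemma twisted_mult_add_left: "(a + b) \<star> c = a \<star> c + b \<star> c"
  by (simp add: twisted_mult_def part_add distrib_right signed_add sum.distrib)

lemma twisted_mult_add_right: "a \<star> (b + c) = a \<star> b + a \<star> c"
  by (simp add: twisted_mult_def part_add distrib_left signed_add sum.distrib)

lemma homogeneous_induct:
  assumes hom: "\<And>\<gamma> a. \<gamma> \<in> degrees n \<Longrightarrow> a \<in> A \<gamma> \<Longrightarrow> P a"
    and add: "\<And>a b. P a \<Longrightarrow> P b \<Longrightarrow> P (a + b)"
  shows "P a"
proof -
  have "P (\<Sum>\<gamma>\<in>G. part \<gamma> a)" if "finite G" "G \<subseteq> degrees n" for G
    using that
  proof (induction G rule: finite_induct)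
    case empty
    then show ?case
      using hom[OF deg_zero_closed homogeneous_zero[OF deg_zero_closed]] by simp
  next
    case (insert \<gamma> G)
    then show ?case
      using hom[OF _ part_homogeneous] by (auto intro!: add)
  qed
  from this[OF finite_degrees order_refl] show ?thesis
    by (simp only: sum_part)
qed

lemma twisted_mult_assoc: "a \<star> b \<star> c = a \<star> (b \<star> c)"
proof (induction a rule: homogeneous_induct)
  case a: (1 \<gamma> a)
  show ?case
  proof (induction b rule: homogeneous_induct)
    case b: (1 \<delta> b)
    show ?case
    proof (induction c rule: homogeneous_induct)
      case c: (1 \<epsilon> c)
      have "a \<star> b \<star> c = signed (twist (deg_add \<gamma> \<delta>) \<epsilon>) (signed (twist \<gamma> \<delta>) (a * b) * c)"
        using a b c
        by (simp add: twisted_mult_homogeneous[of \<gamma> \<delta>] twisted_mult_homogeneous[of "deg_add \<gamma> \<delta>" \<epsilon>]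
            deg_add_closed graded_mult homogeneous_signed)
      moreover have "a \<star> (b \<star> c) = signed (twist \<gamma> (deg_add \<delta> \<epsilon>)) (a * signed (twist \<delta> \<epsilon>) (b * c))"
        using a b c
        by (simp add: twisted_mult_homogeneous[of \<delta> \<epsilon>] twisted_mult_homogeneous[of \<gamma> "deg_add \<delta> \<epsilon>"]
            deg_add_closed graded_mult homogeneous_signed)
      ultimately show ?case
        using a b c
        by (simp add: signed_mult_left signed_mult_right signed_signed twist_add_left twist_add_right
            mult.assoc add.assoc add.commute)
          (simp add: add.left_commute add.commute)
    qed (simp add: twisted_mult_add_right)
  qed (simp add: twisted_mult_add_left twisted_mult_add_right)
qed (simp add: twisted_mult_add_left)

lemma part_twisted_mult_left:
  assumes \<gamma>: "\<gamma> \<in> degrees n" and \<delta>: "\<delta> \<in> degrees n" and a: "a \<in> A \<gamma>"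
  shows "part (deg_add \<gamma> \<delta>) (a \<star> b) = a \<star> part \<delta> b"
proof (induction b rule: homogeneous_induct)
  case (1 \<epsilon> b)
  have z: "a \<star> 0 = 0"
    using twisted_mult_homogeneous[OF \<gamma> \<delta> a homogeneous_zero[OF \<delta>]] by simp
  have "a \<star> b \<in> A (deg_add \<gamma> \<epsilon>)"
    using 1 \<gamma> a
    by (simp add: twisted_mult_homogeneous[of \<gamma> \<epsilon>] homogeneous_signed graded_mult deg_add_closed)
  then show ?case
    using 1 \<gamma> \<delta>
    by (simp add: part_of_homogeneous[of "deg_add \<gamma> \<epsilon>"] part_of_homogeneous[of \<epsilon>] deg_add_closed
        deg_add_left_cancel z)
qed (use \<gamma> \<delta> in \<open>simp add: twisted_mult_add_right part_add deg_add_closed\<close>)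

definition even_part :: "'a set" where
  "even_part = {a. \<forall>\<gamma>\<in>degrees n. deg_scalar \<gamma> \<gamma> = 1 \<longrightarrow> part \<gamma> a = 0}"

lemma homogeneous_even:
  "\<lbrakk>\<gamma> \<in> degrees n; deg_scalar \<gamma> \<gamma> = 0; a \<in> A \<gamma>\<rbrakk> \<Longrightarrow> a \<in> even_part"
  by (auto simp: even_part_def part_of_homogeneous)

lemma even_part_zero: "0 \<in> even_part"
  by (simp add: even_part_def part_zero)

lemma even_part_add: "\<lbrakk>a \<in> even_part; b \<in> even_part\<rbrakk> \<Longrightarrow> a + b \<in> even_part"
  by (simp add: even_part_def part_add)

lemma even_part_uminus: "a \<in> even_part \<Longrightarrow> - a \<in> even_part"
  by (simp add: even_part_def part_uminus)

lemma even_part_induct [consumes 1]: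
  assumes a: "a \<in> even_part"
    and hom: "\<And>\<gamma> a. \<gamma> \<in> degrees n \<Longrightarrow> deg_scalar \<gamma> \<gamma> = 0 \<Longrightarrow> a \<in> A \<gamma> \<Longrightarrow> P a"
    and add: "\<And>a b. P a \<Longrightarrow> P b \<Longrightarrow> P (a + b)"
  shows "P a"
proof -
  have z: "P 0"
    using hom[OF deg_zero_closed _ homogeneous_zero[OF deg_zero_closed]]
    by (simp add: deg_scalar_self_sum[OF deg_zero_closed] nth_deg_zero)
  have "P (\<Sum>\<gamma>\<in>G. part \<gamma> a)" if "finite G" "G \<subseteq> degrees n" for G
    using that
  proof (induction G rule: finite_induct)
    case empty
    then show ?case using z by simp
  next
    case (insert \<gamma> G)
    have "P (part \<gamma> a)"
    proof (cases "deg_scalar \<gamma> \<gamma> = 0")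
      case True
      then show ?thesis using insert hom[OF _ _ part_homogeneous] by auto
    next
      case False
      then show ?thesis using insert a z by (simp add: even_part_def)
    qed
    then show ?case using insert by (auto intro!: add)
  qed
  from this[OF finite_degrees order_refl] show ?thesis
    by (simp only: sum_part)
qed

lemma even_part_twisted_mult:
  assumes "a \<in> even_part" "b \<in> even_part"
  shows "a \<star> b \<in> even_part"
  using assms(1)
proof (induction a rule: even_part_induct)
  case a: (1 \<gamma> a)
  show ?case
    using assms(2)
  proof (induction b rule: even_part_induct)
    case b: (1 \<delta> b)
    then show ?case
      using a
      by (auto intro!: homogeneous_even[of "deg_add \<gamma> \<delta>"] homogeneous_signed graded_mult
          simp: twisted_mult_homogeneous[of \<gamma> \<delta>] deg_add_closed deg_scalar_self_add)
  qed (simp add: twisted_mult_add_right even_part_add)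
qed (simp add: twisted_mult_add_left even_part_add)

lemma twisted_mult_commute:
  assumes "a \<in> even_part" "b \<in> even_part"
  shows "a \<star> b = b \<star> a"
  using assms(1)
proof (induction a rule: even_part_induct)
  case a: (1 \<gamma> a)
  show ?case
    using assms(2)
  proof (induction b rule: even_part_induct)
    case b: (1 \<delta> b)
    have "twist \<gamma> \<delta> + twist \<delta> \<gamma> = deg_scalar \<gamma> \<delta>"
      using a b by (simp add: twist_commute)
    then have "twist \<gamma> \<delta> = twist \<delta> \<gamma> + deg_scalar \<gamma> \<delta>"
      by (cases "twist \<gamma> \<delta>"; cases "twist \<delta> \<gamma>") auto
    then show ?case
      using a b graded_commute[of \<gamma> \<delta> a b]
      by (simp add: twisted_mult_homogeneous[of \<gamma> \<delta>] twisted_mult_homogeneous[of \<delta> \<gamma>]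
          signed_signed[symmetric]) (simp add: signed_def)
  qed (simp add: twisted_mult_add_right twisted_mult_add_left)
qed (simp add: twisted_mult_add_right twisted_mult_add_left)

lemma twisted_mult_one: "1 \<star> a = a"
proof (induction a rule: homogeneous_induct)
  case (1 \<gamma> a)
  then show ?case
    using twisted_mult_homogeneous[OF deg_zero_closed 1(1) one_homogeneous 1(2)]
    by (simp add: twist_zero_left)
qed (simp add: twisted_mult_add_right)

lemma deg_scalar_zero: "deg_scalar (deg_zero n) (deg_zero n) = 0"
  by (simp add: deg_scalar_self_sum[OF deg_zero_closed] nth_deg_zero)

text \<open>
  Bilinearity of \<open>twist\<close> gives associativity. On even degrees the correction term in
  \<open>twist_commute\<close> vanishes, so that the sign exchanged between \<open>a \<star> b\<close> and \<open>b \<star> a\<close> cancels the one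
  from graded commutativity.
\<close>

lemma comm_ring_on_even_part: "comm_ring_on even_part (\<star>) 1"
  unfolding comm_ring_on_def
  using homogeneous_even[OF deg_zero_closed deg_scalar_zero one_homogeneous]
  by (auto simp: even_part_zero even_part_uminus even_part_add even_part_twisted_mult twisted_mult_one
      twisted_mult_assoc twisted_mult_add_left intro: twisted_mult_commute)

end

sublocale graded_commutative_algebra \<subseteq> tw: comm_ring_structure even_part "(\<star>)" 1
  by unfold_locales (rule comm_ring_on_even_part)


section \<open>Graded matrices and their lift to the twisted ring\<close>

text \<open>
  The sort \<open>{semiring_0, monoid_mult}\<close> allows \<open>0 = 1\<close>, in contrast to \<^class>\<open>semiring_1\<close>.
\<close>

lemma one_mult_mat:
  fixes X :: "'a::{semiring_0, monoid_mult} mat"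
  assumes "X \<in> carrier_mat N M"
  shows "1\<^sub>m N * X = X"
  using assms by (intro eq_matI) (auto simp: scalar_prod_def if_distrib[of "\<lambda>x. x * _"] cong: if_cong)

lemma mult_one_mat:
  fixes X :: "'a::{semiring_0, monoid_mult} mat"
  assumes "X \<in> carrier_mat N M"
  shows "X * 1\<^sub>m M = X"
  using assms by (intro eq_matI) (auto simp: scalar_prod_def if_distrib[of "\<lambda>x. _ * x"] cong: if_cong)

lemma index_mult_mat_sum:
  assumes "X \<in> carrier_mat N K" "Y \<in> carrier_mat K M" "i < N" "j < M"
  shows "(X * Y) $$ (i, j) = (\<Sum>k<K. X $$ (i, k) * Y $$ (k, j))"
  using assms by (auto simp: scalar_prod_def atLeast0LessThan intro!: sum.cong)

context graded_commutative_algebra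
begin

text \<open>
  Rectangular blocks of graded matrices, with one degree for each single row and column instead of one
  for each block.
\<close>

definition gmats :: "degree list \<Rightarrow> degree list \<Rightarrow> 'a mat set" where
  "gmats ds es = {X \<in> carrier_mat (length ds) (length es).
     \<forall>i<length ds. \<forall>j<length es. X $$ (i, j) \<in> A (deg_add (ds ! i) (es ! j))}"

definition degrees_of_parity :: "bit \<Rightarrow> degree set" where
  "degrees_of_parity p = {\<gamma> \<in> degrees n. deg_scalar \<gamma> \<gamma> = p}"

lemma gmatsD:
  assumes "X \<in> gmats ds es"
  shows "X \<in> carrier_mat (length ds) (length es)"
    and "i < length ds \<Longrightarrow> j < length es \<Longrightarrow> X $$ (i, j) \<in> A (deg_add (ds ! i) (es ! j))"
  using assms by (auto simp: gmats_def)

lemma gmatsI: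
  assumes "X \<in> carrier_mat (length ds) (length es)"
    and "\<And>i j. i < length ds \<Longrightarrow> j < length es \<Longrightarrow> X $$ (i, j) \<in> A (deg_add (ds ! i) (es ! j))"
  shows "X \<in> gmats ds es"
  using assms by (auto simp: gmats_def)

lemma nth_degrees: "set ds \<subseteq> degrees n \<Longrightarrow> i < length ds \<Longrightarrow> ds ! i \<in> degrees n"
  by auto

lemma gmats_mult:
  assumes X: "X \<in> gmats ds es" and Y: "Y \<in> gmats es fs"
    and deg: "set ds \<subseteq> degrees n" "set es \<subseteq> degrees n" "set fs \<subseteq> degrees n"
  shows "X * Y \<in> gmats ds fs"
proof (rule gmatsI)
  show "X * Y \<in> carrier_mat (length ds) (length fs)"
    using gmatsD(1)[OF X] gmatsD(1)[OF Y] by simp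
  fix i k assume i: "i < length ds" and k: "k < length fs"
  have "X $$ (i, j) * Y $$ (j, k) \<in> A (deg_add (ds ! i) (fs ! k))" if j: "j < length es" for j
    using graded_mult[OF _ _ gmatsD(2)[OF X i j] gmatsD(2)[OF Y j k]]
      nth_degrees[OF deg(1) i] nth_degrees[OF deg(2) j] nth_degrees[OF deg(3) k]
    by (simp add: deg_add_closed deg_add_telescope)
  then show "(X * Y) $$ (i, k) \<in> A (deg_add (ds ! i) (fs ! k))"
    unfolding index_mult_mat_sum[OF gmatsD(1)[OF X] gmatsD(1)[OF Y] i k]
    using nth_degrees[OF deg(1) i] nth_degrees[OF deg(3) k]
    by (intro homogeneous_sum) (auto simp: deg_add_closed)
qed

lemma gmats_add:
  assumes X: "X \<in> gmats ds es" and Y: "Y \<in> gmats ds es"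
    and deg: "set ds \<subseteq> degrees n" "set es \<subseteq> degrees n"
  shows "X + Y \<in> gmats ds es"
  using gmatsD[OF X] gmatsD[OF Y] nth_degrees[OF deg(1)] nth_degrees[OF deg(2)]
  by (intro gmatsI) (auto intro!: homogeneous_add deg_add_closed)

lemma gmats_uminus:
  assumes X: "X \<in> gmats ds es" and deg: "set ds \<subseteq> degrees n" "set es \<subseteq> degrees n"
  shows "- X \<in> gmats ds es"
  using gmatsD[OF X] nth_degrees[OF deg(1)] nth_degrees[OF deg(2)]
  by (intro gmatsI) (auto intro!: homogeneous_uminus deg_add_closed)

lemma gmats_zero:
  assumes deg: "set ds \<subseteq> degrees n" "set es \<subseteq> degrees n"
  shows "0\<^sub>m (length ds) (length es) \<in> gmats ds es"
  using nth_degrees[OF deg(1)] nth_degrees[OF deg(2)]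
  by (intro gmatsI) (auto intro!: homogeneous_zero deg_add_closed)

lemma gmats_one:
  assumes deg: "set ds \<subseteq> degrees n"
  shows "1\<^sub>m (length ds) \<in> gmats ds ds"
  using nth_degrees[OF deg]
  by (intro gmatsI) (auto simp: deg_add_self[of _ n] intro!: homogeneous_zero deg_add_closed one_homogeneous)

lemma gmats_four_block:
  assumes "X \<in> gmats ds ds'" "Y \<in> gmats ds es'" "Z \<in> gmats es ds'" "W \<in> gmats es es'"
  shows "four_block_mat X Y Z W \<in> gmats (ds @ es) (ds' @ es')"
  using assms[THEN gmatsD(1)] assms[THEN gmatsD(2)]
  by (intro gmatsI) (auto simp: nth_append)

lemma gmats_four_blockD:
  assumes F: "four_block_mat X Y Z W \<in> gmats (ds @ es) (ds' @ es')"
    and c: "X \<in> carrier_mat (length ds) (length ds')" "Y \<in> carrier_mat (length ds) (length es')"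
      "Z \<in> carrier_mat (length es) (length ds')" "W \<in> carrier_mat (length es) (length es')"
  shows "X \<in> gmats ds ds'" "Y \<in> gmats ds es'" "Z \<in> gmats es ds'" "W \<in> gmats es es'"
proof -
  note D = gmatsD(2)[OF F]
  show "X \<in> gmats ds ds'"
  proof (rule gmatsI[OF c(1)])
    fix i j assume "i < length ds" "j < length ds'"
    then show "X $$ (i, j) \<in> A (deg_add (ds ! i) (ds' ! j))"
      using D[of i j] c by (simp add: nth_append)
  qed
  show "Y \<in> gmats ds es'"
  proof (rule gmatsI[OF c(2)])
    fix i j assume "i < length ds" "j < length es'"
    then show "Y $$ (i, j) \<in> A (deg_add (ds ! i) (es' ! j))"
      using D[of i "length ds' + j"] c by (simp add: nth_append)
  qed
  show "Z \<in> gmats es ds'"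
  proof (rule gmatsI[OF c(3)])
    fix i j assume "i < length es" "j < length ds'"
    then show "Z $$ (i, j) \<in> A (deg_add (es ! i) (ds' ! j))"
      using D[of "length ds + i" j] c by (simp add: nth_append)
  qed
  show "W \<in> gmats es es'"
  proof (rule gmatsI[OF c(4)])
    fix i j assume "i < length es" "j < length es'"
    then show "W $$ (i, j) \<in> A (deg_add (es ! i) (es' ! j))"
      using D[of "length ds + i" "length ds' + j"] c by (simp add: nth_append)
  qed
qed

lemma degrees_of_parity_subset: "set ds \<subseteq> degrees_of_parity p \<Longrightarrow> set ds \<subseteq> degrees n"
  by (auto simp: degrees_of_parity_def)

lemma deg_scalar_same_parity:
  assumes "\<gamma> \<in> degrees_of_parity p" "\<delta> \<in> degrees_of_parity p"
  shows "deg_scalar (deg_add \<gamma> \<delta>) (deg_add \<gamma> \<delta>) = 0"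
  using assms by (simp add: degrees_of_parity_def deg_scalar_self_add[of _ n] bit_add_self)

definition twisted_entry :: "degree \<Rightarrow> degree \<Rightarrow> 'a \<Rightarrow> 'a" where
  "twisted_entry \<gamma> \<delta> a = signed (twist (deg_add \<gamma> \<delta>) \<delta>) a"

lemma twisted_entry_homogeneous:
  assumes "\<gamma> \<in> degrees n" "\<delta> \<in> degrees n" "a \<in> A (deg_add \<gamma> \<delta>)"
  shows "twisted_entry \<gamma> \<delta> a \<in> A (deg_add \<gamma> \<delta>)"
  using assms by (simp add: twisted_entry_def homogeneous_signed deg_add_closed)

lemma twisted_entry_even:
  assumes "\<gamma> \<in> degrees_of_parity p" "\<delta> \<in> degrees_of_parity p" "a \<in> A (deg_add \<gamma> \<delta>)"
  shows "twisted_entry \<gamma> \<delta> a \<in> even_part"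
  using assms deg_scalar_same_parity[OF assms(1,2)]
  by (auto intro!: homogeneous_even[of "deg_add \<gamma> \<delta>"] twisted_entry_homogeneous
      simp: degrees_of_parity_def deg_add_closed)

text \<open>
  The sign of an entry depends on its row and column in such a way that it absorbs the sign of the
  twisted product; the middle index \<open>\<delta>\<close> cancels. Summation over \<open>\<delta>\<close> turns the matrix product of the
  algebra into the one of the twisted ring.
\<close>

lemma twisted_entry_mult:
  assumes d: "\<gamma> \<in> degrees n" "\<delta> \<in> degrees n" "\<epsilon> \<in> degrees n"
    and a: "a \<in> A (deg_add \<gamma> \<delta>)" and b: "b \<in> A (deg_add \<delta> \<epsilon>)"
  shows "twisted_entry \<gamma> \<delta> a \<star> twisted_entry \<delta> \<epsilon> b = twisted_entry \<gamma> \<epsilon> (a * b)"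
proof -
  have *: "twist (deg_add \<gamma> \<delta>) (deg_add \<delta> \<epsilon>) + twist (deg_add \<gamma> \<delta>) \<delta> + twist (deg_add \<delta> \<epsilon>) \<epsilon>
      = twist (deg_add \<gamma> \<epsilon>) \<epsilon>"
    using d
    by (simp add: twist_add_left[of _ n] twist_add_right[of _ n] deg_add_closed)
  have "twisted_entry \<gamma> \<delta> a \<star> twisted_entry \<delta> \<epsilon> b
      = signed (twist (deg_add \<gamma> \<delta>) (deg_add \<delta> \<epsilon>)) (twisted_entry \<gamma> \<delta> a * twisted_entry \<delta> \<epsilon> b)"
    using d a b by (intro twisted_mult_homogeneous) (auto simp: twisted_entry_homogeneous deg_add_closed)
  then show ?thesis
    unfolding twisted_entry_def *[symmetric]
    by (simp add: signed_mult_left signed_mult_right signed_signed add_ac)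
qed

lemma twisted_entry_sum: "twisted_entry \<gamma> \<delta> (sum f I) = (\<Sum>i\<in>I. twisted_entry \<gamma> \<delta> (f i))"
  by (simp add: twisted_entry_def signed_sum)

lemma twisted_entry_zero [simp]: "twisted_entry \<gamma> \<delta> 0 = 0"
  by (simp add: twisted_entry_def)

lemma twisted_entry_self: "\<gamma> \<in> degrees n \<Longrightarrow> twisted_entry \<gamma> \<gamma> a = a"
  by (simp add: twisted_entry_def deg_add_self twist_zero_left)

lemma twisted_entry_twisted_entry [simp]: "twisted_entry \<gamma> \<delta> (twisted_entry \<gamma> \<delta> a) = a"
  by (simp add: twisted_entry_def)

definition lift_mat :: "degree list \<Rightarrow> degree list \<Rightarrow> 'a mat \<Rightarrow> 'a universal_ring mat" where
  "lift_mat ds es X = mat (length ds) (length es)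
     (\<lambda>(i, j). tw.emb (twisted_entry (ds ! i) (es ! j) (X $$ (i, j))))"

lemma lift_mat_carrier [simp]: "lift_mat ds es X \<in> carrier_mat (length ds) (length es)"
  by (simp add: lift_mat_def)

lemma lift_mat_mult:
  assumes X: "X \<in> gmats ds es" and Y: "Y \<in> gmats es fs"
    and par: "set ds \<subseteq> degrees_of_parity p" "set es \<subseteq> degrees_of_parity p"
      "set fs \<subseteq> degrees_of_parity p"
  shows "lift_mat ds fs (X * Y) = lift_mat ds es X * lift_mat es fs Y"
proof (rule eq_matI)
  show "dim_row (lift_mat ds fs (X * Y)) = dim_row (lift_mat ds es X * lift_mat es fs Y)"
    "dim_col (lift_mat ds fs (X * Y)) = dim_col (lift_mat ds es X * lift_mat es fs Y)"
    by (simp_all add: lift_mat_def)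
  fix i k
  assume "i < dim_row (lift_mat ds es X * lift_mat es fs Y)"
    and "k < dim_col (lift_mat ds es X * lift_mat es fs Y)"
  then have i: "i < length ds" and k: "k < length fs"
    by (simp_all add: lift_mat_def)
  have pi: "ds ! i \<in> degrees_of_parity p" and pk: "fs ! k \<in> degrees_of_parity p"
    and pj: "\<And>j. j < length es \<Longrightarrow> es ! j \<in> degrees_of_parity p"
    using par i k by auto
  note d = pi[unfolded degrees_of_parity_def] pk[unfolded degrees_of_parity_def]
    pj[unfolded degrees_of_parity_def]
  let ?x = "\<lambda>j. twisted_entry (ds ! i) (es ! j) (X $$ (i, j))"
  let ?y = "\<lambda>j. twisted_entry (es ! j) (fs ! k) (Y $$ (j, k))"
  have e: "?x j \<in> even_part" "?y j \<in> even_part" if "j < length es" for j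
    using gmatsD(2)[OF X i that] gmatsD(2)[OF Y that k] pi pk pj[OF that]
    by (auto intro: twisted_entry_even)
  have "lift_mat ds fs (X * Y) $$ (i, k)
      = tw.emb (\<Sum>j<length es. twisted_entry (ds ! i) (fs ! k) (X $$ (i, j) * Y $$ (j, k)))"
    using i k
    by (simp only: lift_mat_def index_mat index_mult_mat_sum[OF gmatsD(1)[OF X] gmatsD(1)[OF Y] i k]
        twisted_entry_sum prod.case)
  also have "\<dots> = tw.emb (\<Sum>j<length es. ?x j \<star> ?y j)"
    using gmatsD(2)[OF X i] gmatsD(2)[OF Y _ k] d
    by (intro arg_cong[of _ _ tw.emb] sum.cong refl twisted_entry_mult[symmetric]) auto
  also have "\<dots> = (\<Sum>j<length es. tw.emb (?x j \<star> ?y j))"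
    using e by (intro tw.concentrate_sum[THEN conjunct2]) (auto intro: even_part_twisted_mult)
  also have "\<dots> = (\<Sum>j<length es. tw.emb (?x j) * tw.emb (?y j))"
    using e by (intro sum.cong refl tw.concentrate_mult) auto
  also have "\<dots> = (lift_mat ds es X * lift_mat es fs Y) $$ (i, k)"
    unfolding index_mult_mat_sum[OF lift_mat_carrier lift_mat_carrier i k]
    using i k by (simp add: lift_mat_def)
  finally show "lift_mat ds fs (X * Y) $$ (i, k) = (lift_mat ds es X * lift_mat es fs Y) $$ (i, k)" .
qed

lemma lift_mat_four_block:
  assumes c: "X \<in> carrier_mat (length ds) (length ds')" "Y \<in> carrier_mat (length ds) (length es')"
      "Z \<in> carrier_mat (length es) (length ds')" "W \<in> carrier_mat (length es) (length es')"
  shows "lift_mat (ds @ es) (ds' @ es') (four_block_mat X Y Z W)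
    = four_block_mat (lift_mat ds ds' X) (lift_mat ds es' Y) (lift_mat es ds' Z) (lift_mat es es' W)"
  using c by (intro eq_matI) (auto simp: lift_mat_def nth_append)

lemma lift_mat_zero: "lift_mat ds es (0\<^sub>m (length ds) (length es)) = 0\<^sub>m (length ds) (length es)"
  by (intro eq_matI) (auto simp: lift_mat_def tw.concentrate_zero)

text \<open>
  The determinant of the sign-twisted matrix over the commutative ring of even elements; the degrees
  in \<open>ds\<close> are meant to have one common parity, so that all entries are even.
\<close>

definition gdet :: "degree list \<Rightarrow> 'a mat \<Rightarrow> 'a" where
  "gdet ds X = tw.pr (det (lift_mat ds ds X))"

lemma component_lift_mat:
  assumes "X \<in> gmats ds es" "set ds \<subseteq> degrees_of_parity p" "set es \<subseteq> degrees_of_parity p"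
    and "i < length ds" "j < length es"
  shows "tw.pr (lift_mat ds es X $$ (i, j)) = twisted_entry (ds ! i) (es ! j) (X $$ (i, j))"
proof -
  have "ds ! i \<in> degrees_of_parity p" "es ! j \<in> degrees_of_parity p"
    using assms(2-5) by auto
  then show ?thesis
    using assms gmatsD(2)[OF assms(1,4,5)]
    by (simp add: lift_mat_def tw.component_concentrate twisted_entry_even)
qed

lemma gdet_one:
  assumes par: "set ds \<subseteq> degrees_of_parity p"
  shows "gdet ds (1\<^sub>m (length ds)) = 1"
proof -
  have "gdet ds (1\<^sub>m (length ds)) = tw.pr (det (1\<^sub>m (length ds) :: 'a universal_ring mat))"
    unfolding gdet_def
  proof (rule tw.component_det_cong[OF lift_mat_carrier one_carrier_mat])
    fix i j assume ij: "i < length ds" "j < length ds"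
    then have "ds ! i \<in> degrees n"
      using degrees_of_parity_subset[OF par] by auto
    then show "tw.pr (lift_mat ds ds (1\<^sub>m (length ds)) $$ (i, j))
        = tw.pr (1\<^sub>m (length ds) $$ (i, j))"
      using component_lift_mat[OF gmats_one[OF degrees_of_parity_subset[OF par]] par par ij] ij
      by (auto simp: tw.component_one twisted_entry_self)
  qed
  then show ?thesis
    by (simp add: tw.component_one)
qed

end


section \<open>The determinant of graded matrices of one parity\<close>

lemma sum_bit_permute_self:
  fixes N :: nat
  assumes "\<pi> permutes {0..<N}"
  shows "(\<Sum>i<N. f i + f (\<pi> i) :: bit) = 0"
proof -
  have "(\<Sum>i<N. f (\<pi> i)) = (\<Sum>i<N. f i)"
    using sum.permute[OF assms, of f] by (simp add: atLeast0LessThan o_def)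
  then show ?thesis
    by (simp add: sum.distrib bit_add_self)
qed

lemma permutes_moves_two:
  assumes \<pi>: "\<pi> permutes {0..<N}" "\<pi> \<noteq> id"
  obtains i :: nat where "i < N" "\<pi> i < N" "\<pi> (\<pi> i) < N" "\<pi> i \<noteq> i" "\<pi> (\<pi> i) \<noteq> \<pi> i"
proof -
  obtain i where i: "\<pi> i \<noteq> i"
    using \<pi>(2) by fastforce
  then have "i \<in> {0..<N}"
    using permutes_not_in[OF \<pi>(1), of i] by blast
  moreover have "\<pi> (\<pi> i) \<noteq> \<pi> i"
    using i permutes_inj[OF \<pi>(1)] by (metis injD)
  ultimately show thesis
    using that[of i] i permutes_in_image[OF \<pi>(1)] by auto
qed

lemma prod_list_signed:
  "\<exists>s. \<forall>x :: nat \<Rightarrow> 'a::{ring, monoid_mult}.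
     prod_list (map (\<lambda>i. signed (c i) (x i)) [0..<k]) = signed s (prod_list (map x [0..<k]))"
proof (induction k)
  case 0
  then show ?case by (auto intro: exI[of _ 0])
next
  case (Suc k)
  then obtain s where "\<forall>x :: nat \<Rightarrow> 'a.
     prod_list (map (\<lambda>i. signed (c i) (x i)) [0..<k]) = signed s (prod_list (map x [0..<k]))"
    by blast
  then show ?case
    by (intro exI[of _ "c k + s"]) (simp add: signed_mult_left signed_mult_right signed_signed)
qed

context graded_commutative_algebra
begin

text \<open>
  A twisted product of homogeneous factors is the original product up to a sign that depends on the
  degrees of the factors but not on the factors. This makes \<open>gdet\<close> a polynomial in the original
  entries.
\<close>

lemma component_prod_homogeneous:
  assumes g: "\<And>i. i < k \<Longrightarrow> g i \<in> degrees_of_parity 0"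
  shows "\<exists>s. \<exists>\<gamma>\<in>degrees n. (\<forall>t<n. \<gamma> ! t = (\<Sum>i<k. g i ! t)) \<and>
    (\<forall>x. (\<forall>i<k. x i \<in> A (g i)) \<longrightarrow> prod_list (map x [0..<k]) \<in> A \<gamma> \<and>
      tw.pr (\<Prod>i = 0..<k. tw.emb (x i)) = signed s (prod_list (map x [0..<k])))"
  using g
proof (induction k)
  case 0
  show ?case
    by (intro exI[of _ 0] bexI[of _ "\<zero>\<^sub>d"])
      (auto simp: nth_deg_zero one_homogeneous tw.component_one deg_zero_closed)
next
  case (Suc k)
  then obtain s \<gamma> where \<gamma>: "\<gamma> \<in> degrees n" "\<forall>t<n. \<gamma> ! t = (\<Sum>i<k. g i ! t)"
    and x: "\<And>x. (\<forall>i<k. x i \<in> A (g i)) \<Longrightarrow> prod_list (map x [0..<k]) \<in> A \<gamma> \<and>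
      tw.pr (\<Prod>i = 0..<k. tw.emb (x i)) = signed s (prod_list (map x [0..<k]))"
    by (metis less_Suc_eq)
  have gk: "g k \<in> degrees n" "deg_scalar (g k) (g k) = 0"
    using Suc.prems[of k] by (auto simp: degrees_of_parity_def)
  show ?case
  proof (intro exI[of _ "twist \<gamma> (g k) + s"] bexI[of _ "deg_add \<gamma> (g k)"] conjI allI impI)
    show "deg_add \<gamma> (g k) \<in> degrees n"
      using \<gamma>(1) gk(1) by (rule deg_add_closed)
    fix t assume "t < n"
    then show "deg_add \<gamma> (g k) ! t = (\<Sum>i<Suc k. g i ! t)"
      using \<gamma> gk nth_deg_add[OF \<gamma>(1) gk(1)] by simp
  next
    fix x assume xk: "\<forall>i<Suc k. x i \<in> A (g i)"
    then have IH: "prod_list (map x [0..<k]) \<in> A \<gamma>"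
      "tw.pr (\<Prod>i = 0..<k. tw.emb (x i)) = signed s (prod_list (map x [0..<k]))"
      using x[of x] by auto
    show "prod_list (map x [0..<Suc k]) \<in> A (deg_add \<gamma> (g k))"
      using graded_mult[OF \<gamma>(1) gk(1) IH(1)] xk by simp
    have "x k \<in> even_part"
      using homogeneous_even[OF gk] xk by simp
    then have "tw.pr (\<Prod>i = 0..<Suc k. tw.emb (x i))
        = signed s (prod_list (map x [0..<k])) \<star> x k"
      by (simp add: tw.component_mult IH(2) tw.component_concentrate)
    also have "\<dots> = signed (twist \<gamma> (g k)) (signed s (prod_list (map x [0..<k])) * x k)"
      using twisted_mult_homogeneous[OF \<gamma>(1) gk(1) homogeneous_signed[OF \<gamma>(1) IH(1)]] xk by simp
    finally show "tw.pr (\<Prod>i = 0..<Suc k. tw.emb (x i))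
        = signed (twist \<gamma> (g k) + s) (prod_list (map x [0..<Suc k]))"
      by (simp add: signed_mult_left signed_signed)
  qed
qed

lemma component_signof_mult: "tw.pr (signof \<pi> * y) = (if evenperm \<pi> then tw.pr y else - tw.pr y)"
  by (simp add: sign_def)

lemma gdet_expand:
  "gdet ds X = (\<Sum>\<pi> | \<pi> permutes {0..<length ds}.
     if evenperm \<pi> then tw.pr (\<Prod>i = 0..<length ds. lift_mat ds ds X $$ (i, \<pi> i))
     else - tw.pr (\<Prod>i = 0..<length ds. lift_mat ds ds X $$ (i, \<pi> i)))"
  unfolding gdet_def det_def'[OF lift_mat_carrier] component_sum component_signof_mult ..

lemma gdet_leibniz_term:
  assumes par: "set ds \<subseteq> degrees_of_parity p" and \<pi>: "\<pi> permutes {0..<length ds}"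
  shows "\<exists>s. \<forall>X\<in>gmats ds ds. prod_list (map (\<lambda>i. X $$ (i, \<pi> i)) [0..<length ds]) \<in> A \<zero>\<^sub>d \<and>
    (if evenperm \<pi> then tw.pr (\<Prod>i = 0..<length ds. lift_mat ds ds X $$ (i, \<pi> i))
     else - tw.pr (\<Prod>i = 0..<length ds. lift_mat ds ds X $$ (i, \<pi> i)))
    = signed s (prod_list (map (\<lambda>i. X $$ (i, \<pi> i)) [0..<length ds]))"
proof -
  let ?N = "length ds"
  let ?g = "\<lambda>i. deg_add (ds ! i) (ds ! \<pi> i)"
  let ?c = "\<lambda>i. twist (?g i) (ds ! \<pi> i)"
  have \<pi>N: "\<pi> i < ?N" if "i < ?N" for i
    using permutes_in_image[OF \<pi>] that by auto
  have dp: "ds ! i \<in> degrees_of_parity p" if "i < ?N" for i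
    using par that by auto
  then have d: "ds ! i \<in> degrees n" if "i < ?N" for i
    using that by (auto simp: degrees_of_parity_def)
  have g: "?g i \<in> degrees_of_parity 0" if "i < ?N" for i
    using deg_scalar_same_parity[OF dp[OF that] dp[OF \<pi>N[OF that]]] d[OF that] d[OF \<pi>N[OF that]]
    by (simp add: degrees_of_parity_def deg_add_closed)
  obtain s \<gamma> where \<gamma>: "\<gamma> \<in> degrees n" "\<forall>t<n. \<gamma> ! t = (\<Sum>i<?N. ?g i ! t)"
    and x: "\<And>x. (\<forall>i<?N. x i \<in> A (?g i)) \<Longrightarrow> prod_list (map x [0..<?N]) \<in> A \<gamma> \<and>
      tw.pr (\<Prod>i = 0..<?N. tw.emb (x i)) = signed s (prod_list (map x [0..<?N]))"
    using component_prod_homogeneous[of ?N ?g] g by auto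
  \<comment> \<open>every degree of the list occurs once as a row and once as a column\<close>
  have "\<gamma> = \<zero>\<^sub>d"
  proof (rule degree_eqI[OF \<gamma>(1) deg_zero_closed])
    fix t assume t: "t < n"
    have "\<gamma> ! t = (\<Sum>i<?N. ds ! i ! t + ds ! \<pi> i ! t)"
      using \<gamma>(2) t d \<pi>N by (auto intro!: sum.cong simp: nth_deg_add[of _ n])
    then show "\<gamma> ! t = \<zero>\<^sub>d ! t"
      using sum_bit_permute_self[OF \<pi>, of "\<lambda>i. ds ! i ! t"] t by (simp add: nth_deg_zero)
  qed
  obtain s' where s': "\<And>x :: nat \<Rightarrow> 'a.
     prod_list (map (\<lambda>i. signed (?c i) (x i)) [0..<?N]) = signed s' (prod_list (map x [0..<?N]))"
    using prod_list_signed[of ?c ?N] by blast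
  show ?thesis
  proof (intro exI[of _ "(if evenperm \<pi> then 0 else 1) + (s + s')"] ballI conjI)
    fix X assume X: "X \<in> gmats ds ds"
    have XA: "X $$ (i, \<pi> i) \<in> A (?g i)" if "i < ?N" for i
      using gmatsD(2)[OF X that \<pi>N[OF that]] .
    then show "prod_list (map (\<lambda>i. X $$ (i, \<pi> i)) [0..<?N]) \<in> A \<zero>\<^sub>d"
      using x[of "\<lambda>i. X $$ (i, \<pi> i)"] \<open>\<gamma> = \<zero>\<^sub>d\<close> by auto
    have "(\<Prod>i = 0..<?N. lift_mat ds ds X $$ (i, \<pi> i))
        = (\<Prod>i = 0..<?N. tw.emb (signed (?c i) (X $$ (i, \<pi> i))))"
      using \<pi>N by (intro prod.cong) (auto simp: lift_mat_def twisted_entry_def)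
    moreover have "signed (?c i) (X $$ (i, \<pi> i)) \<in> A (?g i)" if "i < ?N" for i
      using XA[OF that] d[OF that] d[OF \<pi>N[OF that]] by (simp add: homogeneous_signed deg_add_closed)
    ultimately have "tw.pr (\<Prod>i = 0..<?N. lift_mat ds ds X $$ (i, \<pi> i))
        = signed (s + s') (prod_list (map (\<lambda>i. X $$ (i, \<pi> i)) [0..<?N]))"
      using x[of "\<lambda>i. signed (?c i) (X $$ (i, \<pi> i))"] by (simp add: s' signed_signed)
    then show "(if evenperm \<pi> then tw.pr (\<Prod>i = 0..<?N. lift_mat ds ds X $$ (i, \<pi> i))
         else - tw.pr (\<Prod>i = 0..<?N. lift_mat ds ds X $$ (i, \<pi> i)))
        = signed ((if evenperm \<pi> then 0 else 1) + (s + s'))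
           (prod_list (map (\<lambda>i. X $$ (i, \<pi> i)) [0..<?N]))"
      by (simp add: signed_signed[symmetric]) (simp add: signed_def)
  qed
qed

lemma gdet_leibniz:
  assumes par: "set ds \<subseteq> degrees_of_parity p"
  obtains s where "\<And>X. X \<in> gmats ds ds \<Longrightarrow> gdet ds X
      = (\<Sum>\<pi> | \<pi> permutes {0..<length ds}.
          signed (s \<pi>) (prod_list (map (\<lambda>i. X $$ (i, \<pi> i)) [0..<length ds])))"
    and "\<And>X \<pi>. X \<in> gmats ds ds \<Longrightarrow> \<pi> permutes {0..<length ds} \<Longrightarrow>
          prod_list (map (\<lambda>i. X $$ (i, \<pi> i)) [0..<length ds]) \<in> A \<zero>\<^sub>d"
proof -
  define Q where "Q \<pi> s \<longleftrightarrow> (\<forall>X\<in>gmats ds ds.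
      prod_list (map (\<lambda>i. X $$ (i, \<pi> i)) [0..<length ds]) \<in> A \<zero>\<^sub>d \<and>
      (if evenperm \<pi> then tw.pr (\<Prod>i = 0..<length ds. lift_mat ds ds X $$ (i, \<pi> i))
       else - tw.pr (\<Prod>i = 0..<length ds. lift_mat ds ds X $$ (i, \<pi> i)))
      = signed s (prod_list (map (\<lambda>i. X $$ (i, \<pi> i)) [0..<length ds])))" for \<pi> s
  have "\<exists>s. Q \<pi> s" if "\<pi> permutes {0..<length ds}" for \<pi>
    using gdet_leibniz_term[OF par that] unfolding Q_def .
  then obtain s where s: "\<And>\<pi>. \<pi> permutes {0..<length ds} \<Longrightarrow> Q \<pi> (s \<pi>)"
    by metis
  show thesis
  proof (rule that[of s])
    fix X assume X: "X \<in> gmats ds ds"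
    show "gdet ds X = (\<Sum>\<pi> | \<pi> permutes {0..<length ds}.
          signed (s \<pi>) (prod_list (map (\<lambda>i. X $$ (i, \<pi> i)) [0..<length ds])))"
      unfolding gdet_expand
      by (rule sum.cong[OF refl], rule s[unfolded Q_def, rule_format, THEN conjunct2, OF _ X], simp)
    show "prod_list (map (\<lambda>i. X $$ (i, \<pi> i)) [0..<length ds]) \<in> A \<zero>\<^sub>d"
      if "\<pi> permutes {0..<length ds}" for \<pi>
      by (rule s[OF that, unfolded Q_def, rule_format, OF X, THEN conjunct1])
  qed
qed

lemma gdet_deg_zero:
  assumes "set ds \<subseteq> degrees_of_parity p" "X \<in> gmats ds ds"
  shows "gdet ds X \<in> A \<zero>\<^sub>d"
proof -
  obtain s where "gdet ds X = (\<Sum>\<pi> | \<pi> permutes {0..<length ds}.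
          signed (s \<pi>) (prod_list (map (\<lambda>i. X $$ (i, \<pi> i)) [0..<length ds])))"
    and "\<And>\<pi>. \<pi> permutes {0..<length ds} \<Longrightarrow>
          prod_list (map (\<lambda>i. X $$ (i, \<pi> i)) [0..<length ds]) \<in> A \<zero>\<^sub>d"
    by (rule gdet_leibniz[OF assms(1)]) (use assms(2) in blast)
  then show ?thesis
    by (auto intro!: homogeneous_sum homogeneous_signed deg_zero_closed)
qed

lemma twisted_mult_deg_zero: "\<lbrakk>a \<in> A \<zero>\<^sub>d; b \<in> A \<zero>\<^sub>d\<rbrakk> \<Longrightarrow> a \<star> b = a * b"
  using twisted_mult_homogeneous[OF deg_zero_closed deg_zero_closed]
  by (simp add: twist_zero_left[OF deg_zero_closed])

lemma gdet_mult:
  assumes par: "set ds \<subseteq> degrees_of_parity p" and X: "X \<in> gmats ds ds" and Y: "Y \<in> gmats ds ds"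
  shows "gdet ds (X * Y) = gdet ds X * gdet ds Y"
  using gdet_deg_zero[OF par X] gdet_deg_zero[OF par Y]
  by (simp only: gdet_def lift_mat_mult[OF X Y par par par] det_mult[OF lift_mat_carrier lift_mat_carrier]
      tw.component_mult twisted_mult_deg_zero)

lemma gdet_block_lower:
  assumes par: "set ds \<subseteq> degrees_of_parity p" "set es \<subseteq> degrees_of_parity p"
    and X: "X \<in> gmats ds ds" and Z: "Z \<in> carrier_mat (length es) (length ds)" and W: "W \<in> gmats es es"
  shows "gdet (ds @ es) (four_block_mat X (0\<^sub>m (length ds) (length es)) Z W) = gdet ds X * gdet es W"
  using gdet_deg_zero[OF par(1) X] gdet_deg_zero[OF par(2) W]
  by (simp only: gdet_def lift_mat_four_block[OF gmatsD(1)[OF X] zero_carrier_mat Z gmatsD(1)[OF W]]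
      lift_mat_zero det_four_block_mat_block_lower_triangular[OF lift_mat_carrier lift_mat_carrier lift_mat_carrier]
      tw.component_mult twisted_mult_deg_zero)

lemma gdet_block_upper:
  assumes par: "set ds \<subseteq> degrees_of_parity p" "set es \<subseteq> degrees_of_parity p"
    and X: "X \<in> gmats ds ds" and Y: "Y \<in> carrier_mat (length ds) (length es)" and W: "W \<in> gmats es es"
  shows "gdet (ds @ es) (four_block_mat X Y (0\<^sub>m (length es) (length ds)) W) = gdet ds X * gdet es W"
  using gdet_deg_zero[OF par(1) X] gdet_deg_zero[OF par(2) W]
  by (simp only: gdet_def lift_mat_four_block[OF gmatsD(1)[OF X] Y zero_carrier_mat gmatsD(1)[OF W]]
      lift_mat_zero det_four_block_mat_block_upper_triangular[OF lift_mat_carrier lift_mat_carrier lift_mat_carrier]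
      tw.component_mult twisted_mult_deg_zero)

lemma gdet_constant_degree:
  assumes \<delta>: "\<delta> \<in> degrees_of_parity p" and X: "X \<in> gmats (replicate k \<delta>) (replicate k \<delta>)"
  shows "gdet (replicate k \<delta>) X = leibniz_det X"
proof -
  have d: "\<delta> \<in> degrees n"
    using \<delta> by (simp add: degrees_of_parity_def)
  have A0: "X $$ (i, j) \<in> A \<zero>\<^sub>d" if "i < k" "j < k" for i j
    using gmatsD(2)[OF X, of i j] that by (simp add: deg_add_self[OF d])
  have prod: "tw.pr (\<Prod>i = 0..<l. tw.emb (x i)) = prod_list (map x [0..<l]) \<and> prod_list (map x [0..<l]) \<in> A \<zero>\<^sub>d"
    if "\<And>i. i < l \<Longrightarrow> x i \<in> A \<zero>\<^sub>d" for x l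
    using that
  proof (induction l)
    case 0
    then show ?case by (simp add: tw.component_one one_homogeneous)
  next
    case (Suc l)
    then have "x l \<in> even_part"
      using homogeneous_even[OF deg_zero_closed deg_scalar_zero] by simp
    then show ?case
      using Suc by (simp add: tw.component_mult tw.component_concentrate twisted_mult_deg_zero deg_zero_mult)
  qed
  have "tw.pr (\<Prod>i = 0..<k. lift_mat (replicate k \<delta>) (replicate k \<delta>) X $$ (i, \<pi> i))
      = prod_list (map (\<lambda>i. X $$ (i, \<pi> i)) [0..<k])" if "\<pi> permutes {0..<k}" for \<pi>
  proof -
    have "(\<Prod>i = 0..<k. lift_mat (replicate k \<delta>) (replicate k \<delta>) X $$ (i, \<pi> i))
        = (\<Prod>i = 0..<k. tw.emb (X $$ (i, \<pi> i)))"
      using permutes_in_image[OF that]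
      by (intro prod.cong) (auto simp: lift_mat_def twisted_entry_self[OF d])
    then show ?thesis
      using prod[of k "\<lambda>i. X $$ (i, \<pi> i)"] A0 permutes_in_image[OF that] by auto
  qed
  then show ?thesis
    using gmatsD(1)[OF X]
    by (auto simp: gdet_expand leibniz_det_def atLeast0LessThan intro!: sum.cong)
qed

text \<open>
  A matrix for which only the identity permutation contributes to the Leibniz formula.
\<close>

lemma gdet_single_permutation:
  assumes par: "set ds \<subseteq> degrees_of_parity p" and X: "X \<in> gmats ds ds" and m: "m < length ds"
    and diag: "\<And>i. i < length ds \<Longrightarrow> i \<noteq> m \<Longrightarrow> X $$ (i, i) = 1"
    and off: "\<And>\<pi>. \<pi> permutes {0..<length ds} \<Longrightarrow> \<pi> \<noteq> id \<Longrightarrow> \<exists>i<length ds. X $$ (i, \<pi> i) = 0"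
  shows "gdet ds X = X $$ (m, m)"
proof -
  let ?N = "length ds"
  let ?L = "lift_mat ds ds X"
  have d: "ds ! i \<in> degrees n" if "i < ?N" for i
    using degrees_of_parity_subset[OF par] that by auto
  have "(\<Prod>i = 0..<?N. ?L $$ (i, \<pi> i)) = 0" if \<pi>: "\<pi> permutes {0..<?N}" "\<pi> \<noteq> id" for \<pi>
  proof -
    obtain i where i: "i < ?N" "X $$ (i, \<pi> i) = 0"
      using off[OF \<pi>] by blast
    moreover have "\<pi> i < ?N"
      using permutes_in_image[OF \<pi>(1), of i] i by auto
    ultimately show ?thesis
      by (intro prod_zero) (auto intro!: bexI[of _ i] simp: lift_mat_def tw.concentrate_zero)
  qed
  then have "gdet ds X = (\<Sum>\<pi> | \<pi> permutes {0..<?N}.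
      if \<pi> = id then tw.pr (\<Prod>i = 0..<?N. ?L $$ (i, i)) else 0)"
    unfolding gdet_expand by (intro sum.cong) auto
  also have "\<dots> = tw.pr (\<Prod>i = 0..<?N. ?L $$ (i, i))"
    by (simp add: finite_permutations permutes_id)
  also have "\<dots> = tw.pr (\<Prod>i = 0..<?N. if i = m then ?L $$ (m, m) else 1)"
    using diag d component_lift_mat[OF X par par]
    by (intro tw.component_prod_cong) (auto simp: tw.component_one twisted_entry_self)
  also have "\<dots> = X $$ (m, m)"
    using m d component_lift_mat[OF X par par] by (simp add: twisted_entry_self)
  finally show ?thesis .
qed

lemma gdet_identity_off_row:
  assumes par: "set ds \<subseteq> degrees_of_parity p" and X: "X \<in> gmats ds ds" and m: "m < length ds"
    and one: "\<And>i j. i < length ds \<Longrightarrow> j < length ds \<Longrightarrow> i \<noteq> m \<Longrightarrow> X $$ (i, j) = (if i = j then 1 else 0)"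
  shows "gdet ds X = X $$ (m, m)"
proof (rule gdet_single_permutation[OF par X m])
  fix \<pi> assume "\<pi> permutes {0..<length ds}" "\<pi> \<noteq> id"
  then obtain i where "i < length ds" "\<pi> i < length ds" "\<pi> (\<pi> i) < length ds"
    "\<pi> i \<noteq> i" "\<pi> (\<pi> i) \<noteq> \<pi> i"
    by (rule permutes_moves_two)
  then show "\<exists>i<length ds. X $$ (i, \<pi> i) = 0"
    using one[of i "\<pi> i"] one[of "\<pi> i" "\<pi> (\<pi> i)"] by metis
qed (use one in auto)

lemma gdet_identity_off_col:
  assumes par: "set ds \<subseteq> degrees_of_parity p" and X: "X \<in> gmats ds ds" and m: "m < length ds"
    and one: "\<And>i j. i < length ds \<Longrightarrow> j < length ds \<Longrightarrow> j \<noteq> m \<Longrightarrow> X $$ (i, j) = (if i = j then 1 else 0)"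
  shows "gdet ds X = X $$ (m, m)"
proof (rule gdet_single_permutation[OF par X m])
  fix \<pi> assume "\<pi> permutes {0..<length ds}" "\<pi> \<noteq> id"
  then obtain i where "i < length ds" "\<pi> i < length ds" "\<pi> (\<pi> i) < length ds"
    "\<pi> i \<noteq> i" "\<pi> (\<pi> i) \<noteq> \<pi> i"
    by (rule permutes_moves_two)
  then show "\<exists>i<length ds. X $$ (i, \<pi> i) = 0"
    using one[of i "\<pi> i"] one[of "\<pi> i" "\<pi> (\<pi> i)"] by metis
qed (use one in auto)

text \<open>
  The adjugate matrix over the twisted ring, divided by the determinant, is an inverse over that ring
  with entries in the even part. Replacing each entry by its component in the degree that it should
  have does not destroy the inverse, because the other factor and the identity matrix are homogeneous.
\<close>

lemma right_inverse_of_unit_gdet: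
  assumes par: "set ds \<subseteq> degrees_of_parity p" and X: "X \<in> gmats ds ds"
    and u: "u \<in> A \<zero>\<^sub>d" "u * gdet ds X = 1"
  shows "\<exists>Y\<in>gmats ds ds. X * Y = 1\<^sub>m (length ds)"
proof -
  let ?N = "length ds"
  let ?M = "lift_mat ds ds X"
  have d: "ds ! i \<in> degrees n" if "i < ?N" for i
    using degrees_of_parity_subset[OF par] that by auto
  \<comment> \<open>the entries of the twisted inverse, before projection to the expected degrees\<close>
  define v where "v j k = tw.pr (tw.emb u * adj_mat ?M $$ (j, k))" for j k
  define Y where "Y = mat ?N ?N (\<lambda>(j, k).
    twisted_entry (ds ! j) (ds ! k) (part (deg_add (ds ! j) (ds ! k)) (v j k)))"
  have Y: "Y \<in> gmats ds ds"
    unfolding Y_def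
    by (intro gmatsI) (auto intro!: twisted_entry_homogeneous part_homogeneous deg_add_closed d)
  have Yt: "twisted_entry (ds ! j) (ds ! k) (Y $$ (j, k)) = part (deg_add (ds ! j) (ds ! k)) (v j k)"
    if "j < ?N" "k < ?N" for j k
    using that by (simp add: Y_def)
  have uE: "u \<in> even_part"
    using homogeneous_even[OF deg_zero_closed deg_scalar_zero u(1)] .
  have adj: "(\<Sum>j<?N. twisted_entry (ds ! i) (ds ! j) (X $$ (i, j)) \<star> v j k) = (if i = k then 1 else 0)"
    if i: "i < ?N" and k: "k < ?N" for i k
  proof -
    have "(\<Sum>j<?N. twisted_entry (ds ! i) (ds ! j) (X $$ (i, j)) \<star> v j k)
        = tw.pr (\<Sum>j<?N. ?M $$ (i, j) * (tw.emb u * adj_mat ?M $$ (j, k)))"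
      using i component_lift_mat[OF X par par i] by (simp add: v_def tw.component_mult)
    also have "(\<Sum>j<?N. ?M $$ (i, j) * (tw.emb u * adj_mat ?M $$ (j, k)))
        = tw.emb u * (?M * adj_mat ?M) $$ (i, k)"
      unfolding index_mult_mat_sum[OF lift_mat_carrier adj_mat(1)[OF lift_mat_carrier] i k]
      by (simp add: sum_distrib_left mult.left_commute)
    also have "\<dots> = (if i = k then tw.emb u * det ?M else 0)"
      using i k by (simp add: adj_mat(2)[OF lift_mat_carrier])
    also have "tw.pr \<dots> = (if i = k then 1 else 0)"
      using u gdet_deg_zero[OF par X]
      by (simp add: tw.component_mult tw.component_concentrate[OF uE] twisted_mult_deg_zero
          flip: gdet_def)
    finally show ?thesis .
  qed
  have "X * Y = 1\<^sub>m ?N"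
  proof (rule eq_matI)
    fix i k assume "i < dim_row (1\<^sub>m ?N :: 'a mat)" "k < dim_col (1\<^sub>m ?N :: 'a mat)"
    then have i: "i < ?N" and k: "k < ?N" by auto
    let ?t = "twisted_entry (ds ! i) (ds ! k)"
    have "?t ((X * Y) $$ (i, k)) = (\<Sum>j<?N. ?t (X $$ (i, j) * Y $$ (j, k)))"
      by (simp only: index_mult_mat_sum[OF gmatsD(1)[OF X] gmatsD(1)[OF Y] i k] twisted_entry_sum)
    also have "\<dots> = (\<Sum>j<?N. twisted_entry (ds ! i) (ds ! j) (X $$ (i, j))
        \<star> part (deg_add (ds ! j) (ds ! k)) (v j k))"
      using twisted_entry_mult[OF d[OF i] d d[OF k] gmatsD(2)[OF X i] gmatsD(2)[OF Y _ k]] k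
      by (intro sum.cong refl) (simp flip: Yt)
    also have "\<dots> = (\<Sum>j<?N. part (deg_add (ds ! i) (ds ! k))
        (twisted_entry (ds ! i) (ds ! j) (X $$ (i, j)) \<star> v j k))"
    proof (rule sum.cong[OF refl])
      fix j assume "j \<in> {..<?N}"
      then have j: "j < ?N" by simp
      show "twisted_entry (ds ! i) (ds ! j) (X $$ (i, j)) \<star> part (deg_add (ds ! j) (ds ! k)) (v j k)
          = part (deg_add (ds ! i) (ds ! k)) (twisted_entry (ds ! i) (ds ! j) (X $$ (i, j)) \<star> v j k)"
        using part_twisted_mult_left[OF deg_add_closed[OF d[OF i] d[OF j]]
            deg_add_closed[OF d[OF j] d[OF k]]
            twisted_entry_homogeneous[OF d[OF i] d[OF j] gmatsD(2)[OF X i j]], of "v j k"]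
        by (simp add: deg_add_telescope[OF d[OF i] d[OF j] d[OF k]])
    qed
    also have "\<dots> = part (deg_add (ds ! i) (ds ! k)) (if i = k then 1 else 0)"
      using deg_add_closed[OF d[OF i] d[OF k]] by (simp add: part_sum[symmetric] adj[OF i k])
    also have "\<dots> = (if i = k then 1 else 0)"
      using deg_add_closed[OF d[OF i] d[OF k]]
      by (simp add: part_zero deg_add_self[OF d[OF i]] deg_add_self[OF d[OF k]]
          part_of_homogeneous[OF deg_zero_closed deg_zero_closed one_homogeneous])
    finally have "(X * Y) $$ (i, k) = ?t (if i = k then 1 else 0)"
      by (metis twisted_entry_twisted_entry)
    then show "(X * Y) $$ (i, k) = 1\<^sub>m ?N $$ (i, k)"
      using i k d by (auto simp: twisted_entry_self)
  qed (use gmatsD(1)[OF X] gmatsD(1)[OF Y] in auto)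
  with Y show ?thesis by blast
qed

lemma inverse_of_unit_gdet:
  assumes par: "set ds \<subseteq> degrees_of_parity p" and X: "X \<in> gmats ds ds"
    and u: "u \<in> A \<zero>\<^sub>d" "u * gdet ds X = 1"
  obtains Y where "Y \<in> gmats ds ds" "X * Y = 1\<^sub>m (length ds)" "Y * X = 1\<^sub>m (length ds)"
proof -
  obtain Y where Y: "Y \<in> gmats ds ds" "X * Y = 1\<^sub>m (length ds)"
    using right_inverse_of_unit_gdet[OF assms] by blast
  have "gdet ds X * gdet ds Y = 1"
    using gdet_mult[OF par X Y(1)] Y(2) gdet_one[OF par] by simp
  then obtain Z where Z: "Z \<in> gmats ds ds" "Y * Z = 1\<^sub>m (length ds)"
    using right_inverse_of_unit_gdet[OF par Y(1) gdet_deg_zero[OF par X]] by blast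
  have "X = X * (Y * Z)"
    using Z(2) mult_one_mat[OF gmatsD(1)[OF X]] by simp
  also have "\<dots> = Z"
    using assoc_mult_mat[OF gmatsD(1)[OF X] gmatsD(1)[OF Y(1)] gmatsD(1)[OF Z(1)]] Y(2)
      one_mult_mat[OF gmatsD(1)[OF Z(1)]] by simp
  finally show thesis
    using that Y Z(2) by blast
qed

end


section \<open>Odd blocks and the Berezinian of an invertible matrix\<close>

lemma left_mult_uminus_mat:
  fixes X :: "'a::ring mat"
  assumes "X \<in> carrier_mat n k" "Y \<in> carrier_mat k m"
  shows "- X * Y = - (X * Y)"
  using assms by (intro eq_matI) (auto simp: scalar_prod_def sum_negf)

lemma right_mult_uminus_mat:
  fixes X :: "'a::ring mat"
  assumes "X \<in> carrier_mat n k" "Y \<in> carrier_mat k m"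
  shows "X * - Y = - (X * Y)"
  using assms by (intro eq_matI) (auto simp: scalar_prod_def sum_negf)

text \<open>
  This identity moves the inverse of \<open>1 + C * B\<close> past \<open>C\<close>, where it becomes the inverse of
  \<open>1 + B * C\<close>.
\<close>

lemma push_through:
  fixes B :: "'a::{ring, monoid_mult} mat"
  assumes B: "B \<in> carrier_mat n m" and C: "C \<in> carrier_mat m n"
  shows "C * (1\<^sub>m n + B * C) = (1\<^sub>m m + C * B) * C"
  using mult_add_distrib_mat[OF C one_carrier_mat mult_carrier_mat[OF B C]]
    add_mult_distrib_mat[OF one_carrier_mat mult_carrier_mat[OF C B] C]
    mult_one_mat[OF C] one_mult_mat[OF C] assoc_mult_mat[OF C B C]
  by simp

context graded_commutative_algebra
begin

text \<open>
  If \<open>b\<close> is the only nonzero entry of \<open>B\<close> and \<open>c\<close> the entry of \<open>C\<close> at the transposed position,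
  then \<open>1 + B * C\<close> differs from the identity in a single row and \<open>1 + C * B\<close> in a single column, so
  the determinants are \<open>1 + b * c\<close> and \<open>1 + c * b = 1 - b * c\<close>. Their product is \<open>1\<close> because
  \<open>b * b = 0\<close>.
\<close>

lemma gdet_one_plus_single_entry:
  assumes pds: "set ds \<subseteq> degrees_of_parity p" and pes: "set es \<subseteq> degrees_of_parity q"
    and pq: "p + q = 1"
    and B: "B \<in> gmats ds es" and C: "C \<in> gmats es ds"
    and k: "k < length ds" and l: "l < length es"
    and single: "\<And>i j. i < length ds \<Longrightarrow> j < length es \<Longrightarrow> (i, j) \<noteq> (k, l) \<Longrightarrow> B $$ (i, j) = 0"
  shows "gdet ds (1\<^sub>m (length ds) + B * C) * gdet es (1\<^sub>m (length es) + C * B) = 1"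
proof -
  note dds = degrees_of_parity_subset[OF pds] and des = degrees_of_parity_subset[OF pes]
  note Bc = gmatsD(1)[OF B] and Cc = gmatsD(1)[OF C]
  let ?b = "B $$ (k, l)" and ?c = "C $$ (l, k)" and ?\<gamma> = "deg_add (ds ! k) (es ! l)"
  have BC: "(B * C) $$ (i, j) = (if i = k then ?b * C $$ (l, j) else 0)"
    if i: "i < length ds" and j: "j < length ds" for i j
  proof -
    have "(B * C) $$ (i, j) = (\<Sum>t<length es. if t = l then (if i = k then ?b * C $$ (l, j) else 0) else 0)"
      unfolding index_mult_mat_sum[OF Bc Cc i j]
      using single[OF i] i by (intro sum.cong) auto
    then show ?thesis using l by simp
  qed
  have CB: "(C * B) $$ (i, j) = (if j = l then C $$ (i, k) * ?b else 0)"
    if i: "i < length es" and j: "j < length es" for i j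
  proof -
    have "(C * B) $$ (i, j) = (\<Sum>t<length ds. if t = k then (if j = l then C $$ (i, k) * ?b else 0) else 0)"
      unfolding index_mult_mat_sum[OF Cc Bc i j]
      using single[OF _ j] j by (intro sum.cong) auto
    then show ?thesis using k by simp
  qed
  have row: "gdet ds (1\<^sub>m (length ds) + B * C) = 1 + ?b * ?c"
    using gdet_identity_off_row[OF pds gmats_add[OF gmats_one[OF dds] gmats_mult[OF B C dds des dds] dds dds] k]
      Bc Cc k BC by simp
  have col: "gdet es (1\<^sub>m (length es) + C * B) = 1 + ?c * ?b"
    using gdet_identity_off_col[OF pes gmats_add[OF gmats_one[OF des] gmats_mult[OF C B des dds des] des des] l]
      Bc Cc l CB by simp
  have dk: "ds ! k \<in> degrees_of_parity p" and el: "es ! l \<in> degrees_of_parity q"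
    using pds pes k l by auto
  then have dkn: "ds ! k \<in> degrees n" and eln: "es ! l \<in> degrees n"
    and \<gamma>: "?\<gamma> \<in> degrees n" "deg_scalar ?\<gamma> ?\<gamma> = 1"
    using pq by (auto simp: degrees_of_parity_def deg_add_closed deg_scalar_self_add[of _ n])
  have b: "?b \<in> A ?\<gamma>" and c: "?c \<in> A ?\<gamma>"
    using gmatsD(2)[OF B k l] gmatsD(2)[OF C l k] by (simp_all add: deg_add_commute[OF eln dkn])
  have cb: "?c * ?b = - (?b * ?c)"
    using graded_commute[OF \<gamma>(1) \<gamma>(1) b c] \<gamma>(2) by simp
  have "?b * ?c * (?b * ?c) = ?b * (?c * ?b) * ?c"
    by (simp add: mult.assoc)
  also have "\<dots> = - (?b * ?b * (?c * ?c))"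
    by (simp add: cb mult.assoc)
  also have "\<dots> = 0"
    using odd_square_zero[OF \<gamma> b] by simp
  finally show ?thesis
    by (simp add: row col cb distrib_left distrib_right right_diff_distrib left_diff_distrib)
qed

text \<open>
  With \<open>C' = (1 + C * B)\<^sup>-\<^sup>1 * C\<close> one has \<open>1 + C * (B + B') = (1 + C * B) * (1 + C' * B')\<close> and, by
  \<open>push_through\<close>, \<open>1 + (B + B') * C = (1 + B' * C') * (1 + B * C)\<close>. The identity for \<open>B\<close> provides
  the inverse, and the identities for \<open>B\<close> and \<open>B'\<close> multiply.
\<close>

lemma gdet_one_plus_add:
  assumes pds: "set ds \<subseteq> degrees_of_parity p" and pes: "set es \<subseteq> degrees_of_parity q"
    and B: "B \<in> gmats ds es" and B': "B' \<in> gmats ds es"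
    and P: "\<And>C. C \<in> gmats es ds \<Longrightarrow>
      gdet ds (1\<^sub>m (length ds) + B * C) * gdet es (1\<^sub>m (length es) + C * B) = 1"
    and P': "\<And>C. C \<in> gmats es ds \<Longrightarrow>
      gdet ds (1\<^sub>m (length ds) + B' * C) * gdet es (1\<^sub>m (length es) + C * B') = 1"
    and C: "C \<in> gmats es ds"
  shows "gdet ds (1\<^sub>m (length ds) + (B + B') * C) * gdet es (1\<^sub>m (length es) + C * (B + B')) = 1"
proof -
  note dds = degrees_of_parity_subset[OF pds] and des = degrees_of_parity_subset[OF pes]
  let ?I = "1\<^sub>m (length ds) :: 'a mat" and ?J = "1\<^sub>m (length es) :: 'a mat"
  have one_BC: "?I + X * Y \<in> gmats ds ds" if "X \<in> gmats ds es" "Y \<in> gmats es ds" for X Y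
    using that by (intro gmats_add gmats_one gmats_mult[where es = es] dds des)
  have one_CB: "?J + Y * X \<in> gmats es es" if "X \<in> gmats ds es" "Y \<in> gmats es ds" for X Y
    using that by (intro gmats_add gmats_one gmats_mult[where es = ds] dds des)
  \<comment> \<open>the identity for \<open>B\<close> also shows that \<open>1 + C * B\<close> is invertible\<close>
  obtain V where V: "V \<in> gmats es es" "(?J + C * B) * V = ?J" "V * (?J + C * B) = ?J"
    using inverse_of_unit_gdet[OF pes one_CB[OF B C] gdet_deg_zero[OF pds one_BC[OF B C]] P[OF C]] .
  let ?C = "V * C"
  have C': "?C \<in> gmats es ds"
    by (rule gmats_mult[OF V(1) C des des dds])
  note c = gmatsD(1)[OF B] gmatsD(1)[OF B'] gmatsD(1)[OF C] gmatsD(1)[OF V(1)] gmatsD(1)[OF C']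
  have VC: "?C * (?I + B * C) = C"
  proof -
    have "?C * (?I + B * C) = V * (C * (?I + B * C))"
      by (rule assoc_mult_mat[OF c(4,3) gmatsD(1)[OF one_BC[OF B C]]])
    also have "\<dots> = V * (?J + C * B) * C"
      unfolding push_through[OF c(1,3)]
      by (rule assoc_mult_mat[OF c(4) gmatsD(1)[OF one_CB[OF B C]] c(3), symmetric])
    finally show ?thesis
      using one_mult_mat[OF c(3)] V(3) by simp
  qed
  have CV: "(?J + C * B) * ?C = C"
    using assoc_mult_mat[OF gmatsD(1)[OF one_CB[OF B C]] c(4,3)] V(2) one_mult_mat[OF c(3)] by simp
  have "(?I + B' * ?C) * (?I + B * C) = (?I + B * C) + B' * ?C * (?I + B * C)"
    using add_mult_distrib_mat[OF one_carrier_mat mult_carrier_mat[OF c(2,5)] gmatsD(1)[OF one_BC[OF B C]]]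
      one_mult_mat[OF gmatsD(1)[OF one_BC[OF B C]]] by simp
  also have "B' * ?C * (?I + B * C) = B' * C"
    using assoc_mult_mat[OF c(2,5) gmatsD(1)[OF one_BC[OF B C]]] VC by simp
  also have "(?I + B * C) + B' * C = ?I + (B + B') * C"
    using add_mult_distrib_mat[OF c(1,2,3)]
      assoc_add_mat[OF one_carrier_mat mult_carrier_mat[OF c(1,3)] mult_carrier_mat[OF c(2,3)]] by simp
  finally have 1: "(?I + B' * ?C) * (?I + B * C) = ?I + (B + B') * C" .
  have "(?J + C * B) * (?J + ?C * B') = (?J + C * B) + (?J + C * B) * (?C * B')"
    using mult_add_distrib_mat[OF gmatsD(1)[OF one_CB[OF B C]] one_carrier_mat mult_carrier_mat[OF c(5,2)]]
      mult_one_mat[OF gmatsD(1)[OF one_CB[OF B C]]] by simp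
  also have "(?J + C * B) * (?C * B') = C * B'"
    using assoc_mult_mat[OF gmatsD(1)[OF one_CB[OF B C]] c(5,2)] CV by simp
  also have "(?J + C * B) + C * B' = ?J + C * (B + B')"
    using mult_add_distrib_mat[OF c(3,1,2)]
      assoc_add_mat[OF one_carrier_mat mult_carrier_mat[OF c(3,1)] mult_carrier_mat[OF c(3,2)]] by simp
  finally have 2: "(?J + C * B) * (?J + ?C * B') = ?J + C * (B + B')" .
  have "gdet ds (?I + (B + B') * C) * gdet es (?J + C * (B + B'))
      = gdet ds (?I + B' * ?C) * (gdet ds (?I + B * C) * gdet es (?J + C * B)) * gdet es (?J + ?C * B')"
    unfolding 1[symmetric] 2[symmetric]
      gdet_mult[OF pds one_BC[OF B' C'] one_BC[OF B C]] gdet_mult[OF pes one_CB[OF B C] one_CB[OF B' C']]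
    by (simp add: mult.assoc)
  then show ?thesis
    by (simp add: P[OF C] P'[OF C'])
qed

text \<open>
  The super analogue of \<open>det (1 + B * C) = det (1 + C * B)\<close>: for odd blocks the two determinants are
  inverse to each other. The proof adds up the entries of \<open>B\<close> one at a time.
\<close>

theorem gdet_one_plus_odd:
  assumes pds: "set ds \<subseteq> degrees_of_parity p" and pes: "set es \<subseteq> degrees_of_parity q"
    and pq: "p + q = 1"
    and B: "B \<in> gmats ds es" and C: "C \<in> gmats es ds"
  shows "gdet ds (1\<^sub>m (length ds) + B * C) * gdet es (1\<^sub>m (length es) + C * B) = 1"
proof -
  note dds = degrees_of_parity_subset[OF pds] and des = degrees_of_parity_subset[OF pes]
  define R where "R T = mat (length ds) (length es) (\<lambda>ij. if ij \<in> T then B $$ ij else 0)" for T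
  have R: "R T \<in> gmats ds es" for T
  proof (rule gmatsI)
    show "R T \<in> carrier_mat (length ds) (length es)"
      by (simp add: R_def)
    fix i j assume ij: "i < length ds" "j < length es"
    then show "R T $$ (i, j) \<in> A (deg_add (ds ! i) (es ! j))"
      using gmatsD(2)[OF B ij] nth_degrees[OF dds ij(1)] nth_degrees[OF des ij(2)]
      by (simp add: R_def homogeneous_zero deg_add_closed)
  qed
  have "\<forall>C\<in>gmats es ds. gdet ds (1\<^sub>m (length ds) + R T * C) * gdet es (1\<^sub>m (length es) + C * R T) = 1"
    if "finite T" "T \<subseteq> {..<length ds} \<times> {..<length es}" for T
    using that
  proof (induction T rule: finite_induct)
    case empty
    show ?case
    proof
      fix C assume C: "C \<in> gmats es ds"
      have "R {} = 0\<^sub>m (length ds) (length es)"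
        by (intro eq_matI) (auto simp: R_def)
      then show "gdet ds (1\<^sub>m (length ds) + R {} * C) * gdet es (1\<^sub>m (length es) + C * R {}) = 1"
        using gmatsD(1)[OF C] by (simp add: gdet_one[OF pds] gdet_one[OF pes])
    qed
  next
    case (insert t T)
    obtain k l where t: "t = (k, l)" and kl: "k < length ds" "l < length es"
      using insert.prems by auto
    have single: "gdet ds (1\<^sub>m (length ds) + R {t} * C) * gdet es (1\<^sub>m (length es) + C * R {t}) = 1"
      if "C \<in> gmats es ds" for C
      by (rule gdet_one_plus_single_entry[OF pds pes pq R that kl]) (auto simp: R_def t)
    have split: "R (insert t T) = R T + R {t}"
      using insert.hyps by (intro eq_matI) (auto simp: R_def)
    show ?case
      unfolding split
      by (intro ballI gdet_one_plus_add[OF pds pes R R _ single]) (use insert in auto)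
  qed
  moreover have "R ({..<length ds} \<times> {..<length es}) = B"
    using gmatsD(1)[OF B] by (intro eq_matI) (auto simp: R_def)
  ultimately show ?thesis
    using C by (metis finite_SigmaI finite_lessThan order_refl)
qed

lemma gmats_blocks:
  assumes X: "X \<in> gmats (ds @ es) (ds @ es)"
  obtains P Q R S where "X = four_block_mat P Q R S"
    "P \<in> gmats ds ds" "Q \<in> gmats ds es" "R \<in> gmats es ds" "S \<in> gmats es es"
proof -
  obtain P Q R S where s: "split_block X (length ds) (length ds) = (P, Q, R, S)"
    by (metis prod_cases4)
  have d: "dim_row X = length ds + length es" "dim_col X = length ds + length es"
    using gmatsD(1)[OF X] by auto
  note sb = split_block[OF s d]
  show thesis
    using that[OF sb(5)] gmats_four_blockD[OF X[unfolded sb(5)] sb(1-4)] by blast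
qed

lemma four_block_mat_eqD:
  assumes "four_block_mat P Q R S = four_block_mat P' Q' R' S'"
    and "P \<in> carrier_mat a b" "Q \<in> carrier_mat a b'" "R \<in> carrier_mat a' b" "S \<in> carrier_mat a' b'"
    and "P' \<in> carrier_mat a b" "Q' \<in> carrier_mat a b'" "R' \<in> carrier_mat a' b" "S' \<in> carrier_mat a' b'"
  shows "P = P'" "Q = Q'" "R = R'" "S = S'"
proof -
  have e: "four_block_mat P Q R S $$ (i, j) = four_block_mat P' Q' R' S' $$ (i, j)" for i j
    using assms(1) by simp
  show "P = P'"
  proof (rule eq_matI)
    fix i j assume "i < dim_row P'" "j < dim_col P'"
    then show "P $$ (i, j) = P' $$ (i, j)" using e[of i j] assms(2-) by simp
  qed (use assms in auto)
  show "Q = Q'"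
  proof (rule eq_matI)
    fix i j assume "i < dim_row Q'" "j < dim_col Q'"
    then show "Q $$ (i, j) = Q' $$ (i, j)" using e[of i "b + j"] assms(2-) by simp
  qed (use assms in auto)
  show "R = R'"
  proof (rule eq_matI)
    fix i j assume "i < dim_row R'" "j < dim_col R'"
    then show "R $$ (i, j) = R' $$ (i, j)" using e[of "a + i" j] assms(2-) by simp
  qed (use assms in auto)
  show "S = S'"
  proof (rule eq_matI)
    fix i j assume "i < dim_row S'" "j < dim_col S'"
    then show "S $$ (i, j) = S' $$ (i, j)" using e[of "a + i" "b + j"] assms(2-) by simp
  qed (use assms in auto)
qed

lemma four_block_mult_eq_one:
  assumes prod: "four_block_mat P Q R S * four_block_mat P' Q' R' S' = 1\<^sub>m (length (ds @ es))"
    and X: "P \<in> gmats ds ds" "Q \<in> gmats ds es" "R \<in> gmats es ds" "S \<in> gmats es es"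
    and X': "P' \<in> gmats ds ds" "Q' \<in> gmats ds es" "R' \<in> gmats es ds" "S' \<in> gmats es es"
  shows "P * P' + Q * R' = 1\<^sub>m (length ds)" "P * Q' + Q * S' = 0\<^sub>m (length ds) (length es)"
    "R * P' + S * R' = 0\<^sub>m (length es) (length ds)" "R * Q' + S * S' = 1\<^sub>m (length es)"
proof -
  note c = X[THEN gmatsD(1)] X'[THEN gmatsD(1)]
  have "four_block_mat (P * P' + Q * R') (P * Q' + Q * S') (R * P' + S * R') (R * Q' + S * S')
      = four_block_mat (1\<^sub>m (length ds)) (0\<^sub>m (length ds) (length es)) (0\<^sub>m (length es) (length ds)) (1\<^sub>m (length es))"
    using prod mult_four_block_mat[OF c] by simp
  note e = four_block_mat_eqD[OF this]
  show "P * P' + Q * R' = 1\<^sub>m (length ds)" "P * Q' + Q * S' = 0\<^sub>m (length ds) (length es)"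
    "R * P' + S * R' = 0\<^sub>m (length es) (length ds)" "R * Q' + S * S' = 1\<^sub>m (length es)"
    by (rule e; use c in auto)+
qed

text \<open>
  The diagonal blocks of \<open>X * X' = 1\<close> read \<open>P * P' = 1 - Q * R'\<close> and \<open>S * S' = 1 - R * Q'\<close>, and the
  determinants of the right-hand sides are invertible by \<open>gdet_one_plus_odd\<close>.
\<close>

lemma gdet_corner_units:
  assumes pds: "set ds \<subseteq> degrees_of_parity p" and pes: "set es \<subseteq> degrees_of_parity q"
    and pq: "p + q = 1"
    and prod: "four_block_mat P Q R S * four_block_mat P' Q' R' S' = 1\<^sub>m (length (ds @ es))"
    and X: "P \<in> gmats ds ds" "Q \<in> gmats ds es" "R \<in> gmats es ds" "S \<in> gmats es es"
    and X': "P' \<in> gmats ds ds" "Q' \<in> gmats ds es" "R' \<in> gmats es ds" "S' \<in> gmats es es"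
  shows "\<exists>u\<in>A \<zero>\<^sub>d. u * gdet ds P = 1" "\<exists>u\<in>A \<zero>\<^sub>d. u * gdet es S = 1"
proof -
  note dds = degrees_of_parity_subset[OF pds] and des = degrees_of_parity_subset[OF pes]
  note c = X[THEN gmatsD(1)] X'[THEN gmatsD(1)]
  note eq = four_block_mult_eq_one[OF prod X X']
  have mR': "- R' \<in> gmats es ds" and mR: "- R \<in> gmats es ds"
    by (rule gmats_uminus[OF X'(3) des dds], rule gmats_uminus[OF X(3) des dds])
  have "P * P' = 1\<^sub>m (length ds) + Q * (- R')"
    unfolding eq(1)[symmetric] right_mult_uminus_mat[OF c(2,7)]
    using c by (intro eq_matI) auto
  then have P: "gdet ds P * gdet ds P' * gdet es (1\<^sub>m (length es) + - R' * Q) = 1"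
    using gdet_one_plus_odd[OF pds pes pq X(2) mR'] gdet_mult[OF pds X(1) X'(1)] by simp
  have "S * S' = 1\<^sub>m (length es) + - R * Q'"
    unfolding eq(4)[symmetric] left_mult_uminus_mat[OF c(3,6)]
    using c by (intro eq_matI) auto
  then have S: "gdet ds (1\<^sub>m (length ds) + Q' * - R) * (gdet es S * gdet es S') = 1"
    using gdet_one_plus_odd[OF pds pes pq X'(2) mR] gdet_mult[OF pes X(4) X'(4)] by simp
  have A0: "gdet ds P \<in> A \<zero>\<^sub>d" "gdet ds P' \<in> A \<zero>\<^sub>d" "gdet es S \<in> A \<zero>\<^sub>d" "gdet es S' \<in> A \<zero>\<^sub>d"
    "gdet es (1\<^sub>m (length es) + - R' * Q) \<in> A \<zero>\<^sub>d" "gdet ds (1\<^sub>m (length ds) + Q' * - R) \<in> A \<zero>\<^sub>d"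
    using gdet_deg_zero[OF pds X(1)] gdet_deg_zero[OF pds X'(1)] gdet_deg_zero[OF pes X(4)]
      gdet_deg_zero[OF pes X'(4)]
      gdet_deg_zero[OF pes gmats_add[OF gmats_one[OF des] gmats_mult[OF mR' X(2) des dds des] des des]]
      gdet_deg_zero[OF pds gmats_add[OF gmats_one[OF dds] gmats_mult[OF X'(2) mR dds des dds] dds dds]]
    by auto
  show "\<exists>u\<in>A \<zero>\<^sub>d. u * gdet ds P = 1"
    using P A0 deg_zero_central[OF A0(1)]
    by (intro bexI[of _ "gdet ds P' * gdet es (1\<^sub>m (length es) + - R' * Q)"])
      (auto simp: mult.assoc deg_zero_mult)
  show "\<exists>u\<in>A \<zero>\<^sub>d. u * gdet es S = 1"
    using S A0 deg_zero_central[OF A0(4), of "gdet es S"]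
    by (intro bexI[of _ "gdet ds (1\<^sub>m (length ds) + Q' * - R) * gdet es S'"])
      (auto simp: mult.assoc deg_zero_mult)
qed

definition upper_left :: "degree list \<Rightarrow> 'a mat \<Rightarrow> 'a mat" where
  "upper_left ds X = mat (length ds) (length ds) (\<lambda>(i, j). X $$ (i, j))"

definition lower_right :: "degree list \<Rightarrow> degree list \<Rightarrow> 'a mat \<Rightarrow> 'a mat" where
  "lower_right ds es X =
     mat (length es) (length es) (\<lambda>(i, j). X $$ (length ds + i, length ds + j))"

lemma corners_four_block:
  assumes "P \<in> carrier_mat (length ds) (length ds)" "S \<in> carrier_mat (length es) (length es)"
  shows "upper_left ds (four_block_mat P Q R S) = P" "lower_right ds es (four_block_mat P Q R S) = S"
  using assms by (auto simp: upper_left_def lower_right_def intro!: eq_matI)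

text \<open>
  The inverse of the Berezinian of \<open>X\<close>, where \<open>X'\<close> is the inverse of \<open>X\<close>. If \<open>X\<close> has blocks
  \<open>P\<close>, \<open>Q\<close>, \<open>R\<close>, \<open>S\<close>, then the upper left block of \<open>X'\<close> is the inverse of
  \<open>P - Q * S\<^sup>-\<^sup>1 * R\<close>, so that this is the classical formula with both factors inverted. Written with
  the inverse matrix it treats the two corners alike, which keeps the proof of multiplicativity short.
\<close>

definition inverse_ber :: "degree list \<Rightarrow> degree list \<Rightarrow> 'a mat \<Rightarrow> 'a mat \<Rightarrow> 'a" where
  "inverse_ber ds es X X' = gdet ds (upper_left ds X') * gdet es (lower_right ds es X)"

text \<open>
  With \<open>C = S\<^sup>-\<^sup>1 * R\<close> from \<open>X\<close> and \<open>B = L * N\<^sup>-\<^sup>1\<close> from \<open>Y\<close>, where \<open>S\<close> and \<open>N\<close> are the lower right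
  blocks, the lower right block of \<open>X * Y\<close> is \<open>S * (1 + C * B) * N\<close> and the upper left block of
  \<open>Y' * X'\<close> is \<open>K' * (1 + B * C) * P'\<close>. The two middle factors cancel by \<open>gdet_one_plus_odd\<close>.
\<close>

lemma inverse_ber_mult:
  assumes pds: "set ds \<subseteq> degrees_of_parity p" and pes: "set es \<subseteq> degrees_of_parity q"
    and pq: "p + q = 1"
    and X: "X \<in> gmats (ds @ es) (ds @ es)" and X': "X' \<in> gmats (ds @ es) (ds @ es)"
    and XX': "X * X' = 1\<^sub>m (length (ds @ es))"
    and Y: "Y \<in> gmats (ds @ es) (ds @ es)" and Y': "Y' \<in> gmats (ds @ es) (ds @ es)"
    and YY': "Y * Y' = 1\<^sub>m (length (ds @ es))" "Y' * Y = 1\<^sub>m (length (ds @ es))"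
  shows "inverse_ber ds es (X * Y) (Y' * X') = inverse_ber ds es X X' * inverse_ber ds es Y Y'"
proof -
  note dds = degrees_of_parity_subset[OF pds] and des = degrees_of_parity_subset[OF pes]
  obtain P Q R S where X_eq: "X = four_block_mat P Q R S"
    and Xb: "P \<in> gmats ds ds" "Q \<in> gmats ds es" "R \<in> gmats es ds" "S \<in> gmats es es"
    using gmats_blocks[OF X] .
  obtain P' Q' R' S' where X'_eq: "X' = four_block_mat P' Q' R' S'"
    and X'b: "P' \<in> gmats ds ds" "Q' \<in> gmats ds es" "R' \<in> gmats es ds" "S' \<in> gmats es es"
    using gmats_blocks[OF X'] .
  obtain K L M N where Y_eq: "Y = four_block_mat K L M N"
    and Yb: "K \<in> gmats ds ds" "L \<in> gmats ds es" "M \<in> gmats es ds" "N \<in> gmats es es"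
    using gmats_blocks[OF Y] .
  obtain K' L' M' N' where Y'_eq: "Y' = four_block_mat K' L' M' N'"
    and Y'b: "K' \<in> gmats ds ds" "L' \<in> gmats ds es" "M' \<in> gmats es ds" "N' \<in> gmats es es"
    using gmats_blocks[OF Y'] .
  note c = Xb[THEN gmatsD(1)] and c' = X'b[THEN gmatsD(1)]
    and k = Yb[THEN gmatsD(1)] and k' = Y'b[THEN gmatsD(1)]
  obtain V where V: "V \<in> gmats es es" "S * V = 1\<^sub>m (length es)" "V * S = 1\<^sub>m (length es)"
    using gdet_corner_units(2)[OF pds pes pq XX'[unfolded X_eq X'_eq] Xb X'b]
      inverse_of_unit_gdet[OF pes Xb(4)] by blast
  obtain W where W: "W \<in> gmats es es" "N * W = 1\<^sub>m (length es)" "W * N = 1\<^sub>m (length es)"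
    using gdet_corner_units(2)[OF pds pes pq YY'(1)[unfolded Y_eq Y'_eq] Yb Y'b]
      inverse_of_unit_gdet[OF pes Yb(4)] by blast
  note v = gmatsD(1)[OF V(1)] and w = gmatsD(1)[OF W(1)]
  define C where "C = V * R"
  define B where "B = L * W"
  have Cg: "C \<in> gmats es ds" and Bg: "B \<in> gmats ds es"
    unfolding C_def B_def by (rule gmats_mult[OF V(1) Xb(3) des des dds], rule gmats_mult[OF Yb(2) W(1) dds des des])
  note Cc = gmatsD(1)[OF Cg] and Bc = gmatsD(1)[OF Bg]
  let ?I = "1\<^sub>m (length ds) :: 'a mat" and ?J = "1\<^sub>m (length es) :: 'a mat"
  have one_BC: "?I + B * C \<in> gmats ds ds" and one_CB: "?J + C * B \<in> gmats es es"
    by (intro gmats_add gmats_one gmats_mult[OF Bg Cg] gmats_mult[OF Cg Bg] dds des)+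
  have SC: "S * C = R" and BN: "B * N = L"
    using assoc_mult_mat[OF c(4) v c(3)] V(2) one_mult_mat[OF c(3)]
      assoc_mult_mat[OF k(2) w k(4)] W(3) mult_one_mat[OF k(2)]
    by (simp_all add: C_def B_def)
  have neg_unique: "T = - U" if "U + T = 0\<^sub>m a b" "U \<in> carrier_mat a b" "T \<in> carrier_mat a b"
    for T U :: "'a mat" and a b
  proof (rule eq_matI)
    fix i j assume "i < dim_row (- U)" "j < dim_col (- U)"
    then have ij: "i < a" "j < b" using that by auto
    have "U $$ (i, j) + T $$ (i, j) = 0"
      using arg_cong[OF that(1), of "\<lambda>Z. Z $$ (i, j)"] that(2,3) ij by simp
    then show "T $$ (i, j) = (- U) $$ (i, j)"
      using that ij by (simp add: eq_neg_iff_add_eq_0 add.commute)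
  qed (use that in auto)
  \<comment> \<open>the off-diagonal blocks of \<open>X * X' = 1\<close> and \<open>Y' * Y = 1\<close>\<close>
  have R': "R' = - (C * P')"
  proof -
    have "S * R' = - (R * P')"
      using neg_unique[OF four_block_mult_eq_one(3)[OF XX'[unfolded X_eq X'_eq] Xb X'b]] c c' by auto
    then have "V * (S * R') = - (V * (R * P'))"
      using right_mult_uminus_mat[OF v mult_carrier_mat[OF c(3) c'(1)]] by simp
    then show ?thesis
      using assoc_mult_mat[OF v c(4) c'(3)] V(3) one_mult_mat[OF c'(3)] assoc_mult_mat[OF v c(3) c'(1)]
      by (simp add: C_def)
  qed
  have L': "L' = - (K' * B)"
  proof -
    have "L' * N = - (K' * L)"
      using neg_unique[OF four_block_mult_eq_one(2)[OF YY'(2)[unfolded Y_eq Y'_eq] Y'b Yb]] k k' by auto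
    then have "L' * N * W = - (K' * L * W)"
      using left_mult_uminus_mat[OF mult_carrier_mat[OF k'(1) k(2)] w] by simp
    then show ?thesis
      using assoc_mult_mat[OF k'(2) k(4) w] W(2) mult_one_mat[OF k'(2)] assoc_mult_mat[OF k'(1) k(2) w]
      by (simp add: B_def)
  qed
  have lr: "R * L + S * N = S * (?J + C * B) * N"
  proof -
    have "S * (?J + C * B) = S + R * B"
      using mult_add_distrib_mat[OF c(4) one_carrier_mat mult_carrier_mat[OF Cc Bc]]
        mult_one_mat[OF c(4)] assoc_mult_mat[OF c(4) Cc Bc] SC by simp
    then have "S * (?J + C * B) * N = S * N + R * L"
      using add_mult_distrib_mat[OF c(4) mult_carrier_mat[OF c(3) Bc] k(4)]
        assoc_mult_mat[OF c(3) Bc k(4)] BN by simp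
    then show ?thesis
      using comm_add_mat[OF mult_carrier_mat[OF c(3) k(2)] mult_carrier_mat[OF c(4) k(4)]] by simp
  qed
  have ul: "K' * P' + L' * R' = K' * (?I + B * C) * P'"
  proof -
    have "K' * (?I + B * C) = K' + K' * B * C"
      using mult_add_distrib_mat[OF k'(1) one_carrier_mat mult_carrier_mat[OF Bc Cc]]
        mult_one_mat[OF k'(1)] assoc_mult_mat[OF k'(1) Bc Cc] by simp
    then have 1: "K' * (?I + B * C) * P' = K' * P' + K' * B * (C * P')"
      using add_mult_distrib_mat[OF k'(1) mult_carrier_mat[OF mult_carrier_mat[OF k'(1) Bc] Cc] c'(1)]
        assoc_mult_mat[OF mult_carrier_mat[OF k'(1) Bc] Cc c'(1)] by simp
    have "L' * R' = K' * B * (C * P')"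
      unfolding L' R'
      using left_mult_uminus_mat[OF mult_carrier_mat[OF k'(1) Bc] uminus_carrier_mat[OF mult_carrier_mat[OF Cc c'(1)]]]
        right_mult_uminus_mat[OF mult_carrier_mat[OF k'(1) Bc] mult_carrier_mat[OF Cc c'(1)]]
      by simp
    then show ?thesis using 1 by simp
  qed
  have XY: "lower_right ds es (X * Y) = S * (?J + C * B) * N"
    unfolding X_eq Y_eq mult_four_block_mat[OF c k] lr[symmetric]
    using c k by (intro corners_four_block(2)) auto
  have Y'X': "upper_left ds (Y' * X') = K' * (?I + B * C) * P'"
    unfolding X'_eq Y'_eq mult_four_block_mat[OF k' c'] ul[symmetric]
    using c' k' by (intro corners_four_block(1)) auto
  have XX: "inverse_ber ds es X X' = gdet ds P' * gdet es S"
    and YY: "inverse_ber ds es Y Y' = gdet ds K' * gdet es N"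
    using c c' k k' by (simp_all add: inverse_ber_def X_eq X'_eq Y_eq Y'_eq corners_four_block)
  have A0: "gdet ds P' \<in> A \<zero>\<^sub>d" "gdet ds K' \<in> A \<zero>\<^sub>d"
    using gdet_deg_zero[OF pds X'b(1)] gdet_deg_zero[OF pds Y'b(1)] by auto
  have SA0: "gdet es S \<in> A \<zero>\<^sub>d"
    using gdet_deg_zero[OF pes Xb(4)] .
  have "inverse_ber ds es (X * Y) (Y' * X')
      = gdet ds K' * gdet ds (?I + B * C) * gdet ds P' * (gdet es S * gdet es (?J + C * B) * gdet es N)"
    unfolding inverse_ber_def XY Y'X'
      gdet_mult[OF pes gmats_mult[OF Xb(4) one_CB des des des] Yb(4)] gdet_mult[OF pes Xb(4) one_CB]
      gdet_mult[OF pds gmats_mult[OF Y'b(1) one_BC dds dds dds] X'b(1)] gdet_mult[OF pds Y'b(1) one_BC] ..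
  also have "\<dots> = gdet ds P' * (gdet es S * (gdet ds K' * (gdet ds (?I + B * C) * gdet es (?J + C * B)) * gdet es N))"
    using deg_zero_central[OF A0(1)] deg_zero_central[OF A0(2)] deg_zero_central[OF SA0]
    by (smt (verit) mult.assoc)
  also have "\<dots> = inverse_ber ds es X X' * inverse_ber ds es Y Y'"
    using gdet_one_plus_odd[OF pds pes pq Bg Cg] by (simp add: XX YY mult.assoc)
  finally show ?thesis .
qed

text \<open>
  Block elimination: \<open>S\<close> is invertible by \<open>gdet_corner_units\<close>, so \<open>Q\<close> can be cleared from the left and
  \<open>R\<close> from the right.
\<close>

lemma unitriangular_diagonalization:
  assumes pds: "set ds \<subseteq> degrees_of_parity p" and pes: "set es \<subseteq> degrees_of_parity q"
    and pq: "p + q = 1"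
    and X: "X \<in> gmats (ds @ es) (ds @ es)" and X': "X' \<in> gmats (ds @ es) (ds @ es)"
    and XX': "X * X' = 1\<^sub>m (length (ds @ es))"
  obtains B C K S where "B \<in> gmats ds es" "C \<in> gmats es ds" "K \<in> gmats ds ds" "S \<in> gmats es es"
    "four_block_mat (1\<^sub>m (length ds)) B (0\<^sub>m (length es) (length ds)) (1\<^sub>m (length es))
      * (X * four_block_mat (1\<^sub>m (length ds)) (0\<^sub>m (length ds) (length es)) C (1\<^sub>m (length es)))
     = four_block_mat K (0\<^sub>m (length ds) (length es)) (0\<^sub>m (length es) (length ds)) S"
proof -
  note dds = degrees_of_parity_subset[OF pds] and des = degrees_of_parity_subset[OF pes]
  obtain P Q R S where X_eq: "X = four_block_mat P Q R S"
    and Xb: "P \<in> gmats ds ds" "Q \<in> gmats ds es" "R \<in> gmats es ds" "S \<in> gmats es es"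
    using gmats_blocks[OF X] .
  obtain P' Q' R' S' where X'_eq: "X' = four_block_mat P' Q' R' S'"
    and X'b: "P' \<in> gmats ds ds" "Q' \<in> gmats ds es" "R' \<in> gmats es ds" "S' \<in> gmats es es"
    using gmats_blocks[OF X'] .
  note c = Xb[THEN gmatsD(1)]
  obtain V where V: "V \<in> gmats es es" "S * V = 1\<^sub>m (length es)" "V * S = 1\<^sub>m (length es)"
    using gdet_corner_units(2)[OF pds pes pq XX'[unfolded X_eq X'_eq] Xb X'b]
      inverse_of_unit_gdet[OF pes Xb(4)] by blast
  note v = gmatsD(1)[OF V(1)]
  define B where "B = - (Q * V)"
  define C where "C = - (V * R)"
  have B: "B \<in> gmats ds es" and C: "C \<in> gmats es ds"
    unfolding B_def C_def
    by (intro gmats_uminus gmats_mult[OF Xb(2) V(1)] gmats_mult[OF V(1) Xb(3)] dds des)+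
  note bc = gmatsD(1)[OF B] gmatsD(1)[OF C]
  have SC: "S * C = - R"
    unfolding C_def right_mult_uminus_mat[OF c(4) mult_carrier_mat[OF v c(3)]]
    using assoc_mult_mat[OF c(4) v c(3)] V(2) one_mult_mat[OF c(3)] by simp
  have BS: "B * S = - Q"
    unfolding B_def left_mult_uminus_mat[OF mult_carrier_mat[OF c(2) v] c(4)]
    using assoc_mult_mat[OF c(2) v c(4)] V(3) mult_one_mat[OF c(2)] by simp
  let ?L = "four_block_mat (1\<^sub>m (length ds)) (0\<^sub>m (length ds) (length es)) C (1\<^sub>m (length es))"
  let ?U = "four_block_mat (1\<^sub>m (length ds)) B (0\<^sub>m (length es) (length ds)) (1\<^sub>m (length es))"
  have "X * ?L = four_block_mat (P + Q * C) Q (R + S * C) S"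
    unfolding X_eq mult_four_block_mat[OF c one_carrier_mat zero_carrier_mat bc(2) one_carrier_mat]
    using c bc by (simp add: mult_one_mat)
  also have "R + S * C = 0\<^sub>m (length es) (length ds)"
    unfolding SC using c by (intro eq_matI) auto
  finally have XL: "X * ?L = four_block_mat (P + Q * C) Q (0\<^sub>m (length es) (length ds)) S" .
  have K: "P + Q * C \<in> gmats ds ds"
    by (intro gmats_add gmats_mult[OF Xb(2) C] Xb dds des)
  have "?U * (X * ?L) = four_block_mat (P + Q * C) (Q + B * S) (0\<^sub>m (length es) (length ds)) S"
    unfolding XL mult_four_block_mat[OF one_carrier_mat bc(1) zero_carrier_mat one_carrier_mat
        gmatsD(1)[OF K] c(2) zero_carrier_mat c(4)]
    using c bc gmatsD(1)[OF K] one_mult_mat[OF gmatsD(1)[OF K]] by (simp add: one_mult_mat)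
  also have "Q + B * S = 0\<^sub>m (length ds) (length es)"
    unfolding BS using c by (intro eq_matI) auto
  finally show thesis
    by (rule that[OF B C K Xb(4)])
qed

end


section \<open>The graded determinant as a polynomial in the entries\<close>

lemma index_degrees_Cons: "index_degrees (d # ds) (m # rs) = replicate m d @ index_degrees ds rs"
  by (simp add: index_degrees_def)

lemma length_index_degrees:
  "length ds = length rs \<Longrightarrow> length (index_degrees ds rs) = sum_list rs"
  by (induction ds rs rule: list_induct2) (simp_all add: index_degrees_Cons, simp add: index_degrees_def)

lemma set_index_degrees: "set (index_degrees ds rs) \<subseteq> set ds"
  by (auto simp: index_degrees_def dest: set_zip_leftD)

lemma index_degrees_append:
  "length ds = length rs \<Longrightarrow>
    index_degrees (ds @ es) (rs @ ss) = index_degrees ds rs @ index_degrees es ss"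
  by (simp add: index_degrees_def)

lemma index_degrees_drop:
  assumes "length ds = length rs"
  shows "index_degrees (drop k ds) (drop k rs) = drop (sum_list (take k rs)) (index_degrees ds rs)"
proof -
  have "index_degrees ds rs
      = index_degrees (take k ds) (take k rs) @ index_degrees (drop k ds) (drop k rs)"
    using index_degrees_append[of "take k ds" "take k rs" "drop k ds" "drop k rs"] assms by simp
  then show ?thesis
    using length_index_degrees[of "take k ds" "take k rs"] assms by simp
qed

definition tail_mat :: "nat \<Rightarrow> 'a mat \<Rightarrow> 'a mat" where
  "tail_mat m Z = mat (dim_row Z - m) (dim_col Z - m) (\<lambda>(i, j). Z $$ (i + m, j + m))"

lemma trailing_eq_tail_mat: "trailing rs k Z = tail_mat (sum_list (take k rs)) Z"
  by (simp add: trailing_def tail_mat_def Let_def)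

definition add_diagonal_entry :: "nat \<Rightarrow> 'a::plus \<Rightarrow> 'a mat \<Rightarrow> 'a mat" where
  "add_diagonal_entry m s W = mat (dim_row W) (dim_col W)
     (\<lambda>(i, j). if i = m \<and> j = m then W $$ (i, j) + s else W $$ (i, j))"

lemma tail_mat_add_diagonal_entry: "m < k \<Longrightarrow> tail_mat k (add_diagonal_entry m s W) = tail_mat k W"
  by (rule eq_matI) (auto simp: tail_mat_def add_diagonal_entry_def)

context graded_commutative_algebra
begin

lemma graded_mats_eq_gmats:
  assumes "length ds = length rs"
  shows "graded_mats A ds rs = gmats (index_degrees ds rs) (index_degrees ds rs)"
  using assms by (simp add: graded_mats_def gmats_def length_index_degrees)

lemma monoid_graded_mats:
  assumes len: "length ds = length rs" and ds: "set ds \<subseteq> degrees n"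
  shows "Group.monoid (graded_mat_monoid A ds rs)"
proof -
  have d: "set (index_degrees ds rs) \<subseteq> degrees n"
    using set_index_degrees ds by blast
  note simps = graded_mat_monoid_def graded_mats_eq_gmats[OF len]
  note carrier = gmatsD(1)[of _ "index_degrees ds rs" "index_degrees ds rs",
      unfolded length_index_degrees[OF len]]
  show ?thesis
  proof (rule monoidI)
    show "\<one>\<^bsub>graded_mat_monoid A ds rs\<^esub> \<in> carrier (graded_mat_monoid A ds rs)"
      using gmats_one[OF d] by (simp add: simps length_index_degrees[OF len])
  next
    fix X Y assume "X \<in> carrier (graded_mat_monoid A ds rs)" "Y \<in> carrier (graded_mat_monoid A ds rs)"
    then show "X \<otimes>\<^bsub>graded_mat_monoid A ds rs\<^esub> Y \<in> carrier (graded_mat_monoid A ds rs)"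
      using gmats_mult[OF _ _ d d d] by (simp add: simps)
  next
    fix X Y Z
    assume "X \<in> carrier (graded_mat_monoid A ds rs)" "Y \<in> carrier (graded_mat_monoid A ds rs)"
      "Z \<in> carrier (graded_mat_monoid A ds rs)"
    then show "X \<otimes>\<^bsub>graded_mat_monoid A ds rs\<^esub> Y \<otimes>\<^bsub>graded_mat_monoid A ds rs\<^esub> Z
        = X \<otimes>\<^bsub>graded_mat_monoid A ds rs\<^esub> (Y \<otimes>\<^bsub>graded_mat_monoid A ds rs\<^esub> Z)"
      using assoc_mult_mat[OF carrier carrier carrier] by (simp add: simps)
  next
    fix X assume "X \<in> carrier (graded_mat_monoid A ds rs)"
    then have X: "X \<in> carrier_mat (sum_list rs) (sum_list rs)"
      by (intro carrier) (simp add: simps)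
    then show "\<one>\<^bsub>graded_mat_monoid A ds rs\<^esub> \<otimes>\<^bsub>graded_mat_monoid A ds rs\<^esub> X = X"
      "X \<otimes>\<^bsub>graded_mat_monoid A ds rs\<^esub> \<one>\<^bsub>graded_mat_monoid A ds rs\<^esub> = X"
      by (simp_all add: simps one_mult_mat mult_one_mat)
  qed
qed

lemma gmats_tail_mat:
  assumes W: "W \<in> gmats ds ds"
  shows "tail_mat m W \<in> gmats (drop m ds) (drop m ds)"
  using gmatsD[OF W] by (intro gmatsI) (auto simp: tail_mat_def add.commute)

lemma gdet_empty:
  assumes "X \<in> carrier_mat 0 0"
  shows "gdet [] X = 1"
proof -
  have "X = 1\<^sub>m 0"
    using assms by (intro eq_matI) auto
  then show ?thesis
    using gdet_one[of "[]" 0] by simp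
qed

text \<open>
  Multiplication by a lower unitriangular matrix of determinant one clears the lower left block.
\<close>

lemma gdet_schur:
  assumes par: "set ds \<subseteq> degrees_of_parity p" "set es \<subseteq> degrees_of_parity p"
    and P: "P \<in> gmats ds ds" and Q: "Q \<in> gmats ds es" and R: "R \<in> gmats es ds" and S: "S \<in> gmats es es"
    and V: "V \<in> gmats es es" and SV: "S * V = 1\<^sub>m (length es)"
  shows "gdet (ds @ es) (four_block_mat P Q R S) = gdet ds (P - Q * V * R) * gdet es S"
    and "P - Q * V * R \<in> gmats ds ds"
proof -
  note d = par[THEN degrees_of_parity_subset]
  have pde: "set (ds @ es) \<subseteq> degrees_of_parity p"
    using par by simp
  define C where "C = - (V * R)"
  have C: "C \<in> gmats es ds"
    unfolding C_def by (intro gmats_uminus gmats_mult[OF V R] d)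
  note c = P[THEN gmatsD(1)] Q[THEN gmatsD(1)] R[THEN gmatsD(1)] S[THEN gmatsD(1)]
    V[THEN gmatsD(1)] C[THEN gmatsD(1)]
  have SC: "S * C = - R"
    unfolding C_def right_mult_uminus_mat[OF c(4) mult_carrier_mat[OF c(5,3)]]
    using assoc_mult_mat[OF c(4,5,3)] SV one_mult_mat[OF c(3)] by simp
  have QC: "P + Q * C = P - Q * V * R"
    unfolding C_def right_mult_uminus_mat[OF c(2) mult_carrier_mat[OF c(5,3)]]
      assoc_mult_mat[OF c(2,5,3)]
    by (rule minus_add_uminus_mat[symmetric, OF c(1)]) (use c in auto)
  have K: "P + Q * C \<in> gmats ds ds"
    by (intro gmats_add gmats_mult[OF Q C] P d)
  then show K': "P - Q * V * R \<in> gmats ds ds"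
    unfolding QC .
  let ?L = "four_block_mat (1\<^sub>m (length ds)) (0\<^sub>m (length ds) (length es)) C (1\<^sub>m (length es))"
  have L: "?L \<in> gmats (ds @ es) (ds @ es)"
    by (intro gmats_four_block gmats_one gmats_zero C d)
  have X: "four_block_mat P Q R S \<in> gmats (ds @ es) (ds @ es)"
    by (intro gmats_four_block P Q R S)
  have "four_block_mat P Q R S * ?L = four_block_mat (P + Q * C) Q (R + S * C) S"
    unfolding mult_four_block_mat[OF c(1-4) one_carrier_mat zero_carrier_mat c(6) one_carrier_mat]
    using c by (simp add: mult_one_mat)
  also have "R + S * C = 0\<^sub>m (length es) (length ds)"
    unfolding SC using c by (intro eq_matI) auto
  finally have "gdet (ds @ es) (four_block_mat P Q R S) * gdet (ds @ es) ?L
      = gdet ds (P + Q * C) * gdet es S"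
    using gdet_mult[OF pde X L] gdet_block_upper[OF par K c(2) S] by simp
  moreover have "gdet (ds @ es) ?L = 1"
    using gdet_block_lower[OF par gmats_one[OF d(1)] c(6) gmats_one[OF d(2)]]
      gdet_one[OF par(1)] gdet_one[OF par(2)] by simp
  ultimately show "gdet (ds @ es) (four_block_mat P Q R S) = gdet ds (P - Q * V * R) * gdet es S"
    by (simp add: QC)
qed

lemma split_tail_mat:
  assumes W: "W \<in> carrier_mat N N" and m: "m + k \<le> N"
    and s: "split_block (tail_mat m W) k k = (P, Q, R, S)"
  shows "tail_mat m W = four_block_mat P Q R S" "S = tail_mat (m + k) W"
    and "P \<in> carrier_mat k k" "Q \<in> carrier_mat k (N - (m + k))"
    "R \<in> carrier_mat (N - (m + k)) k" "S \<in> carrier_mat (N - (m + k)) (N - (m + k))"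
proof -
  have "dim_row (tail_mat m W) = k + (N - (m + k))" "dim_col (tail_mat m W) = k + (N - (m + k))"
    using W m by (auto simp: tail_mat_def)
  note sb = split_block[OF s this]
  show "tail_mat m W = four_block_mat P Q R S" "P \<in> carrier_mat k k"
    "Q \<in> carrier_mat k (N - (m + k))" "R \<in> carrier_mat (N - (m + k)) k"
    "S \<in> carrier_mat (N - (m + k)) (N - (m + k))"
    by (fact sb)+
  show "S = tail_mat (m + k) W"
    using s W m by (auto simp: split_block_def Let_def tail_mat_def intro!: eq_matI simp: ac_simps)
qed

text \<open>
  Iteration of the Schur complement formula, from the last block to the first. Each quasideterminant
  belongs to a diagonal block of constant degree, where \<open>gdet\<close> is the Leibniz determinant.
\<close>

lemma gdet_eq_prod_quasidets:
  assumes len: "length ds = length rs" and par: "set ds \<subseteq> degrees_of_parity p"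
    and W: "W \<in> graded_mats A ds rs" and ex: "quasidets_exist A ds rs W"
  shows "gdet (index_degrees ds rs) W
    = prod_list (map (\<lambda>k. leibniz_det (quasidet A ds rs k W)) [0..<length rs])"
proof -
  let ?I = "index_degrees ds rs"
  let ?m = "\<lambda>k. sum_list (take k rs)"
  have pI: "set ?I \<subseteq> degrees_of_parity p"
    using set_index_degrees par by blast
  have WI: "W \<in> gmats ?I ?I"
    using W by (simp add: graded_mats_eq_gmats[OF len])
  have lI: "length ?I = sum_list rs"
    by (rule length_index_degrees[OF len])
  have Wc: "W \<in> carrier_mat (sum_list rs) (sum_list rs)"
    using gmatsD(1)[OF WI] by (simp add: lI)
  have "gdet (drop (?m k) ?I) (trailing rs k W)
      = prod_list (map (\<lambda>k. leibniz_det (quasidet A ds rs k W)) [k..<length rs])"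
    if "k \<le> length rs" for k
    using that
  proof (induction k rule: inc_induct)
    case base
    have "tail_mat (sum_list rs) W \<in> carrier_mat 0 0"
      using Wc by (simp add: tail_mat_def)
    then show ?case
      by (simp add: trailing_eq_tail_mat lI gdet_empty)
  next
    case (step k)
    have mk: "?m (Suc k) = ?m k + rs ! k"
      using step.hyps by (simp add: take_Suc_conv_app_nth)
    have le: "?m k + rs ! k \<le> sum_list rs"
      using sum_list_append[of "take (Suc k) rs" "drop (Suc k) rs"] by (simp flip: mk)
    obtain P Q R S where s: "split_block (trailing rs k W) (rs ! k) (rs ! k) = (P, Q, R, S)"
      by (metis prod_cases4)
    note b = split_tail_mat[OF Wc le s[unfolded trailing_eq_tail_mat]]
    let ?es = "drop (?m (Suc k)) ?I" and ?ds = "replicate (rs ! k) (ds ! k)"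
    let ?G = "graded_mat_monoid A (drop (Suc k) ds) (drop (Suc k) rs)"
    have split: "drop (?m k) ?I = ?ds @ ?es"
    proof -
      have "drop k ds = ds ! k # drop (Suc k) ds" "drop k rs = rs ! k # drop (Suc k) rs"
        using step.hyps len by (simp_all add: Cons_nth_drop_Suc)
      then show ?thesis
        using index_degrees_drop[OF len, of k] index_degrees_drop[OF len, of "Suc k"]
        by (simp add: index_degrees_Cons)
    qed
    have les: "length ?es = sum_list rs - (?m k + rs ! k)"
      by (simp add: lI mk)
    have pds: "set ?ds \<subseteq> degrees_of_parity p" and pes: "set ?es \<subseteq> degrees_of_parity p"
      using par pI step.hyps len set_drop_subset[of "?m (Suc k)" ?I] by auto
    have dk: "ds ! k \<in> degrees_of_parity p"
      using par step.hyps len by auto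
    have t: "trailing rs k W = four_block_mat P Q R S" and S: "S = trailing rs (Suc k) W"
      using b(1,2) by (simp_all add: trailing_eq_tail_mat mk)
    have "four_block_mat P Q R S \<in> gmats (?ds @ ?es) (?ds @ ?es)"
      using gmats_tail_mat[OF WI, of "?m k"] by (simp add: split flip: t trailing_eq_tail_mat)
    note g = gmats_four_blockD[OF this, unfolded length_replicate les, OF b(3-6)]
    have len': "length (drop (Suc k) ds) = length (drop (Suc k) rs)"
      using len by simp
    have "set (drop (Suc k) ds) \<subseteq> degrees n"
      using degrees_of_parity_subset[OF par] set_drop_subset[of "Suc k" ds] by blast
    then interpret G: Group.monoid ?G
      by (rule monoid_graded_mats[OF len'])
    have SU: "S \<in> Units ?G"
      using ex step.hyps by (simp add: quasidets_exist_def S)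
    let ?V = "inv\<^bsub>?G\<^esub> S"
    have V: "?V \<in> gmats ?es ?es"
      using G.Units_inv_closed[OF SU]
      by (simp add: graded_mat_monoid_def graded_mats_eq_gmats[OF len'] index_degrees_drop[OF len])
    have "sum_list (drop (Suc k) rs) = length ?es"
      using length_index_degrees[OF len'] by (simp add: index_degrees_drop[OF len])
    then have SV: "S * ?V = 1\<^sub>m (length ?es)"
      using G.Units_r_inv[OF SU] by (simp add: graded_mat_monoid_def)
    note schur = gdet_schur[OF pds pes g V SV]
    have "quasidet A ds rs k W = P - Q * ?V * R"
      by (simp add: quasidet_def s)
    then have "gdet (drop (?m k) ?I) (trailing rs k W)
        = leibniz_det (quasidet A ds rs k W) * gdet ?es S"
      using schur gdet_constant_degree[OF dk] by (simp add: split t)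
    then show ?case
      using step.IH step.hyps by (simp add: S upt_conv_Cons)
  qed
  moreover have "trailing rs 0 W = W"
    using Wc by (intro eq_matI) (auto simp: trailing_eq_tail_mat tail_mat_def)
  ultimately show ?thesis
    using le0 by (metis drop0 sum_list.Nil take0)
qed

lemma entry_polynomials_uminus:
  assumes "P \<in> entry_polynomials scale N"
  shows "(\<lambda>Z. - P Z) \<in> entry_polynomials scale N"
  using entry_polynomials.mult[OF entry_polynomials.const[of scale "-1" N] assms]
  by (simp flip: scale_mult_left)

lemma entry_polynomials_zero: "(\<lambda>Z. 0) \<in> entry_polynomials scale N"
  using entry_polynomials.const[of scale 0 N] by simp

lemma entry_polynomials_one: "(\<lambda>Z. 1) \<in> entry_polynomials scale N"
  using entry_polynomials.const[of scale 1 N] by simp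

lemma entry_polynomials_sum:
  "(\<And>i. i \<in> I \<Longrightarrow> F i \<in> entry_polynomials scale N) \<Longrightarrow>
    (\<lambda>Z. \<Sum>i\<in>I. F i Z) \<in> entry_polynomials scale N"
  by (induction I rule: infinite_finite_induct)
    (auto intro: entry_polynomials.add entry_polynomials_zero)

lemma entry_polynomials_prod_list:
  "(\<And>i. i \<in> set xs \<Longrightarrow> F i \<in> entry_polynomials scale N) \<Longrightarrow>
    (\<lambda>Z. prod_list (map (\<lambda>i. F i Z) xs)) \<in> entry_polynomials scale N"
  by (induction xs) (auto intro: entry_polynomials.mult entry_polynomials_one)

lemma gdet_entry_polynomial:
  assumes par: "set ds \<subseteq> degrees_of_parity p"
  obtains P where "P \<in> entry_polynomials scale (length ds)" "\<And>X. X \<in> gmats ds ds \<Longrightarrow> P X = gdet ds X"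
proof -
  obtain s where s: "\<And>X. X \<in> gmats ds ds \<Longrightarrow> gdet ds X
      = (\<Sum>\<pi> | \<pi> permutes {0..<length ds}.
          signed (s \<pi>) (prod_list (map (\<lambda>i. X $$ (i, \<pi> i)) [0..<length ds])))"
    by (rule gdet_leibniz[OF par], rule that, assumption)
  have "(\<lambda>X. signed (s \<pi>) (prod_list (map (\<lambda>i. X $$ (i, \<pi> i)) [0..<length ds])))
      \<in> entry_polynomials scale (length ds)" if \<pi>: "\<pi> permutes {0..<length ds}" for \<pi>
  proof -
    have "(\<lambda>X. prod_list (map (\<lambda>i. X $$ (i, \<pi> i)) [0..<length ds])) \<in> entry_polynomials scale (length ds)"
      using permutes_in_image[OF \<pi>]
      by (intro entry_polynomials_prod_list entry_polynomials.entry) auto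
    then show ?thesis
      using entry_polynomials_uminus by (cases "s \<pi>") (auto simp: signed_def)
  qed
  then have "(\<lambda>X. \<Sum>\<pi> | \<pi> permutes {0..<length ds}.
      signed (s \<pi>) (prod_list (map (\<lambda>i. X $$ (i, \<pi> i)) [0..<length ds])))
      \<in> entry_polynomials scale (length ds)"
    by (intro entry_polynomials_sum) auto
  then show thesis
    by (rule that) (rule s[symmetric])
qed

text \<open>
  Functions on \<open>A\<close> in degree zero that are given by a polynomial with arbitrary coefficients in the
  algebra. As the argument is central, it can be collected to the right of the coefficients.
\<close>

definition central_polynomial :: "('a \<Rightarrow> 'a) \<Rightarrow> bool" where
  "central_polynomial f \<longleftrightarrow> (\<exists>K a. \<forall>s\<in>A \<zero>\<^sub>d. f s = (\<Sum>i<K. a i * s ^ i))"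

lemma central_polynomial_monomial: "central_polynomial (\<lambda>s. c * s ^ k)"
  unfolding central_polynomial_def
  by (intro exI[of _ "Suc k"] exI[of _ "\<lambda>i. if i = k then c else 0"]) (auto intro!: sum.neutral[symmetric])

lemma central_polynomial_add:
  assumes "central_polynomial f" "central_polynomial g"
  shows "central_polynomial (\<lambda>s. f s + g s)"
proof -
  obtain K a where f: "\<And>s. s \<in> A \<zero>\<^sub>d \<Longrightarrow> f s = (\<Sum>i<K. a i * s ^ i)"
    using assms(1) by (auto simp: central_polynomial_def)
  obtain L b where g: "\<And>s. s \<in> A \<zero>\<^sub>d \<Longrightarrow> g s = (\<Sum>i<L. b i * s ^ i)"
    using assms(2) by (auto simp: central_polynomial_def)
  have extend: "(\<Sum>i<M. c i * s ^ i) = (\<Sum>i<K + L. (if i < M then c i else 0) * s ^ i)"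
    if "M \<le> K + L" for M c and s :: 'a
    using that by (intro sum.mono_neutral_cong_left) auto
  show ?thesis
    unfolding central_polynomial_def
    by (intro exI[of _ "K + L"] exI[of _ "\<lambda>i. (if i < K then a i else 0) + (if i < L then b i else 0)"])
      (simp add: f g extend[of K] extend[of L] distrib_right sum.distrib)
qed

lemma central_polynomial_sum:
  "finite I \<Longrightarrow> (\<And>i. i \<in> I \<Longrightarrow> central_polynomial (f i)) \<Longrightarrow> central_polynomial (\<lambda>s. \<Sum>i\<in>I. f i s)"
proof (induction I rule: finite_induct)
  case empty
  then show ?case using central_polynomial_monomial[of 0] by simp
qed (simp add: central_polynomial_add)

lemma deg_zero_power: "s \<in> A \<zero>\<^sub>d \<Longrightarrow> s ^ k \<in> A \<zero>\<^sub>d"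
  by (induction k) (simp_all add: one_homogeneous deg_zero_mult)

lemma central_polynomial_mult:
  assumes "central_polynomial f" "central_polynomial g"
  shows "central_polynomial (\<lambda>s. f s * g s)"
proof -
  obtain K a where f: "\<And>s. s \<in> A \<zero>\<^sub>d \<Longrightarrow> f s = (\<Sum>i<K. a i * s ^ i)"
    using assms(1) by (auto simp: central_polynomial_def)
  obtain L b where g: "\<And>s. s \<in> A \<zero>\<^sub>d \<Longrightarrow> g s = (\<Sum>i<L. b i * s ^ i)"
    using assms(2) by (auto simp: central_polynomial_def)
  have "f s * g s = (\<Sum>i<K. \<Sum>j<L. (a i * b j) * s ^ (i + j))" if s: "s \<in> A \<zero>\<^sub>d" for s
  proof -
    have "a i * s ^ i * (b j * s ^ j) = (a i * b j) * s ^ (i + j)" for i j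
      using deg_zero_central[OF deg_zero_power[OF s], of "b j" i]
      by (metis mult.assoc power_add)
    then show ?thesis
      by (simp add: f[OF s] g[OF s] sum_product)
  qed
  moreover have "central_polynomial (\<lambda>s. \<Sum>i<K. \<Sum>j<L. (a i * b j) * s ^ (i + j))"
    by (intro central_polynomial_sum central_polynomial_monomial) auto
  ultimately show ?thesis
    unfolding central_polynomial_def by simp
qed

lemma entry_polynomial_central:
  assumes "P \<in> entry_polynomials scale N" and W: "W \<in> carrier_mat N N"
  shows "central_polynomial (\<lambda>s. P (add_diagonal_entry m s W))"
  using assms(1)
proof induction
  case (const c)
  then show ?case using central_polynomial_monomial[of "scale c 1" 0] by simp
next
  case (entry i j)
  have "central_polynomial (\<lambda>s. W $$ (i, j) * s ^ 0)" "central_polynomial (\<lambda>s. W $$ (i, j) * s ^ 0 + 1 * s ^ 1)"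
    by (intro central_polynomial_add central_polynomial_monomial)+
  then show ?case
    using entry W by (cases "i = m \<and> j = m") (simp_all add: add_diagonal_entry_def, auto)
qed (auto intro: central_polynomial_add central_polynomial_mult)

text \<open>
  Polynomials over a field of characteristic zero with coefficients in a vector space: the combination
  \<open>f (2 * c) - 2 ^ K * f c\<close> eliminates the leading coefficient and multiplies the others by nonzero
  scalars.
\<close>

lemma vanishing_polynomial_coefficients:
  assumes "\<And>c. c \<noteq> 0 \<Longrightarrow> (\<Sum>i<K. scale (c ^ i) (a i)) = 0" and "i < K"
  shows "a i = 0"
  using assms
proof (induction K arbitrary: a i)
  case (Suc K)
  have low: "a j = 0" if j: "j < K" for j
  proof -
    have "(\<Sum>i<K. scale (c ^ i) (scale (2 ^ i - 2 ^ K) (a i))) = 0" if c: "c \<noteq> 0" for c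
    proof -
      have "(\<Sum>i<K. scale (c ^ i) (scale (2 ^ i - 2 ^ K) (a i)))
          = (\<Sum>i<Suc K. scale ((2 * c) ^ i) (a i)) - scale (2 ^ K) (\<Sum>i<Suc K. scale (c ^ i) (a i))"
        by (simp add: scale_sum_right scale_right_distrib scale_left_diff_distrib scale_right_diff_distrib
            sum_subtractf power_mult_distrib mult.commute)
      then show ?thesis
        using Suc.prems(1)[of c] Suc.prems(1)[of "2 * c"] c by simp
    qed
    from Suc.IH[of "\<lambda>i. scale (2 ^ i - 2 ^ K) (a i)", OF this j]
    have "(2 :: 'k) ^ j = 2 ^ K \<or> a j = 0"
      by simp
    moreover have "(2 :: 'k) ^ j \<noteq> 2 ^ K"
    proof -
      have "of_nat (2 ^ j) \<noteq> (of_nat (2 ^ K) :: 'k)"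
        using j by (simp only: of_nat_eq_iff) simp
      then show ?thesis by simp
    qed
    ultimately show ?thesis by blast
  qed
  show ?case
  proof (cases "i = K")
    case True
    then show ?thesis
      using Suc.prems(1)[of 1] low by simp
  next
    case False
    then show ?thesis
      using low Suc.prems(2) by simp
  qed
qed simp

lemma central_polynomial_vanishing:
  assumes "central_polynomial f" and zero: "\<And>c. c \<noteq> 0 \<Longrightarrow> f (scale c 1) = 0" and q: "q \<in> A \<zero>\<^sub>d"
  shows "f q = 0"
proof -
  obtain K a where f: "\<And>s. s \<in> A \<zero>\<^sub>d \<Longrightarrow> f s = (\<Sum>i<K. a i * s ^ i)"
    using assms(1) by (auto simp: central_polynomial_def)
  have pow: "a * scale c 1 ^ i = scale (c ^ i) a" for a c i
  proof (induction i arbitrary: a)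
    case (Suc i)
    have "a * scale c 1 ^ Suc i = scale c a * scale c 1 ^ i"
      by (simp flip: mult.assoc scale_mult_right)
    then show ?case
      by (simp add: Suc mult.commute)
  qed simp
  have "(\<Sum>i<K. scale (c ^ i) (a i)) = 0" if "c \<noteq> 0" for c
    using zero[OF that] f[OF homogeneous_scale[OF deg_zero_closed one_homogeneous], of c] by (simp add: pow)
  then have "a i = 0" if "i < K" for i
    using vanishing_polynomial_coefficients that by blast
  then show ?thesis
    using f[OF q] by simp
qed

text \<open>
  The trailing minor starting at \<open>m\<close> is affine in the \<open>m\<close>-th diagonal entry, with the next trailing
  minor as its slope. If the latter is invertible, it can be factored out: \<open>q\<close> is the
  quasideterminant of size one.
\<close>

lemma gdet_tail_add_diagonal_entry:
  assumes par: "set ds \<subseteq> degrees_of_parity p" and W: "W \<in> gmats ds ds" and m: "m < length ds"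
    and u: "u \<in> A \<zero>\<^sub>d" "u * gdet (drop (Suc m) ds) (tail_mat (Suc m) W) = 1"
  shows "\<exists>q\<in>A \<zero>\<^sub>d. \<forall>s\<in>A \<zero>\<^sub>d. gdet (drop m ds) (tail_mat m (add_diagonal_entry m s W))
    = (q + s) * gdet (drop (Suc m) ds) (tail_mat (Suc m) W)"
proof -
  let ?es = "drop (Suc m) ds" and ?N = "length ds"
  have dm: "ds ! m \<in> degrees_of_parity p" "ds ! m \<in> degrees n"
    using par degrees_of_parity_subset[OF par] m by auto
  have pes: "set ?es \<subseteq> degrees_of_parity p" and pd: "set [ds ! m] \<subseteq> degrees_of_parity p"
    using par dm(1) set_drop_subset[of "Suc m" ds] by auto
  have split: "drop m ds = [ds ! m] @ ?es"
    using m by (simp add: Cons_nth_drop_Suc)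
  obtain P Q R S where s: "split_block (tail_mat m W) 1 1 = (P, Q, R, S)"
    by (metis prod_cases4)
  have m1: "m + 1 \<le> ?N" using m by simp
  note b = split_tail_mat[OF gmatsD(1)[OF W] m1 s]
  have S: "S = tail_mat (Suc m) W" using b(2) by simp
  have "four_block_mat P Q R S \<in> gmats ([ds ! m] @ ?es) ([ds ! m] @ ?es)"
    using gmats_tail_mat[OF W, of m] by (simp only: split b(1))
  note g = gmats_four_blockD[OF this, unfolded length_drop length_Cons list.size, simplified, OF b(3-6)[simplified]]
  obtain V where V: "V \<in> gmats ?es ?es" "S * V = 1\<^sub>m (length ?es)"
    using inverse_of_unit_gdet[OF pes g(4) u(1)] u(2) S by metis
  note c = b(3-6) gmatsD(1)[OF V(1)]
  define q where "q = (P - Q * V * R) $$ (0, 0)"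
  have one_dim: "gdet [ds ! m] M = M $$ (0, 0)" if "M \<in> gmats [ds ! m] [ds ! m]" for M
    using gdet_identity_off_row[OF pd that, of 0] by simp
  show ?thesis
  proof (intro bexI[of _ q] ballI)
    show "q \<in> A \<zero>\<^sub>d"
      using gmatsD(2)[OF gdet_schur(2)[OF pd pes g V], of 0 0] by (simp add: q_def deg_add_self[OF dm(2)])
    fix s assume s: "s \<in> A \<zero>\<^sub>d"
    define P' where "P' = mat 1 1 (\<lambda>_. P $$ (0, 0) + s)"
    have P': "P' \<in> gmats [ds ! m] [ds ! m]"
      using gmatsD(2)[OF g(1), of 0 0] s
      by (intro gmatsI) (auto simp: P'_def deg_add_self[OF dm(2)] intro!: homogeneous_add[OF deg_zero_closed])
    have t: "tail_mat m (add_diagonal_entry m s W) = four_block_mat P' Q R S"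
    proof (rule eq_matI)
      fix i j assume ij: "i < dim_row (four_block_mat P' Q R S)" "j < dim_col (four_block_mat P' Q R S)"
      then have ij': "i < ?N - m" "j < ?N - m"
        using c m by (auto simp: P'_def)
      have "tail_mat m (add_diagonal_entry m s W) $$ (i, j)
          = (if i = 0 \<and> j = 0 then tail_mat m W $$ (i, j) + s else tail_mat m W $$ (i, j))"
        using ij' gmatsD(1)[OF W] by (auto simp: tail_mat_def add_diagonal_entry_def)
      then show "tail_mat m (add_diagonal_entry m s W) $$ (i, j) = four_block_mat P' Q R S $$ (i, j)"
        unfolding b(1) using ij ij' c m by (auto simp: P'_def)
    qed (use c m gmatsD(1)[OF W] in \<open>auto simp: P'_def tail_mat_def add_diagonal_entry_def\<close>)
    have "gdet (drop m ds) (tail_mat m (add_diagonal_entry m s W))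
        = (P' - Q * V * R) $$ (0, 0) * gdet ?es S"
      using gdet_schur[OF pd pes P' g(2-4) V] one_dim by (simp only: split t)
    also have "(P' - Q * V * R) $$ (0, 0) = q + s"
      using c by (simp add: q_def P'_def)
    finally show "gdet (drop m ds) (tail_mat m (add_diagonal_entry m s W))
        = (q + s) * gdet ?es (tail_mat (Suc m) W)"
      by (simp add: S)
  qed
qed

lemma gmats_add_diagonal_entry:
  assumes W: "W \<in> gmats ds ds" and ds: "set ds \<subseteq> degrees n" and s: "s \<in> A \<zero>\<^sub>d"
  shows "add_diagonal_entry m s W \<in> gmats ds ds"
proof (rule gmatsI)
  show "add_diagonal_entry m s W \<in> carrier_mat (length ds) (length ds)"
    using gmatsD(1)[OF W] by (auto simp: add_diagonal_entry_def)
  fix i j assume ij: "i < length ds" "j < length ds"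
  then show "add_diagonal_entry m s W $$ (i, j) \<in> A (deg_add (ds ! i) (ds ! j))"
    using gmatsD[OF W] nth_degrees[OF ds] s
    by (auto simp: add_diagonal_entry_def deg_add_self[of _ n] intro!: homogeneous_add[OF deg_zero_closed])
      (metis deg_add_self)
qed

text \<open>
  The invertibility of the trailing minors is removed from the first one on. Suppose that \<open>R\<close> vanishes
  on all matrices whose trailing minors from the index \<open>m\<close> on are invertible, and that \<open>W\<close> satisfies
  this only from \<open>Suc m\<close> on. Shifting the \<open>m\<close>-th diagonal entry of \<open>W\<close> by \<open>c - q\<close> with a scalar
  \<open>c \<noteq> 0\<close> makes the \<open>m\<close>-th minor invertible, by \<open>gdet_tail_add_diagonal_entry\<close>, and leaves the
  later ones unchanged. So the polynomial
  \<open>s \<mapsto> R (W shifted by s - q)\<close> vanishes at all nonzero scalars; hence it is zero, also at \<open>s = q\<close>.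
\<close>

lemma entry_polynomial_vanishing:
  assumes par: "set ds \<subseteq> degrees_of_parity p" and R: "R \<in> entry_polynomials scale (length ds)"
    and zero: "\<And>W. W \<in> gmats ds ds \<Longrightarrow>
      (\<forall>j\<le>length ds. \<exists>u\<in>A \<zero>\<^sub>d. u * gdet (drop j ds) (tail_mat j W) = 1) \<Longrightarrow> R W = 0"
    and W: "W \<in> gmats ds ds"
  shows "R W = 0"
proof -
  note ds = degrees_of_parity_subset[OF par]
  let ?N = "length ds"
  let ?unit = "\<lambda>j W. \<exists>u\<in>A \<zero>\<^sub>d. u * gdet (drop j ds) (tail_mat j W) = 1"
  have "\<forall>W\<in>gmats ds ds. (\<forall>j. m \<le> j \<and> j \<le> ?N \<longrightarrow> ?unit j W) \<longrightarrow> R W = 0" if "m \<le> ?N" for m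
    using that
  proof (induction m)
    case 0
    then show ?case using zero by simp
  next
    case (Suc m)
    show ?case
    proof (intro ballI impI)
      fix W assume W: "W \<in> gmats ds ds" and unit: "\<forall>j. Suc m \<le> j \<and> j \<le> ?N \<longrightarrow> ?unit j W"
      have m: "m < ?N" using Suc.prems by simp
      let ?d = "gdet (drop (Suc m) ds) (tail_mat (Suc m) W)"
      obtain u where u: "u \<in> A \<zero>\<^sub>d" "u * ?d = 1"
        using unit Suc.prems by blast
      obtain q where q: "q \<in> A \<zero>\<^sub>d" and det: "\<And>s. s \<in> A \<zero>\<^sub>d \<Longrightarrow>
          gdet (drop m ds) (tail_mat m (add_diagonal_entry m s W)) = (q + s) * ?d"
        using gdet_tail_add_diagonal_entry[OF par W m u] by blast
      let ?W = "add_diagonal_entry m (- q) W"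
      have W': "?W \<in> carrier_mat ?N ?N"
        using gmatsD(1)[OF gmats_add_diagonal_entry[OF W ds homogeneous_uminus[OF deg_zero_closed q]]] .
      have shift: "add_diagonal_entry m s ?W = add_diagonal_entry m (s - q) W" for s
        by (rule eq_matI) (auto simp: add_diagonal_entry_def)
      have "R (add_diagonal_entry m (scale c 1) ?W) = 0" if c: "c \<noteq> 0" for c
      proof -
        have s: "scale c 1 - q \<in> A \<zero>\<^sub>d"
          using homogeneous_add[OF deg_zero_closed homogeneous_scale[OF deg_zero_closed one_homogeneous, of c]
              homogeneous_uminus[OF deg_zero_closed q]] by simp
        let ?X = "add_diagonal_entry m (scale c 1 - q) W"
        have "u * scale (inverse c) 1 * gdet (drop m ds) (tail_mat m ?X) = 1"
          using u(2) c by (simp add: det[OF s] flip: scale_mult_left scale_mult_right)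
        moreover have "u * scale (inverse c) 1 \<in> A \<zero>\<^sub>d"
          using u(1) by (simp add: homogeneous_scale deg_zero_closed flip: scale_mult_right)
        ultimately have "?unit m ?X" by blast
        moreover have "?unit j ?X" if "Suc m \<le> j" "j \<le> ?N" for j
          using unit that by (simp add: tail_mat_add_diagonal_entry)
        ultimately have "?unit j ?X" if "m \<le> j" "j \<le> ?N" for j
          using that by (metis le_antisym not_less_eq_eq)
        then show ?thesis
          using Suc.IH m gmats_add_diagonal_entry[OF W ds s] by (simp add: shift)
      qed
      then have "R (add_diagonal_entry m q ?W) = 0"
        by (rule central_polynomial_vanishing[OF entry_polynomial_central[OF R W'] _ q])
      moreover have "add_diagonal_entry m q ?W = W"
        unfolding shift by (rule eq_matI) (auto simp: add_diagonal_entry_def)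
      ultimately show "R W = 0" by simp
    qed
  qed
  from this[of ?N] have "(\<forall>j. ?N \<le> j \<and> j \<le> ?N \<longrightarrow> ?unit j W) \<longrightarrow> R W = 0"
    using W by blast
  moreover have "?unit ?N W"
  proof -
    have "tail_mat ?N W \<in> carrier_mat 0 0"
      using gmatsD(1)[OF W] by (simp add: tail_mat_def)
    then show ?thesis
      by (intro bexI[of _ 1] one_homogeneous) (simp add: gdet_empty)
  qed
  ultimately show ?thesis by (metis le_antisym)
qed

theorem graded_det_eq_gdet:
  assumes len: "length ds = length rs" and par: "set ds \<subseteq> degrees_of_parity p"
    and Z: "Z \<in> graded_mats A ds rs"
  shows "graded_det scale A ds rs Z = gdet (index_degrees ds rs) Z"
proof -
  let ?I = "index_degrees ds rs"
  have pI: "set ?I \<subseteq> degrees_of_parity p"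
    using set_index_degrees par by blast
  have lI: "length ?I = sum_list rs"
    by (rule length_index_degrees[OF len])
  note eq = graded_mats_eq_gmats[OF len]
  obtain P where P: "P \<in> entry_polynomials scale (sum_list rs)" "\<And>X. X \<in> gmats ?I ?I \<Longrightarrow> P X = gdet ?I X"
    by (rule gdet_entry_polynomial[OF pI, unfolded lI], erule that, assumption)
  let ?good = "\<lambda>P. \<forall>W \<in> graded_mats A ds rs. quasidets_exist A ds rs W \<longrightarrow>
      P W = prod_list (map (\<lambda>k. leibniz_det (quasidet A ds rs k W)) [0..<length rs])"
  have unique: "Q Z = gdet ?I Z" if Q: "Q \<in> entry_polynomials scale (sum_list rs)" "?good Q" for Q
  proof -
    have "(\<lambda>X. Q X + - P X) Z = 0"
    proof (rule entry_polynomial_vanishing[OF pI])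
      show "(\<lambda>X. Q X + - P X) \<in> entry_polynomials scale (length ?I)"
        unfolding lI by (intro entry_polynomials.add Q entry_polynomials_uminus P)
      show "Z \<in> gmats ?I ?I" using Z eq by simp
      fix W assume W: "W \<in> gmats ?I ?I"
        and unit: "\<forall>j\<le>length ?I. \<exists>u\<in>A \<zero>\<^sub>d. u * gdet (drop j ?I) (tail_mat j W) = 1"
      have "quasidets_exist A ds rs W"
        unfolding quasidets_exist_def
      proof (intro allI impI)
        fix k assume "k < length rs"
        let ?m = "sum_list (take (Suc k) rs)"
        have m: "?m \<le> length ?I"
          using sum_list_append[of "take (Suc k) rs" "drop (Suc k) rs"] by (simp add: lI)
        have len': "length (drop (Suc k) ds) = length (drop (Suc k) rs)"
          using len by simp
        have pd: "set (drop ?m ?I) \<subseteq> degrees_of_parity p"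
          using pI set_drop_subset[of ?m ?I] by blast
        have T: "tail_mat ?m W \<in> gmats (drop ?m ?I) (drop ?m ?I)"
          by (rule gmats_tail_mat[OF W])
        have l: "sum_list (drop (Suc k) rs) = length (drop ?m ?I)"
          using length_index_degrees[OF len'] by (simp add: index_degrees_drop[OF len])
        obtain u where "u \<in> A \<zero>\<^sub>d" "u * gdet (drop ?m ?I) (tail_mat ?m W) = 1"
          using unit m by blast
        then obtain Y where "Y \<in> gmats (drop ?m ?I) (drop ?m ?I)"
          "tail_mat ?m W * Y = 1\<^sub>m (length (drop ?m ?I))" "Y * tail_mat ?m W = 1\<^sub>m (length (drop ?m ?I))"
          by (rule inverse_of_unit_gdet[OF pd T])
        then show "trailing rs (Suc k) W
            \<in> Units (graded_mat_monoid A (drop (Suc k) ds) (drop (Suc k) rs))"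
          using T unfolding Units_def graded_mat_monoid_def trailing_eq_tail_mat
          by (simp add: graded_mats_eq_gmats[OF len'] index_degrees_drop[OF len] l) blast
      qed
      then show "Q W + - P W = 0"
        using Q(2) W P(2)[OF W] gdet_eq_prod_quasidets[OF len par, of W] eq by simp
    qed
    then show ?thesis
      using P(2) Z eq by simp
  qed
  have good: "?good P"
    using P(2) gdet_eq_prod_quasidets[OF len par] eq by simp
  then show ?thesis
    unfolding graded_det_def
  proof (intro the_equality bexI[of _ P] conjI)
    show "gdet ?I Z = P Z"
      using P(2) Z eq by simp
    fix d assume "\<exists>Q\<in>entry_polynomials scale (sum_list rs). ?good Q \<and> d = Q Z"
    then show "d = gdet ?I Z"
      using unique by blast
  qed (rule good P(1))+
qed

end


section \<open>Existence and uniqueness of the Berezinian\<close>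

lemma deg_scalar_Cons: "deg_scalar (a # \<gamma>) (b # \<delta>) = a * b + deg_scalar \<gamma> \<delta>"
  by (simp add: deg_scalar_def)

lemma length_even_odd_degrees_Suc:
  "length (even_degrees (Suc n)) = length (even_degrees n) + length (odd_degrees n)"
  "length (odd_degrees (Suc n)) = length (even_degrees n) + length (odd_degrees n)"
proof -
  have flip: "1 + b = (0 :: bit) \<longleftrightarrow> b = 1" "1 + b = (1 :: bit) \<longleftrightarrow> b = 0" for b
    by (cases b; simp)+
  show "length (even_degrees (Suc n)) = length (even_degrees n) + length (odd_degrees n)"
    "length (odd_degrees (Suc n)) = length (even_degrees n) + length (odd_degrees n)"
    by (simp_all add: even_degrees_def odd_degrees_def filter_map o_def deg_scalar_Cons flip)
qed

lemma length_even_odd_degrees: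
  assumes "n \<ge> 1"
  shows "length (even_degrees n) = 2 ^ (n - 1)" "length (odd_degrees n) = 2 ^ (n - 1)"
proof -
  have "length (even_degrees n) + length (odd_degrees n) = 2 ^ n" for n
  proof (induction n)
    case 0
    show ?case by (simp add: even_degrees_def odd_degrees_def deg_scalar_def)
  next
    case (Suc n)
    then show ?case by (simp add: length_even_odd_degrees_Suc)
  qed
  then show "length (even_degrees n) = 2 ^ (n - 1)" "length (odd_degrees n) = 2 ^ (n - 1)"
    using assms by (cases n; simp add: length_even_odd_degrees_Suc)+
qed

lemma product_lists_in_degrees: "set (product_lists (replicate n [0, 1])) \<subseteq> degrees n"
  by (auto simp: degrees_def dest: in_set_product_lists_length)

context graded_commutative_algebra
begin

lemma even_degrees_parity: "set (even_degrees n) \<subseteq> degrees_of_parity 0"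
  using product_lists_in_degrees by (auto simp: even_degrees_def degrees_of_parity_def)

lemma odd_degrees_parity: "set (odd_degrees n) \<subseteq> degrees_of_parity 1"
  using product_lists_in_degrees by (auto simp: odd_degrees_def degrees_of_parity_def)

lemma degree0_comm_monoid: "Group.comm_monoid (degree0_monoid n A)"
  by (rule comm_monoidI)
    (auto simp: degree0_monoid_def deg_zero_mult one_homogeneous mult.assoc intro: deg_zero_central)

lemma degree0_units_comm_group: "comm_group (degree0_units n A)"
  using comm_monoid.units_comm_group[OF degree0_comm_monoid] .

lemma carrier_degree0_units:
  "carrier (degree0_units n A) = {a \<in> A \<zero>\<^sub>d. \<exists>b\<in>A \<zero>\<^sub>d. b * a = 1}"
proof -
  have "a * b = 1" if "a \<in> A \<zero>\<^sub>d" "b * a = 1" for a b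
    using deg_zero_central[OF that(1), of b] that(2) by simp
  then show ?thesis
    by (auto simp: units_of_def Units_def degree0_monoid_def)
qed

lemma degree0_units_simps:
  "x \<otimes>\<^bsub>degree0_units n A\<^esub> y = x * y" "\<one>\<^bsub>degree0_units n A\<^esub> = 1"
  by (simp_all add: units_of_def degree0_monoid_def)

definition gmat_monoid :: "degree list \<Rightarrow> 'a mat monoid" where
  "gmat_monoid ds = \<lparr>carrier = gmats ds ds, mult = (*), one = 1\<^sub>m (length ds)\<rparr>"

lemma graded_mat_monoid_eq:
  assumes "length ds = length rs"
  shows "graded_mat_monoid A ds rs = gmat_monoid (index_degrees ds rs)"
  by (simp add: graded_mat_monoid_def gmat_monoid_def graded_mats_eq_gmats[OF assms]
      length_index_degrees[OF assms])

lemma carrier_gmat_units: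
  "carrier (units_of (gmat_monoid ds))
    = {X \<in> gmats ds ds. \<exists>Y\<in>gmats ds ds. X * Y = 1\<^sub>m (length ds) \<and> Y * X = 1\<^sub>m (length ds)}"
  by (auto simp: units_of_def Units_def gmat_monoid_def)

lemma mult_gmat_units: "X \<otimes>\<^bsub>units_of (gmat_monoid ds)\<^esub> Y = X * Y"
  by (simp add: units_of_def gmat_monoid_def)

lemma inverse_mult:
  assumes ds: "set ds \<subseteq> degrees n"
    and X: "X \<in> gmats ds ds" "X' \<in> gmats ds ds" "X * X' = 1\<^sub>m (length ds)" "X' * X = 1\<^sub>m (length ds)"
    and Y: "Y \<in> gmats ds ds" "Y' \<in> gmats ds ds" "Y * Y' = 1\<^sub>m (length ds)" "Y' * Y = 1\<^sub>m (length ds)"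
  shows "X * Y * (Y' * X') = 1\<^sub>m (length ds)" "Y' * X' * (X * Y) = 1\<^sub>m (length ds)"
proof -
  note c = X(1,2)[THEN gmatsD(1)] Y(1,2)[THEN gmatsD(1)]
  have "X * Y * (Y' * X') = X * (Y * Y' * X')"
    using assoc_mult_mat[OF c(1,3) mult_carrier_mat[OF c(4,2)]] assoc_mult_mat[OF c(3,4,2)] by simp
  then show "X * Y * (Y' * X') = 1\<^sub>m (length ds)"
    using X(3) Y(3) one_mult_mat[OF c(2)] by simp
  have "Y' * X' * (X * Y) = Y' * (X' * X * Y)"
    using assoc_mult_mat[OF c(4,2) mult_carrier_mat[OF c(1,3)]] assoc_mult_mat[OF c(2,1,3)] by simp
  then show "Y' * X' * (X * Y) = 1\<^sub>m (length ds)"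
    using X(4) Y(4) one_mult_mat[OF c(3)] by simp
qed

text \<open>
  A choice of the inverse as a matrix, to whose blocks \<open>inverse_ber\<close> can refer.
\<close>

definition unit_inverse :: "degree list \<Rightarrow> 'a mat \<Rightarrow> 'a mat" where
  "unit_inverse ds X = (SOME Y. Y \<in> gmats ds ds \<and> X * Y = 1\<^sub>m (length ds) \<and> Y * X = 1\<^sub>m (length ds))"

lemma unit_inverse:
  assumes "X \<in> carrier (units_of (gmat_monoid ds))"
  shows "X \<in> gmats ds ds" "unit_inverse ds X \<in> gmats ds ds"
    "X * unit_inverse ds X = 1\<^sub>m (length ds)" "unit_inverse ds X * X = 1\<^sub>m (length ds)"
proof -
  have "\<exists>Y. Y \<in> gmats ds ds \<and> X * Y = 1\<^sub>m (length ds) \<and> Y * X = 1\<^sub>m (length ds)"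
    using assms by (auto simp: carrier_gmat_units)
  from someI_ex[OF this] show "unit_inverse ds X \<in> gmats ds ds"
    "X * unit_inverse ds X = 1\<^sub>m (length ds)" "unit_inverse ds X * X = 1\<^sub>m (length ds)"
    by (simp_all add: unit_inverse_def)
  show "X \<in> gmats ds ds"
    using assms by (simp add: carrier_gmat_units)
qed

lemma inverse_unique:
  assumes "X \<in> gmats ds ds" "Y \<in> gmats ds ds" "Z \<in> gmats ds ds"
    and "X * Y = 1\<^sub>m (length ds)" "Z * X = 1\<^sub>m (length ds)"
  shows "Y = Z"
proof -
  note c = assms(1-3)[THEN gmatsD(1)]
  have "Y = Z * X * Y"
    using assms(5) one_mult_mat[OF c(2)] by simp
  also have "\<dots> = Z"
    using assoc_mult_mat[OF c(3,1,2)] assms(4) mult_one_mat[OF c(3)] by simp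
  finally show ?thesis .
qed

lemma unit_inverse_mult:
  assumes ds: "set ds \<subseteq> degrees n"
    and X: "X \<in> carrier (units_of (gmat_monoid ds))" and Y: "Y \<in> carrier (units_of (gmat_monoid ds))"
  shows "X * Y \<in> carrier (units_of (gmat_monoid ds))"
    and "unit_inverse ds (X * Y) = unit_inverse ds Y * unit_inverse ds X"
proof -
  note x = unit_inverse[OF X] and y = unit_inverse[OF Y]
  note xy = inverse_mult[OF ds x y]
  have g: "X * Y \<in> gmats ds ds" "unit_inverse ds Y * unit_inverse ds X \<in> gmats ds ds"
    using gmats_mult[OF x(1) y(1) ds ds ds] gmats_mult[OF y(2) x(2) ds ds ds] by auto
  then show XY: "X * Y \<in> carrier (units_of (gmat_monoid ds))"
    using xy by (auto simp: carrier_gmat_units)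
  show "unit_inverse ds (X * Y) = unit_inverse ds Y * unit_inverse ds X"
    using inverse_unique[OF g(1) unit_inverse(2)[OF XY] g(2) unit_inverse(3)[OF XY] xy(2)] .
qed

lemma upper_unitriangular_unit:
  assumes d: "set ds \<subseteq> degrees n" "set es \<subseteq> degrees n" and B: "B \<in> gmats ds es"
  shows "four_block_mat (1\<^sub>m (length ds)) B (0\<^sub>m (length es) (length ds)) (1\<^sub>m (length es))
    \<in> carrier (units_of (gmat_monoid (ds @ es)))"
proof -
  let ?U = "\<lambda>B. four_block_mat (1\<^sub>m (length ds)) B (0\<^sub>m (length es) (length ds)) (1\<^sub>m (length es)) :: 'a mat"
  have "?U B * ?U C = ?U (B + C)" if "B \<in> gmats ds es" "C \<in> gmats ds es" for B C
    unfolding mult_four_block_mat[OF one_carrier_mat gmatsD(1)[OF that(1)] zero_carrier_mat one_carrier_mat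
        one_carrier_mat gmatsD(1)[OF that(2)] zero_carrier_mat one_carrier_mat]
    using gmatsD(1)[OF that(1)] gmatsD(1)[OF that(2)]
    by (simp add: one_mult_mat mult_one_mat one_mult_mat[OF one_carrier_mat] comm_add_mat[of C "length ds" "length es" B])
  moreover have "B + - B = 0\<^sub>m (length ds) (length es)" "- B + B = 0\<^sub>m (length ds) (length es)"
    using gmatsD(1)[OF B] by (auto intro!: eq_matI)
  moreover have "?U C \<in> gmats (ds @ es) (ds @ es)" if "C \<in> gmats ds es" for C
    by (intro gmats_four_block gmats_one gmats_zero d that)
  ultimately show ?thesis
    using B gmats_uminus[OF B d] unfolding carrier_gmat_units
    by (intro CollectI conjI bexI[of _ "?U (- B)"]) simp_all
qed

lemma lower_unitriangular_unit:
  assumes d: "set ds \<subseteq> degrees n" "set es \<subseteq> degrees n" and C: "C \<in> gmats es ds"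
  shows "four_block_mat (1\<^sub>m (length ds)) (0\<^sub>m (length ds) (length es)) C (1\<^sub>m (length es))
    \<in> carrier (units_of (gmat_monoid (ds @ es)))"
proof -
  let ?L = "\<lambda>C. four_block_mat (1\<^sub>m (length ds)) (0\<^sub>m (length ds) (length es)) C (1\<^sub>m (length es)) :: 'a mat"
  have "?L B * ?L C = ?L (B + C)" if "B \<in> gmats es ds" "C \<in> gmats es ds" for B C
    unfolding mult_four_block_mat[OF one_carrier_mat zero_carrier_mat gmatsD(1)[OF that(1)] one_carrier_mat
        one_carrier_mat zero_carrier_mat gmatsD(1)[OF that(2)] one_carrier_mat]
    using gmatsD(1)[OF that(1)] gmatsD(1)[OF that(2)]
    by (simp add: one_mult_mat mult_one_mat one_mult_mat[OF one_carrier_mat])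
  moreover have "C + - C = 0\<^sub>m (length es) (length ds)" "- C + C = 0\<^sub>m (length es) (length ds)"
    using gmatsD(1)[OF C] by (auto intro!: eq_matI)
  moreover have "?L B \<in> gmats (ds @ es) (ds @ es)" if "B \<in> gmats es ds" for B
    by (intro gmats_four_block gmats_one gmats_zero d that)
  ultimately show ?thesis
    using C gmats_uminus[OF C d(2,1)] unfolding carrier_gmat_units
    by (intro CollectI conjI bexI[of _ "?L (- C)"]) simp_all
qed

lemma inverse_ber_unit:
  assumes pds: "set ds \<subseteq> degrees_of_parity p" and pes: "set es \<subseteq> degrees_of_parity q"
    and pq: "p + q = 1" and X: "X \<in> carrier (units_of (gmat_monoid (ds @ es)))"
  shows "inverse_ber ds es X (unit_inverse (ds @ es) X) \<in> carrier (degree0_units n A)"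
proof -
  let ?X' = "unit_inverse (ds @ es) X"
  note x = unit_inverse[OF X]
  obtain P Q R S where X_eq: "X = four_block_mat P Q R S"
    and Xb: "P \<in> gmats ds ds" "Q \<in> gmats ds es" "R \<in> gmats es ds" "S \<in> gmats es es"
    using gmats_blocks[OF x(1)] .
  obtain P' Q' R' S' where X'_eq: "?X' = four_block_mat P' Q' R' S'"
    and X'b: "P' \<in> gmats ds ds" "Q' \<in> gmats ds es" "R' \<in> gmats es ds" "S' \<in> gmats es es"
    using gmats_blocks[OF x(2)] .
  have "inverse_ber ds es X ?X' = gdet ds P' * gdet es S"
    unfolding inverse_ber_def X_eq[symmetric] X'_eq
    using corners_four_block(1)[OF gmatsD(1)[OF X'b(1)] gmatsD(1)[OF X'b(4)]]
      corners_four_block(2)[OF gmatsD(1)[OF Xb(1)] gmatsD(1)[OF Xb(4)]] X_eq by simp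
  moreover have "gdet ds P' \<in> carrier (degree0_units n A)"
    using gdet_corner_units(1)[OF pds pes pq x(4)[unfolded X'_eq, unfolded X_eq] X'b Xb]
      gdet_deg_zero[OF pds X'b(1)] by (simp add: carrier_degree0_units)
  moreover have "gdet es S \<in> carrier (degree0_units n A)"
    using gdet_corner_units(2)[OF pds pes pq x(3)[unfolded X'_eq, unfolded X_eq] Xb X'b]
      gdet_deg_zero[OF pes Xb(4)] by (simp add: carrier_degree0_units)
  ultimately show ?thesis
    using comm_group.axioms(1)[OF degree0_units_comm_group, THEN comm_monoid.axioms(1), THEN monoid.m_closed]
    by (simp add: degree0_units_simps)
qed


text \<open>
  Uniqueness holds because a homomorphism with the prescribed values on unitriangular matrices has the
  same value at \<open>X\<close> and at the block-diagonal matrix from \<open>unitriangular_diagonalization\<close>.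
\<close>

theorem berezinian_exists_unique:
  assumes pds: "set ds \<subseteq> degrees_of_parity p" and pes: "set es \<subseteq> degrees_of_parity q"
    and pq: "p + q = 1"
  defines "N1 \<equiv> length ds" and "N2 \<equiv> length es"
    and "G \<equiv> units_of (gmat_monoid (ds @ es))" and "U \<equiv> degree0_units n A"
  shows "\<exists>!Ber. Ber \<in> extensional (carrier G) \<and> Ber \<in> hom G U
    \<and> (\<forall>X11 \<in> carrier_mat N1 N1. \<forall>X22 \<in> carrier_mat N2 N2.
         four_block_mat X11 (0\<^sub>m N1 N2) (0\<^sub>m N2 N1) X22 \<in> carrier G \<longrightarrow>
           gdet ds X11 \<in> carrier U \<and> gdet es X22 \<in> carrier U
           \<and> Ber (four_block_mat X11 (0\<^sub>m N1 N2) (0\<^sub>m N2 N1) X22)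
             = gdet ds X11 \<otimes>\<^bsub>U\<^esub> inv\<^bsub>U\<^esub> (gdet es X22))
    \<and> (\<forall>X21 \<in> carrier_mat N2 N1.
         four_block_mat (1\<^sub>m N1) (0\<^sub>m N1 N2) X21 (1\<^sub>m N2) \<in> carrier G \<longrightarrow>
           Ber (four_block_mat (1\<^sub>m N1) (0\<^sub>m N1 N2) X21 (1\<^sub>m N2)) = \<one>\<^bsub>U\<^esub>)
    \<and> (\<forall>X12 \<in> carrier_mat N1 N2.
         four_block_mat (1\<^sub>m N1) X12 (0\<^sub>m N2 N1) (1\<^sub>m N2) \<in> carrier G \<longrightarrow>
           Ber (four_block_mat (1\<^sub>m N1) X12 (0\<^sub>m N2 N1) (1\<^sub>m N2)) = \<one>\<^bsub>U\<^esub>)"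
    (is "\<exists>!Ber. ?ext Ber \<and> ?hom Ber \<and> ?diag Ber \<and> ?low Ber \<and> ?up Ber")
proof (rule ex_ex1I)
  note dds = degrees_of_parity_subset[OF pds] and des = degrees_of_parity_subset[OF pes]
  let ?I = "ds @ es"
  let ?inv = "unit_inverse ?I"
  have dI: "set ?I \<subseteq> degrees n"
    using dds des by simp
  interpret U: comm_group U
    unfolding U_def by (rule degree0_units_comm_group)
  have Umult: "x \<otimes>\<^bsub>U\<^esub> y = x * y" and Uone: "\<one>\<^bsub>U\<^esub> = 1" for x y
    by (simp_all add: U_def degree0_units_simps)
  have UI: "a \<in> carrier U" if "a \<in> A \<zero>\<^sub>d" "b \<in> A \<zero>\<^sub>d" "b * a = 1" for a b
    using that by (auto simp: U_def carrier_degree0_units)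
  have Gmult: "X \<otimes>\<^bsub>G\<^esub> Y = X * Y" for X Y
    by (simp add: G_def mult_gmat_units)
  note inverse = unit_inverse[of _ ?I, folded G_def]
  have Gclosed: "X * Y \<in> carrier G" and Ginv: "?inv (X * Y) = ?inv Y * ?inv X"
    if "X \<in> carrier G" "Y \<in> carrier G" for X Y
    using unit_inverse_mult[OF dI] that unfolding G_def by auto
  let ?b = "\<lambda>X. inverse_ber ds es X (?inv X)"
  have b_unit: "?b X \<in> carrier U" if "X \<in> carrier G" for X
    using inverse_ber_unit[OF pds pes pq] that unfolding G_def U_def by blast
  define Ber where "Ber = restrict (\<lambda>X. inv\<^bsub>U\<^esub> (?b X)) (carrier G)"
  have "?hom Ber"
  proof (rule homI)
    show "Ber X \<in> carrier U" if "X \<in> carrier G" for X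
      using b_unit[OF that] that by (simp add: Ber_def)
    fix X Y assume X: "X \<in> carrier G" and Y: "Y \<in> carrier G"
    have "?b (X * Y) = ?b X * ?b Y"
      unfolding Ginv[OF X Y]
      by (rule inverse_ber_mult[OF pds pes pq inverse(1,2,3)[OF X] inverse[OF Y]])
    then show "Ber (X \<otimes>\<^bsub>G\<^esub> Y) = Ber X \<otimes>\<^bsub>U\<^esub> Ber Y"
      using X Y b_unit[OF X] b_unit[OF Y] Gclosed[OF X Y] U.inv_mult[of "?b X" "?b Y"]
      by (simp add: Ber_def Gmult Umult)
  qed
  moreover have "?ext Ber"
    by (simp add: Ber_def)
  moreover have "?diag Ber"
  proof (intro ballI impI)
    fix X11 X22 :: "'a mat"
    assume c: "X11 \<in> carrier_mat N1 N1" "X22 \<in> carrier_mat N2 N2"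
    let ?X = "four_block_mat X11 (0\<^sub>m N1 N2) (0\<^sub>m N2 N1) X22"
    assume X: "?X \<in> carrier G"
    note Xb = gmats_four_blockD[OF inverse(1)[OF X], folded N1_def N2_def, OF c(1) zero_carrier_mat zero_carrier_mat c(2)]
    obtain P' Q' R' S' where X'_eq: "?inv ?X = four_block_mat P' Q' R' S'"
      and X'b: "P' \<in> gmats ds ds" "Q' \<in> gmats ds es" "R' \<in> gmats es ds" "S' \<in> gmats es es"
      using gmats_blocks[OF inverse(2)[OF X]] .
    note c' = X'b[THEN gmatsD(1), folded N1_def N2_def]
    note eq = four_block_mult_eq_one[OF inverse(3)[OF X, unfolded X'_eq] Xb X'b, folded N1_def N2_def]
    have "X11 * P' = 1\<^sub>m N1"
      using eq(1) c c' by simp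
    then have 1: "gdet ds X11 * gdet ds P' = 1"
      using gdet_mult[OF pds Xb(1) X'b(1)] gdet_one[OF pds] by (simp add: N1_def)
    have "X22 * S' = 1\<^sub>m N2"
      using eq(4) c c' by simp
    then have 2: "gdet es X22 * gdet es S' = 1"
      using gdet_mult[OF pes Xb(4) X'b(4)] gdet_one[OF pes] by (simp add: N2_def)
    have A0: "gdet ds X11 \<in> A \<zero>\<^sub>d" "gdet ds P' \<in> A \<zero>\<^sub>d" "gdet es X22 \<in> A \<zero>\<^sub>d" "gdet es S' \<in> A \<zero>\<^sub>d"
      using gdet_deg_zero[OF pds Xb(1)] gdet_deg_zero[OF pds X'b(1)]
        gdet_deg_zero[OF pes Xb(4)] gdet_deg_zero[OF pes X'b(4)] by auto
    have u: "gdet ds X11 \<in> carrier U" "gdet ds P' \<in> carrier U" "gdet es X22 \<in> carrier U"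
      using UI[OF A0(1,2)] UI[OF A0(2,1)] UI[OF A0(3,4)] 1 2
        deg_zero_central[OF A0(1), of "gdet ds P'"] deg_zero_central[OF A0(3), of "gdet es S'"]
      by auto
    have inv1: "inv\<^bsub>U\<^esub> (gdet ds P') = gdet ds X11"
      using U.inv_equality[OF _ u(2,1)] 1 by (simp add: Umult Uone)
    have "?b ?X = gdet ds P' * gdet es X22"
      unfolding inverse_ber_def X'_eq using c c' by (simp add: corners_four_block N1_def N2_def)
    then have "Ber ?X = gdet ds X11 \<otimes>\<^bsub>U\<^esub> inv\<^bsub>U\<^esub> (gdet es X22)"
      using X U.inv_mult[OF u(2,3)] by (simp add: Ber_def Umult inv1)
    with u show "gdet ds X11 \<in> carrier U \<and> gdet es X22 \<in> carrier U
        \<and> Ber ?X = gdet ds X11 \<otimes>\<^bsub>U\<^esub> inv\<^bsub>U\<^esub> (gdet es X22)"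
      by blast
  qed
  moreover have unitriangular: "Ber (four_block_mat (1\<^sub>m N1) Q R (1\<^sub>m N2)) = \<one>\<^bsub>U\<^esub>"
    if X: "four_block_mat (1\<^sub>m N1) Q R (1\<^sub>m N2) \<in> carrier G"
      and c: "Q \<in> carrier_mat N1 N2" "R \<in> carrier_mat N2 N1"
      and QR: "Q = 0\<^sub>m N1 N2 \<or> R = 0\<^sub>m N2 N1" for Q R :: "'a mat"
  proof -
    let ?X = "four_block_mat (1\<^sub>m N1) Q R (1\<^sub>m N2) :: 'a mat"
    note Xb = gmats_four_blockD[OF inverse(1)[OF X], folded N1_def N2_def, OF one_carrier_mat c one_carrier_mat]
    obtain P' Q' R' S' where X'_eq: "?inv ?X = four_block_mat P' Q' R' S'"
      and X'b: "P' \<in> gmats ds ds" "Q' \<in> gmats ds es" "R' \<in> gmats es ds" "S' \<in> gmats es es"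
      using gmats_blocks[OF inverse(2)[OF X]] .
    note c' = X'b[THEN gmatsD(1), folded N1_def N2_def]
    note eq = four_block_mult_eq_one(1)[OF inverse(3)[OF X, unfolded X'_eq] Xb X'b, folded N1_def N2_def]
      four_block_mult_eq_one(1)[OF inverse(4)[OF X, unfolded X'_eq] X'b Xb, folded N1_def N2_def]
    have "P' = 1\<^sub>m N1"
      using QR eq c c' one_mult_mat[OF c'(1)] mult_one_mat[OF c'(1)] by auto
    then have "?b ?X = gdet ds (1\<^sub>m N1) * gdet es (1\<^sub>m N2)"
      unfolding inverse_ber_def X'_eq using c c' by (simp add: corners_four_block N1_def N2_def)
    then have "?b ?X = \<one>\<^bsub>U\<^esub>"
      by (simp add: N1_def N2_def gdet_one[OF pds] gdet_one[OF pes] Uone)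
    then show ?thesis
      using X by (simp add: Ber_def)
  qed
  have "?low Ber" "?up Ber"
    by (intro ballI impI unitriangular; simp)+
  ultimately show "\<exists>Ber. ?ext Ber \<and> ?hom Ber \<and> ?diag Ber \<and> ?low Ber \<and> ?up Ber"
    by blast
  fix F F'
  assume F: "?ext F \<and> ?hom F \<and> ?diag F \<and> ?low F \<and> ?up F"
    and F': "?ext F' \<and> ?hom F' \<and> ?diag F' \<and> ?low F' \<and> ?up F'"
  show "F = F'"
  proof (rule extensionalityI[of _ "carrier G"])
    fix X assume X: "X \<in> carrier G"
    obtain B C K S where b: "B \<in> gmats ds es" "C \<in> gmats es ds" "K \<in> gmats ds ds" "S \<in> gmats es es"
      and D: "four_block_mat (1\<^sub>m N1) B (0\<^sub>m N2 N1) (1\<^sub>m N2)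
        * (X * four_block_mat (1\<^sub>m N1) (0\<^sub>m N1 N2) C (1\<^sub>m N2))
        = four_block_mat K (0\<^sub>m N1 N2) (0\<^sub>m N2 N1) S"
      using unitriangular_diagonalization[OF pds pes pq inverse(1,2,3)[OF X]]
      unfolding N1_def N2_def .
    note c = b[THEN gmatsD(1), folded N1_def N2_def]
    let ?U = "four_block_mat (1\<^sub>m N1) B (0\<^sub>m N2 N1) (1\<^sub>m N2) :: 'a mat"
      and ?L = "four_block_mat (1\<^sub>m N1) (0\<^sub>m N1 N2) C (1\<^sub>m N2) :: 'a mat"
      and ?D = "four_block_mat K (0\<^sub>m N1 N2) (0\<^sub>m N2 N1) S :: 'a mat"
    have UG: "?U \<in> carrier G" and LG: "?L \<in> carrier G"
      using upper_unitriangular_unit[OF dds des b(1)] lower_unitriangular_unit[OF dds des b(2)]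
      by (simp_all add: G_def N1_def N2_def)
    have DG: "?D \<in> carrier G"
      using Gclosed[OF UG Gclosed[OF X LG]] by (simp add: D)
    have determined: "H X = gdet ds K \<otimes>\<^bsub>U\<^esub> inv\<^bsub>U\<^esub> (gdet es S)"
      if H: "?hom H" "?diag H" "?low H" "?up H" for H
    proof -
      have m: "H (Y * Z) = H Y \<otimes>\<^bsub>U\<^esub> H Z" if "Y \<in> carrier G" "Z \<in> carrier G" for Y Z
        using hom_mult[OF H(1) that] by (simp add: Gmult)
      have "H ?D = H ?U \<otimes>\<^bsub>U\<^esub> (H X \<otimes>\<^bsub>U\<^esub> H ?L)"
        using m[OF UG Gclosed[OF X LG]] m[OF X LG] by (simp add: D)
      also have "\<dots> = H X"
        using H(3,4) UG LG c hom_in_carrier[OF H(1) X] by simp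
      finally show ?thesis
        using H(2) DG c by simp
    qed
    show "F X = F' X"
      using determined[of F] determined[of F'] F F' by simp
  qed (use F F' in auto)
qed

end

theorem theorem3:
  fixes scale :: "'k::field_char_0 \<Rightarrow> 'a::{ring, monoid_mult} \<Rightarrow> 'a"
    and n :: nat
    and A :: "degree \<Rightarrow> 'a set"
    and r :: "nat list"
  assumes "graded_commutative_algebra scale n A"
    and "n \<ge> 1"
    and "length r = 2 ^ n"
  defines "r1 \<equiv> take (2 ^ (n - 1)) r"
    and "r2 \<equiv> drop (2 ^ (n - 1)) r"
  defines "N1 \<equiv> sum_list r1"
    and "N2 \<equiv> sum_list r2"
  defines "det1 \<equiv> graded_det scale A (even_degrees n) r1"
    and "det2 \<equiv> graded_det scale A (odd_degrees n) r2"
  defines "U \<equiv> degree0_units n A"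
  shows "\<exists>!Ber. Ber \<in> extensional (carrier (GL0 n A r)) \<and> Ber \<in> hom (GL0 n A r) U
    \<and> (\<forall>X11 \<in> carrier_mat N1 N1. \<forall>X22 \<in> carrier_mat N2 N2.
         four_block_mat X11 (0\<^sub>m N1 N2) (0\<^sub>m N2 N1) X22 \<in> carrier (GL0 n A r) \<longrightarrow>
           det1 X11 \<in> carrier U \<and> det2 X22 \<in> carrier U
           \<and> Ber (four_block_mat X11 (0\<^sub>m N1 N2) (0\<^sub>m N2 N1) X22)
             = det1 X11 \<otimes>\<^bsub>U\<^esub> inv\<^bsub>U\<^esub> (det2 X22))
    \<and> (\<forall>X21 \<in> carrier_mat N2 N1.
         four_block_mat (1\<^sub>m N1) (0\<^sub>m N1 N2) X21 (1\<^sub>m N2) \<in> carrier (GL0 n A r) \<longrightarrow>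
           Ber (four_block_mat (1\<^sub>m N1) (0\<^sub>m N1 N2) X21 (1\<^sub>m N2)) = \<one>\<^bsub>U\<^esub>)
    \<and> (\<forall>X12 \<in> carrier_mat N1 N2.
         four_block_mat (1\<^sub>m N1) X12 (0\<^sub>m N2 N1) (1\<^sub>m N2) \<in> carrier (GL0 n A r) \<longrightarrow>
           Ber (four_block_mat (1\<^sub>m N1) X12 (0\<^sub>m N2 N1) (1\<^sub>m N2)) = \<one>\<^bsub>U\<^esub>)"
proof -
  interpret graded_commutative_algebra scale n A by fact
  have "(2 :: nat) ^ n = 2 ^ (n - 1) + 2 ^ (n - 1)"
    using \<open>n \<ge> 1\<close> by (cases n) simp_all
  then have len: "length (even_degrees n) = length r1" "length (odd_degrees n) = length r2"
    using length_even_odd_degrees[OF \<open>n \<ge> 1\<close>] \<open>length r = 2 ^ n\<close> by (simp_all add: r1_def r2_def)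
  let ?ds = "index_degrees (even_degrees n) r1" and ?es = "index_degrees (odd_degrees n) r2"
  have pds: "set ?ds \<subseteq> degrees_of_parity 0" and pes: "set ?es \<subseteq> degrees_of_parity 1"
    using set_index_degrees even_degrees_parity odd_degrees_parity by blast+
  have N: "length ?ds = N1" "length ?es = N2"
    by (simp_all add: N1_def N2_def length_index_degrees len)
  have r: "r = r1 @ r2"
    by (simp add: r1_def r2_def)
  have "graded_mat_monoid A (degree_list n) r = gmat_monoid (index_degrees (degree_list n) r)"
    by (rule graded_mat_monoid_eq) (simp add: degree_list_def len r)
  also have "index_degrees (degree_list n) r = ?ds @ ?es"
    by (simp add: degree_list_def r index_degrees_append len)
  finally have G: "GL0 n A r = units_of (gmat_monoid (?ds @ ?es))"
    by (simp add: GL0_def)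
  have det: "gdet ?ds X11 = det1 X11 \<and> gdet ?es X22 = det2 X22"
    if X: "four_block_mat X11 (0\<^sub>m N1 N2) (0\<^sub>m N2 N1) X22 \<in> carrier (units_of (gmat_monoid (?ds @ ?es)))"
      and c: "X11 \<in> carrier_mat N1 N1" "X22 \<in> carrier_mat N2 N2" for X11 X22
  proof -
    have "X11 \<in> gmats ?ds ?ds" "X22 \<in> gmats ?es ?es"
      using gmats_four_blockD(1,4)[OF unit_inverse(1)[OF X], unfolded N,
          OF c(1) zero_carrier_mat zero_carrier_mat c(2)] by auto
    then show ?thesis
      using graded_det_eq_gdet[OF len(1) even_degrees_parity, of X11]
        graded_det_eq_gdet[OF len(2) odd_degrees_parity, of X22]
      by (simp add: det1_def det2_def graded_mats_eq_gmats[OF len(1)] graded_mats_eq_gmats[OF len(2)])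
  qed
  have "(0 :: bit) + 1 = 1" by simp
  from berezinian_exists_unique[OF pds pes this, unfolded N, folded U_def]
  show ?thesis
    unfolding G by (simp add: det cong: conj_cong imp_cong)
qed

end
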